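(* Let $k\ge 1$ be an integer and let $(J,\mathcal{B},\eta)$ be a $k$-loose Markov space. Then every finite simple graph of girth at least $5$ and with all degrees at most $k$ is well-measured in $\eta$.
   Context: A Markov space $(J,\mathcal{B},\eta)$ is a standard Borel space $(J,\mathcal{B})$ with a probability measure $\eta$ on $\mathcal{B}\times\mathcal{B}$ that is symmetric ($\eta(A\times B)=\eta(B\times A)$). Its marginal is $\pi(A)=\eta(A\times J)$. For a finite set $S$, $\mathcal{B}^S$ denotes the product sigma-algebra on $J^S$. Disintegrating $\eta$ with respect to $\pi$ gives probability measures $(P_x:x\in J)$ with $\eta(A\times B)=\int_A P_x(B)\,d\pi(x)$. $k$-looseness: choose $x$ from $\pi$ and then $y_1,\dots,y_k$ independently (conditionally on $x$) from $P_x$. Let $\sigma_k$ be the joint distribution of $(y_1,\dots,y_k)$. The Markov space is $k$-loose if $\sigma_k$ is absolutely continuous with respect to $\pi^k$. Let $G=(V,E)$ be a finite simple graph, and $(\mu_S:S\subseteq V)$ a family of sigma-finite measures, $\mu_S$ on $(J^S,\mathcal{B}^S)$. - The family is decreasing if for all $S\subseteq T\subseteq V$ the marginal of $\mu_T$ on $J^S$ is absolutely continuous with respect to $\mu_S$. In this case, there is a measurable family $(\nu_{S,T,x}:x\in J^S)$ of measures on $\mathcal{B}^{T\setminus S}$ (unique up to changes for $x$ in a $\mu_S$-null set) such that $\mu_T(A\times B)=\int_A \nu_{S,T,x}(B)\,d\mu_S(x)$ for $A\in\mathcal{B}^S$, $B\in\mathcal{B}^{T\setminus S}$. - The family is Markovian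 (with respect to $G$) if it is decreasing, and for any $U,W\subseteq V$ with $S=U\cap W$ such that no edge of $G$ connects $U\setminus S$ and $W\setminus S$, we have $\nu_{S,U\cup W,x}=\nu_{S,U,x}\times\nu_{S,W,x}$ for $\mu_S$-almost all $x\in J^S$. - The family is normalized if $\mu_S=\pi$ whenever $|S|=1$, $\mu_S=\eta$ whenever $S=\{i,j\}$ with $ij\in E$, and $\mu_\emptyset$ is the unit mass on the one-point space $J^\emptyset$. $G$ is well-measured in $\eta$ if there is a family $(\mu_S:S\subseteq V)$ that is normalized, decreasing and Markovian with respect to $G$. *)

theory Defs
  imports "HOL-Probability.Probability"
begin

section \<open>Markov spaces\<close>

text \<open>Only the space and the sigma-algebra of the first argument matter here and below; the
  values of \<open>J\<close> as a measure are never used.\<close>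

definition standard_borel :: "'a measure \<Rightarrow> bool" where
  "standard_borel J \<longleftrightarrow>
     (\<exists>X. completely_metrizable_space X \<and> separable_space X \<and> space J = topspace X \<and>
          sets J = sigma_sets (topspace X) {U. openin X U})"

locale markov_space = prob_space \<eta>
  for J :: "'a measure" and \<eta> :: "('a \<times> 'a) measure" +
  assumes standard_borel: "standard_borel J"
    and sets_eta: "sets \<eta> = sets (J \<Otimes>\<^sub>M J)"
    and symmetric:
      "\<And>A B. A \<in> sets J \<Longrightarrow> B \<in> sets J \<Longrightarrow> emeasure \<eta> (A \<times> B) = emeasure \<eta> (B \<times> A)"

definition marginal :: "'a measure \<Rightarrow> ('a \<times> 'a) measure \<Rightarrow> 'a measure" where
  "marginal J \<eta> = distr \<eta> J fst"

definition transition_kernel ::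
    "'a measure \<Rightarrow> ('a \<times> 'a) measure \<Rightarrow> ('a \<Rightarrow> 'a measure) \<Rightarrow> bool" where
  "transition_kernel J \<eta> P \<longleftrightarrow>
     P \<in> J \<rightarrow>\<^sub>M prob_algebra J \<and>
     (\<forall>A\<in>sets J. \<forall>B\<in>sets J.
        emeasure \<eta> (A \<times> B) = (\<integral>\<^sup>+x\<in>A. emeasure (P x) B \<partial>(marginal J \<eta>)))"

definition neighbor_distribution ::
    "nat \<Rightarrow> 'a measure \<Rightarrow> ('a \<times> 'a) measure \<Rightarrow> ('a \<Rightarrow> 'a measure) \<Rightarrow> (nat \<Rightarrow> 'a) measure" where
  "neighbor_distribution k J \<eta> P = marginal J \<eta> \<bind> (\<lambda>x. \<Pi>\<^sub>M i\<in>{..<k}. P x)"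

text \<open>On a standard Borel space the kernel exists and is unique up to a null set of points, and
  changing it on a null set does not change the neighbor distribution, so the existential
  quantifier involves no choice. Note that the library's \<open>absolutely_continuous M N\<close> means that
  \<open>N\<close> is absolutely continuous with respect to \<open>M\<close>.\<close>

definition k_loose :: "nat \<Rightarrow> 'a measure \<Rightarrow> ('a \<times> 'a) measure \<Rightarrow> bool" where
  "k_loose k J \<eta> \<longleftrightarrow>
     (\<exists>P. transition_kernel J \<eta> P \<and>
          absolutely_continuous (\<Pi>\<^sub>M i\<in>{..<k}. marginal J \<eta>) (neighbor_distribution k J \<eta> P))"


section \<open>Finite simple graphs\<close>

definition simple_graph :: "'v set \<Rightarrow> 'v set set \<Rightarrow> bool" where
  "simple_graph V E \<longleftrightarrow> finite V \<and> (\<forall>e\<in>E. e \<subseteq> V \<and> card e = 2)"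

definition vertex_degree :: "'v set set \<Rightarrow> 'v \<Rightarrow> nat" where
  "vertex_degree E v = card {e \<in> E. v \<in> e}"

definition cycles :: "'v set set \<Rightarrow> 'v list set" where
  "cycles E = {p. 3 \<le> length p \<and> distinct p \<and>
                  (\<forall>i<length p. {p ! i, p ! (Suc i mod length p)} \<in> E)}"

text \<open>The girth of a forest is \<open>\<infinity>\<close>, the infimum of the empty set.\<close>

definition girth :: "'v set set \<Rightarrow> enat" where
  "girth E = (INF p\<in>cycles E. enat (length p))"


section \<open>Families of measures indexed by vertex sets\<close>

definition measure_family ::
    "'a measure \<Rightarrow> 'v set \<Rightarrow> ('v set \<Rightarrow> ('v \<Rightarrow> 'a) measure) \<Rightarrow> bool" where
  "measure_family J V \<mu> \<longleftrightarrow>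
     (\<forall>S\<subseteq>V. sets (\<mu> S) = sets (\<Pi>\<^sub>M i\<in>S. J) \<and> sigma_finite_measure (\<mu> S))"

definition decreasing ::
    "'a measure \<Rightarrow> 'v set \<Rightarrow> ('v set \<Rightarrow> ('v \<Rightarrow> 'a) measure) \<Rightarrow> bool" where
  "decreasing J V \<mu> \<longleftrightarrow>
     (\<forall>T\<subseteq>V. \<forall>S\<subseteq>T.
        absolutely_continuous (\<mu> S) (distr (\<mu> T) (\<Pi>\<^sub>M i\<in>S. J) (\<lambda>x. restrict x S)))"

text \<open>The space \<open>J\<^sup>T\<close> is identified with \<open>J\<^sup>S \<times> J\<^bsup>T - S\<^esup>\<close> by \<open>merge S (T - S)\<close>. The disintegration
  identity is required for every measurable \<open>C \<subseteq> J\<^sup>T\<close>, with \<open>\<nu> x\<close> evaluated at the section of \<open>C\<close>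
  over \<open>x\<close>; for \<open>C = A \<times> B\<close> it reads \<open>\<mu>T (A \<times> B) = \<integral>\<^sub>A \<nu> x B d\<mu>S\<close>, and \<open>C = J\<^sup>S \<times> B\<close> gives the
  measurability of \<open>x \<mapsto> \<nu> x B\<close>. Rectangles alone would not do: a sigma-finite measure on \<open>J\<^sup>T\<close>
  may assign only the values \<open>0\<close> and \<open>\<infinity>\<close> to rectangles, and then they do not determine \<open>\<nu>\<close>.
  With all \<open>C\<close>, \<open>\<nu> x\<close> is sigma-finite and uniquely determined for almost all \<open>x\<close>.\<close>

definition disintegration ::
    "'a measure \<Rightarrow> 'v set \<Rightarrow> 'v set \<Rightarrow> ('v \<Rightarrow> 'a) measure \<Rightarrow> ('v \<Rightarrow> 'a) measure \<Rightarrow>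
     (('v \<Rightarrow> 'a) \<Rightarrow> ('v \<Rightarrow> 'a) measure) \<Rightarrow> bool" where
  "disintegration J S T \<mu>S \<mu>T \<nu> \<longleftrightarrow>
     (\<forall>x\<in>space (\<Pi>\<^sub>M i\<in>S. J). sets (\<nu> x) = sets (\<Pi>\<^sub>M i\<in>T - S. J)) \<and>
     (\<forall>C\<in>sets (\<Pi>\<^sub>M i\<in>T. J).
        let \<nu>C = (\<lambda>x. emeasure (\<nu> x) {y \<in> space (\<Pi>\<^sub>M i\<in>T - S. J). merge S (T - S) (x, y) \<in> C})
        in \<nu>C \<in> borel_measurable (\<Pi>\<^sub>M i\<in>S. J) \<and> emeasure \<mu>T C = (\<integral>\<^sup>+x. \<nu>C x \<partial>\<mu>S))"

text \<open>Since the disintegrations are unique almost everywhere, it does not matter which versions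
  \<open>\<nu> S T\<close> are used.\<close>

definition markovian ::
    "'a measure \<Rightarrow> 'v set \<Rightarrow> 'v set set \<Rightarrow> ('v set \<Rightarrow> ('v \<Rightarrow> 'a) measure) \<Rightarrow> bool" where
  "markovian J V E \<mu> \<longleftrightarrow> decreasing J V \<mu> \<and>
     (\<exists>\<nu>. (\<forall>T\<subseteq>V. \<forall>S\<subseteq>T. disintegration J S T (\<mu> S) (\<mu> T) (\<nu> S T)) \<and>
          (\<forall>U W S. U \<subseteq> V \<longrightarrow> W \<subseteq> V \<longrightarrow> S = U \<inter> W \<longrightarrow>
             (\<forall>u\<in>U - S. \<forall>w\<in>W - S. {u, w} \<notin> E) \<longrightarrow>
             (AE x in \<mu> S. \<nu> S (U \<union> W) x =
                distr (\<nu> S U x \<Otimes>\<^sub>M \<nu> S W x) (\<Pi>\<^sub>M i\<in>(U \<union> W) - S. J) (merge (U - S) (W - S)))))"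

definition normalized ::
    "'a measure \<Rightarrow> ('a \<times> 'a) measure \<Rightarrow> 'v set \<Rightarrow> 'v set set \<Rightarrow>
     ('v set \<Rightarrow> ('v \<Rightarrow> 'a) measure) \<Rightarrow> bool" where
  "normalized J \<eta> V E \<mu> \<longleftrightarrow>
     (\<forall>i\<in>V. \<mu> {i} = distr (marginal J \<eta>) (\<Pi>\<^sub>M l\<in>{i}. J) (\<lambda>x. \<lambda>l\<in>{i}. x)) \<and>
     (\<forall>i j. {i, j} \<in> E \<longrightarrow>
        \<mu> {i, j} = distr \<eta> (\<Pi>\<^sub>M l\<in>{i, j}. J) (\<lambda>(x, y). \<lambda>l\<in>{i, j}. if l = i then x else y)) \<and>
     \<mu> {} = return (\<Pi>\<^sub>M l\<in>{}. J) (\<lambda>l. undefined)"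

definition well_measured ::
    "'a measure \<Rightarrow> ('a \<times> 'a) measure \<Rightarrow> 'v set \<Rightarrow> 'v set set \<Rightarrow> bool" where
  "well_measured J \<eta> V E \<longleftrightarrow>
     (\<exists>\<mu>. measure_family J V \<mu> \<and> normalized J \<eta> V E \<mu> \<and> decreasing J V \<mu> \<and> markovian J V E \<mu>)"

end

theory Submission
  imports Defs
begin

text \<open>If \<open>\<eta>\<close> had a density \<open>w\<close> with respect to \<open>\<pi> \<times> \<pi>\<close>, one could give \<open>\<mu> T\<close> the density
  \<open>\<Prod>w(x\<^sub>i, x\<^sub>j)\<close>, the product being over the edges inside \<open>T\<close>, with respect to \<open>\<pi>\<^sup>T\<close>. In general \<open>\<eta>\<close> is
  singular, and \<open>\<mu> T\<close> is built by adding vertices one at a time. Let \<open>v\<close> be added to \<open>S\<close>, and let \<open>N\<close> be the set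
  of its neighbors in \<open>S\<close>. Consider a star: a center \<open>x\<close> chosen from \<open>\<pi>\<close> and leaves \<open>y\<^sub>i\<close>, \<open>i \<in> N\<close>, chosen
  independently from \<open>P x\<close>. As \<open>N\<close> has at most \<open>k\<close> elements, looseness makes the distribution of the leaves
  absolutely continuous with respect to \<open>\<pi>\<^sup>N\<close>, so the star disintegrates into \<open>\<pi>\<^sup>N(dy)\<close> and finite measures
  \<open>\<rho> N y\<close> for the center (\<open>star_kernel_exists\<close>). These distribute the new coordinate, given the old
  coordinates in \<open>N\<close>; \<open>iter\<close> is the resulting iterated integral.

  The kernel for \<open>v\<close> sees only the neighbors of \<open>v\<close>. Hence two consecutive nonadjacent vertices may be
  swapped by Fubini's theorem, and this yields the product form required by the Markov property, without
  exceptional points (\<open>family_kernel_union\<close>). What has to be shown is that \<open>\<mu> T\<close> does not depend on the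
  order of the vertices (\<open>iter_permute\<close>): then a subset \<open>S\<close> may be added first, so the remaining steps
  disintegrate \<open>\<mu> T\<close> over \<open>\<mu> S\<close>, and the family is decreasing.

  It remains to swap two consecutive adjacent vertices \<open>u\<close> and \<open>v\<close>. Let \<open>A\<close> and \<open>B\<close> be their sets of earlier
  neighbors. By the girth condition \<open>A\<close> and \<open>B\<close> are disjoint and \<open>A \<union> B\<close> is independent. If the coordinates
  in \<open>A \<union> B\<close> have distribution \<open>\<pi>\<^bsup>A \<union> B\<^esup>\<close>, then in both orders all the coordinates together are
  distributed as a random edge from \<open>\<eta>\<close> with random neighbors, indexed by \<open>A\<close> and \<open>B\<close>, of its two ends;
  this combines two star identities with the symmetry of \<open>\<eta>\<close> (\<open>iter_double_star\<close>). So the two conditional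
  distributions of the coordinates of \<open>u\<close> and \<open>v\<close> agree outside of a null set of \<open>\<pi>\<^bsup>A \<union> B\<^esup>\<close>. That set
  is negligible for the measure built so far, because by induction the earlier vertices may be reordered
  to begin with \<open>A \<union> B\<close>, and for an independent set the construction gives a power of \<open>\<pi>\<close>.

  The star kernels require regular conditional distributions. They are obtained from conditional
  distribution functions, after coding the standard Borel space \<open>J\<close> by real numbers.\<close>

section \<open>Coding standard Borel spaces by real numbers\<close>

definition ternary :: "(nat \<Rightarrow> bool) \<Rightarrow> real" where
  "ternary b = (\<Sum>i. if b i then (1/3) ^ Suc i else 0)"

text \<open>Digits are read off by rounding down, which needs a tail smaller than one unit. With only the
  digits \<open>0\<close> and \<open>1\<close> in base \<open>3\<close> the tail is at most \<open>1/2\<close>; in base \<open>2\<close> it could be \<open>1\<close>.\<close>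

definition ternary_digit :: "nat \<Rightarrow> real \<Rightarrow> bool" where
  "ternary_digit i t \<longleftrightarrow> \<lfloor>3 ^ Suc i * t\<rfloor> mod 3 = 1"

lemma summable_ternary: "summable (\<lambda>i. if b i then (1/3) ^ Suc i else (0::real))"
  by (rule summable_comparison_test[where g="\<lambda>i. (1/3) ^ Suc i"])
     (auto intro!: exI[of _ 0] simp: summable_geometric)

lemma ternary_nonneg: "0 \<le> ternary b"
  unfolding ternary_def by (rule suminf_nonneg[OF summable_ternary]) auto

lemma ternary_le_half: "ternary b \<le> 1/2"
proof -
  have "ternary b \<le> (\<Sum>i. (1/3) ^ Suc i)"
    unfolding ternary_def by (rule suminf_le[OF _ summable_ternary]) (auto simp: summable_geometric)
  also have "\<dots> = 1/2"
    using sums_mult[OF geometric_sums[of "1/3::real"], of "1/3"]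
    by (auto simp: sums_iff)
  finally show ?thesis .
qed

lemma ternary_shift: "ternary b = ((if b 0 then 1 else 0) + ternary (\<lambda>i. b (Suc i))) / 3"
proof -
  have "ternary b = (\<Sum>i. if b (Suc i) then (1/3) ^ Suc (Suc i) else 0) + (if b 0 then 1/3 else 0)"
    unfolding ternary_def using suminf_split_head[OF summable_ternary, of b] by simp
  also have "(\<Sum>i. if b (Suc i) then (1/3) ^ Suc (Suc i) else (0::real))
      = (1/3) * (\<Sum>i. if b (Suc i) then (1/3) ^ Suc i else 0)"
    by (subst suminf_mult[OF summable_ternary, symmetric]) (auto intro!: arg_cong[where f=suminf])
  finally show ?thesis by (simp add: ternary_def field_simps)
qed

lemma ternary_digit_ternary: "ternary_digit i (ternary b) \<longleftrightarrow> b i"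
proof (induction i arbitrary: b)
  case 0
  have "\<lfloor>3 * ternary b\<rfloor> = (if b 0 then 1 else 0)"
    using ternary_nonneg[of "\<lambda>i. b (Suc i)"] ternary_le_half[of "\<lambda>i. b (Suc i)"]
    by (subst ternary_shift) (auto simp: floor_eq_iff)
  then show ?case by (auto simp: ternary_digit_def)
next
  case (Suc i)
  let ?t = "ternary (\<lambda>i. b (Suc i))"
  let ?z = "if b 0 then 3 ^ i else 0 :: int"
  have "3 ^ Suc (Suc i) * ternary b = 3 ^ Suc i * ?t + of_int (3 * ?z)"
    by (subst ternary_shift) (auto simp: algebra_simps)
  then have "\<lfloor>3 ^ Suc (Suc i) * ternary b\<rfloor> = \<lfloor>3 ^ Suc i * ?t\<rfloor> + 3 * ?z"
    by (metis floor_add_int)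
  then have "\<lfloor>3 ^ Suc (Suc i) * ternary b\<rfloor> mod 3 = \<lfloor>3 ^ Suc i * ?t\<rfloor> mod 3"
    by (metis mod_mult_self2)
  then show ?case using Suc.IH[of "\<lambda>i. b (Suc i)"] by (auto simp: ternary_digit_def)
qed

lemma pred_ternary_digit[measurable]: "Measurable.pred borel (ternary_digit i)"
  unfolding ternary_digit_def by measurable

text \<open>The steps form a geometric series, so completeness gives a limit, and the tail of the series
  bounds the distance to it. The explicit rate makes the limit a measurable function of the sequence.\<close>

lemma (in Metric_space) rapidly_Cauchy_limit:
  assumes "mcomplete" and x: "\<And>n. x n \<in> M" and step: "\<And>n. d (x n) (x (Suc n)) < 2 * (1/2) ^ n"
  shows "\<exists>l\<in>M. \<forall>n. d (x n) l \<le> 4 * (1/2) ^ n"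
proof -
  have far: "d (x n) (x (n + k)) \<le> 4 * (1/2) ^ n - 4 * (1/2) ^ (n + k)" for n k
  proof (induction k)
    case (Suc k)
    have "d (x n) (x (n + Suc k)) \<le> d (x n) (x (n + k)) + d (x (n + k)) (x (Suc (n + k)))"
      using triangle x by simp
    with Suc step[of "n + k"] show ?case by simp
  qed (simp add: x)
  have dist: "d (x n) (x m) \<le> 4 * (1/2) ^ n" if "n \<le> m" for n m
  proof -
    have "d (x n) (x m) \<le> 4 * (1/2) ^ n - 4 * (1/2) ^ m" using far[of n "m - n"] that by simp
    also have "\<dots> \<le> 4 * (1/2) ^ n" by simp
    finally show ?thesis .
  qed
  have "MCauchy x"
    unfolding MCauchy_def
  proof safe
    fix e :: real assume "0 < e"
    obtain N where N: "(1/2::real) ^ N < e / 4"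
      using real_arch_pow_inv[of "e/4" "1/2"] \<open>0 < e\<close> by auto
    have "d (x n) (x n') < e" if "N \<le> n" "N \<le> n'" for n n'
    proof -
      have *: "d (x a) (x b) < e" if "N \<le> a" "a \<le> b" for a b
      proof -
        have "(1/2::real) ^ a \<le> (1/2) ^ N" using that by (intro power_decreasing) auto
        then show ?thesis using dist[OF \<open>a \<le> b\<close>] N by linarith
      qed
      show ?thesis using *[of n n'] *[of n' n] that commute[of "x n" "x n'"] by linarith
    qed
    then show "\<exists>N. \<forall>n n'. N \<le> n \<longrightarrow> N \<le> n' \<longrightarrow> d (x n) (x n') < e" by blast
  qed (use x in auto)
  with \<open>mcomplete\<close> obtain l where l: "limitin mtopology x l sequentially"
    unfolding mcomplete_def by blast
  have "l \<in> M" using l by (simp add: limitin_mspace)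
  moreover have "d (x n) l \<le> 4 * (1/2) ^ n" for n
  proof (rule field_le_epsilon)
    fix e :: real assume "0 < e"
    with l obtain N where N: "\<And>m. m \<ge> N \<Longrightarrow> d (x m) l < e"
      unfolding limit_metric_sequentially by blast
    have "d (x n) l \<le> d (x n) (x (max n N)) + d (x (max n N)) l"
      using triangle x \<open>l \<in> M\<close> by simp
    then show "d (x n) l \<le> 4 * (1/2) ^ n + e"
      using N[of "max n N"] dist[of n "max n N"] by simp
  qed
  ultimately show ?thesis by blast
qed

text \<open>Every standard Borel space is a measurable retract of the real line. The code of a point records
  as ternary digits in which balls \<open>B(q i, (1/2)^n)\<close> around a countable dense set it lies; the point is
  recovered as the limit of the first centers. A measurable left inverse \<open>g\<close> is all that is needed to
  transport kernels from the line, so the image of the coding need not be shown to be a Borel set.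
  The bounds on \<open>c\<close> make distribution functions of the coded point constant outside \<open>[0, 1]\<close>.\<close>

lemma standard_borel_real_coding:
  assumes "standard_borel J" and ne: "space J \<noteq> {}"
  obtains c :: "'a \<Rightarrow> real" and g where "c \<in> borel_measurable J" "g \<in> borel \<rightarrow>\<^sub>M J"
    "\<And>x. x \<in> space J \<Longrightarrow> g (c x) = x" "\<And>x. 0 \<le> c x" "\<And>x. c x \<le> 1"
proof -
  from assms(1) obtain X where X: "completely_metrizable_space X" "separable_space X"
    and spX: "space J = topspace X" and setsX: "sets J = sigma_sets (topspace X) {U. openin X U}"
    unfolding standard_borel_def by blast
  from X(1) obtain M d where "Metric_space M d" and comp: "Metric_space.mcomplete M d"
    and XM: "X = Metric_space.mtopology M d"
    unfolding completely_metrizable_space_def by blast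
  then interpret Metric_space M d by simp
  have spJ: "space J = M" by (simp add: spX XM)
  have setsJ: "sets J = sigma_sets M {U. openin mtopology U}" by (simp add: setsX XM)
  have open_sets: "openin mtopology U \<Longrightarrow> U \<in> sets J" for U
    unfolding setsJ by (rule sigma_sets.Basic) simp
  from X(2) obtain C where C: "countable C" "C \<subseteq> M" "mtopology closure_of C = M"
    unfolding separable_space_def XM by auto
  have "C \<noteq> {}" using C(3) ne spJ by auto
  define q where "q = from_nat_into C"
  have q: "q i \<in> M" for i using from_nat_into[OF \<open>C \<noteq> {}\<close>, of i] C(2) by (auto simp: q_def)
  have dense: "\<exists>i. d (q i) x < e" if "x \<in> M" "0 < e" for x e
  proof -
    have "x \<in> mtopology closure_of C" using C(3) that by simp
    with \<open>0 < e\<close> have "\<exists>y\<in>C. y \<in> mball x e" unfolding metric_closure_of by blast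
    then obtain y where "y \<in> C" "y \<in> mball x e" by blast
    moreover obtain i where "y = q i"
      using from_nat_into_surj[OF C(1) \<open>y \<in> C\<close>] by (auto simp: q_def)
    ultimately show ?thesis by (auto simp: commute)
  qed
  define c where "c x = ternary (\<lambda>p. case prod_decode p of (n, i) \<Rightarrow> x \<in> mball (q i) ((1/2) ^ n))" for x
  \<comment> \<open>\<open>q (ix t n)\<close> is the center of the first ball of radius \<open>(1/2) ^ n\<close> that the digits of \<open>t\<close> announce.\<close>
  define ix where "ix t n = (LEAST i. ternary_digit (prod_encode (n, i)) t)" for t n
  define good where "good t \<longleftrightarrow> (\<forall>n. d (q (ix t n)) (q (ix t (Suc n))) < 2 * (1/2) ^ n)" for t
  define g where
    "g t = (if good t then SOME l. l \<in> M \<and> (\<forall>n. d (q (ix t n)) l \<le> 4 * (1/2) ^ n) else q 0)" for t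
  have ix_meas[measurable]: "(\<lambda>t. ix t n) \<in> borel \<rightarrow>\<^sub>M count_space UNIV" for n
    unfolding ix_def by measurable
  have good_meas[measurable]: "Measurable.pred borel good"
    unfolding good_def by measurable
  have g_good: "g t \<in> M \<and> (\<forall>n. d (q (ix t n)) (g t) \<le> 4 * (1/2) ^ n)" if "good t" for t
    using someI_ex[of "\<lambda>l. l \<in> M \<and> (\<forall>n. d (q (ix t n)) l \<le> 4 * (1/2) ^ n)"]
      rapidly_Cauchy_limit[OF comp, of "\<lambda>n. q (ix t n)"] that q
    unfolding g_def good_def by auto
  have g_M: "g t \<in> M" for t using g_good[of t] q by (cases "good t") (auto simp: g_def)
  have c_meas: "c \<in> borel_measurable J"
  proof -
    have [measurable]: "Measurable.pred J (\<lambda>x. case prod_decode p of (n, i) \<Rightarrow> x \<in> mball (q i) ((1/2) ^ n))" for p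
    proof -
      obtain n i where p: "prod_decode p = (n, i)" by force
      have "mball (q i) ((1/2) ^ n) \<in> sets J" by (rule open_sets) simp
      then show ?thesis by (simp only: p prod.case) (rule pred_sets2[of _ _ "\<lambda>x. x"], auto)
    qed
    show ?thesis unfolding c_def ternary_def by measurable
  qed
  have gc: "g (c x) = x" if "x \<in> space J" for x
  proof -
    have x: "x \<in> M" using that by (simp add: spJ)
    have dig: "ternary_digit (prod_encode (n, i)) (c x) \<longleftrightarrow> d (q i) x < (1/2) ^ n" for n i
      unfolding c_def ternary_digit_ternary using x q by simp
    have near: "d (q (ix (c x) n)) x < (1/2) ^ n" for n
      using LeastI_ex[of "\<lambda>i. ternary_digit (prod_encode (n, i)) (c x)"] dense[OF x, of "(1/2) ^ n"]
      by (simp add: dig ix_def)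
    have "good (c x)"
      unfolding good_def
    proof
      fix n
      have "d (q (ix (c x) n)) (q (ix (c x) (Suc n)))
          \<le> d (q (ix (c x) n)) x + d (q (ix (c x) (Suc n))) x"
        using q x by (metis commute triangle)
      also have "\<dots> < (1/2) ^ n + (1/2) ^ Suc n" using near[of n] near[of "Suc n"] by linarith
      also have "\<dots> \<le> 2 * (1/2) ^ n" by simp
      finally show "d (q (ix (c x) n)) (q (ix (c x) (Suc n))) < 2 * (1/2) ^ n" .
    qed
    then have g: "d (q (ix (c x) n)) (g (c x)) \<le> 4 * (1/2) ^ n" for n using g_good by blast
    have "d (g (c x)) x \<le> 0 + e" if "0 < e" for e
    proof -
      obtain n where n: "(1/2::real) ^ n < e / 5"
        using real_arch_pow_inv[of "e/5" "1/2"] \<open>0 < e\<close> by auto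
      have "d (g (c x)) x \<le> d (q (ix (c x) n)) (g (c x)) + d (q (ix (c x) n)) x"
        using triangle[of "g (c x)" "q (ix (c x) n)" x] q x g_M commute[of "g (c x)" "q (ix (c x) n)"] by simp
      also have "\<dots> \<le> 5 * (1/2) ^ n" using g[of n] near[of n] by linarith
      finally show ?thesis using n by simp
    qed
    then have "d (g (c x)) x \<le> 0" by (rule field_le_epsilon)
    then show ?thesis using x g_M by (metis antisym nonneg zero)
  qed
  \<comment> \<open>The limit lies within \<open>4 * (1/2) ^ n\<close> of the \<open>n\<close>-th center, hence the test with margin \<open>5 * (1/2) ^ n\<close>.\<close>
  have ball_meas: "g -` mball (q a) r \<in> sets borel" for a r
  proof -
    have "(g t \<in> mball (q a) r) \<longleftrightarrow>
        (if good t then \<exists>n. d (q (ix t n)) (q a) + 5 * (1/2) ^ n < r else q 0 \<in> mball (q a) r)" for t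
    proof (cases "good t")
      case True
      note g = g_good[OF True]
      have "d (q a) (g t) < r" if "d (q (ix t n)) (q a) + 5 * (1/2) ^ n < r" for n
      proof -
        have "d (q a) (g t) \<le> d (q (ix t n)) (q a) + d (q (ix t n)) (g t)"
          using triangle[of "q a" "q (ix t n)" "g t"] commute[of "q a" "q (ix t n)"] q g by simp
        moreover have "d (q (ix t n)) (g t) \<le> 4 * (1/2) ^ n" "0 < (1/2::real) ^ n" using g by auto
        ultimately show ?thesis using that by linarith
      qed
      moreover have "\<exists>n. d (q (ix t n)) (q a) + 5 * (1/2) ^ n < r" if less: "d (q a) (g t) < r"
      proof -
        obtain n where n: "(1/2::real) ^ n < (r - d (q a) (g t)) / 9"
          using real_arch_pow_inv[of "(r - d (q a) (g t)) / 9" "1/2"] less by auto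
        have "d (q (ix t n)) (q a) \<le> d (q (ix t n)) (g t) + d (q a) (g t)"
          using triangle[of "q (ix t n)" "g t" "q a"] commute[of "q a" "g t"] q g by simp
        moreover have "d (q (ix t n)) (g t) \<le> 4 * (1/2) ^ n" using g by auto
        moreover have "9 * (1/2) ^ n < r - d (q a) (g t)" using n by simp
        ultimately have "d (q (ix t n)) (q a) + 5 * (1/2) ^ n < r" by linarith
        then show ?thesis by blast
      qed
      ultimately show ?thesis using True q g by auto
    qed (simp add: g_def)
    then have "g -` mball (q a) r = {t \<in> space borel. if good t then
       \<exists>n. d (q (ix t n)) (q a) + 5 * (1/2) ^ n < r else q 0 \<in> mball (q a) r}" by auto
    also have "\<dots> \<in> sets borel" by measurable
    finally show ?thesis .
  qed
  have g_meas: "g \<in> borel \<rightarrow>\<^sub>M J"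
  proof (rule measurable_sigma_sets[OF setsJ])
    show "{U. openin mtopology U} \<subseteq> Pow M" by (auto simp: openin_mtopology)
    fix U assume "U \<in> {U. openin mtopology U}"
    then have U: "openin mtopology U" by simp
    define K where "K = {(a, m). mball (q a) ((1/2) ^ m) \<subseteq> U}"
    have "U = (\<Union>(a, m)\<in>K. mball (q a) ((1/2) ^ m))"
    proof safe
      fix x assume "x \<in> U"
      with U obtain r where r: "0 < r" "mball x r \<subseteq> U" "x \<in> M"
        unfolding openin_mtopology by blast
      obtain m where m: "(1/2::real) ^ m < r / 2"
        using real_arch_pow_inv[of "r/2" "1/2"] r by auto
      obtain a where a: "d (q a) x < (1/2) ^ m" using dense[OF r(3), of "(1/2) ^ m"] by auto
      have "mball (q a) ((1/2) ^ m) \<subseteq> mball x r"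
        using a m r q commute[of "q a" x] by (intro mball_subset) auto
      then show "x \<in> (\<Union>(a, m)\<in>K. mball (q a) ((1/2) ^ m))"
        using r a q by (auto simp: K_def intro!: bexI[of _ "(a, m)"])
    qed (auto simp: K_def)
    then have "g -` U \<inter> space borel = (\<Union>(a, m)\<in>K. g -` mball (q a) ((1/2) ^ m))" by auto
    also have "\<dots> \<in> sets borel" by (intro sets.countable_UN'') (auto simp: ball_meas)
    finally show "g -` U \<inter> space borel \<in> sets borel" .
  qed (use g_M in auto)
  show ?thesis by (rule that[OF c_meas g_meas gc])
      (auto simp: c_def ternary_nonneg order_trans[OF ternary_le_half])
qed

section \<open>Finite kernels and measures given by functionals\<close>

text \<open>The fibres are finite, but their masses need not be bounded: below they are the values of the densities
  of neighbor distributions. So such a kernel need not map into \<open>subprob_algebra\<close>.\<close>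

definition finite_kernel :: "'a measure \<Rightarrow> 'b measure \<Rightarrow> ('a \<Rightarrow> 'b measure) \<Rightarrow> bool" where
  "finite_kernel M N \<kappa> \<longleftrightarrow>
     (\<forall>x\<in>space M. finite_measure (\<kappa> x) \<and> sets (\<kappa> x) = sets N) \<and>
     (\<forall>A\<in>sets N. (\<lambda>x. emeasure (\<kappa> x) A) \<in> borel_measurable M)"

lemma finite_kernelI:
  assumes "\<And>x. x \<in> space M \<Longrightarrow> finite_measure (\<kappa> x)" "\<And>x. x \<in> space M \<Longrightarrow> sets (\<kappa> x) = sets N"
    and "\<And>A. A \<in> sets N \<Longrightarrow> (\<lambda>x. emeasure (\<kappa> x) A) \<in> borel_measurable M"
  shows "finite_kernel M N \<kappa>"
  using assms by (simp add: finite_kernel_def)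

lemma finite_kernelD:
  assumes "finite_kernel M N \<kappa>"
  shows "x \<in> space M \<Longrightarrow> finite_measure (\<kappa> x)" "x \<in> space M \<Longrightarrow> sets (\<kappa> x) = sets N"
    "x \<in> space M \<Longrightarrow> space (\<kappa> x) = space N"
    "A \<in> sets N \<Longrightarrow> (\<lambda>x. emeasure (\<kappa> x) A) \<in> borel_measurable M"
  using assms sets_eq_imp_space_eq[of "\<kappa> x" N] by (auto simp: finite_kernel_def)

lemma finite_kernel_prob_algebra:
  assumes "K \<in> M \<rightarrow>\<^sub>M prob_algebra N"
  shows "finite_kernel M N K"
proof (rule finite_kernelI)
  fix x assume x: "x \<in> space M"
  with assms have "K x \<in> space (prob_algebra N)" by (rule measurable_space)
  then show "finite_measure (K x)" "sets (K x) = sets N"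
    by (auto simp: space_prob_algebra prob_space_def)
next
  fix A assume "A \<in> sets N"
  then show "(\<lambda>x. emeasure (K x) A) \<in> borel_measurable M"
    using measurable_prob_algebraD[OF assms] by measurable
qed

lemma finite_kernel_comp:
  assumes "finite_kernel M N \<kappa>" and "f \<in> L \<rightarrow>\<^sub>M M"
  shows "finite_kernel L N (\<lambda>x. \<kappa> (f x))"
  using finite_kernelD[OF assms(1)] measurable_space[OF assms(2)]
  by (intro finite_kernelI) (auto intro: measurable_compose[OF assms(2)])

text \<open>Dividing the fibres by one plus their mass gives a subprobability kernel, for which the statement is
  known; the factor depends measurably on the base point.\<close>

lemma borel_measurable_nn_integral_kernel:
  assumes \<kappa>: "finite_kernel M N \<kappa>"
    and f: "(\<lambda>(x, y). f x y) \<in> borel_measurable (M \<Otimes>\<^sub>M N)"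
  shows "(\<lambda>x. \<integral>\<^sup>+y. f x y \<partial>\<kappa> x) \<in> borel_measurable M"
proof (cases "space N = {}")
  case True
  then have "(\<integral>\<^sup>+y. f x y \<partial>\<kappa> x) = 0" if "x \<in> space M" for x
    using finite_kernelD(3)[OF \<kappa> that] by (simp add: nn_integral_empty)
  then show ?thesis by (simp cong: measurable_cong)
next
  case False
  define m where "m x = 1 + emeasure (\<kappa> x) (space N)" for x
  have m: "m x \<noteq> 0" "m x \<noteq> \<infinity>" if "x \<in> space M" for x
    using finite_measure.emeasure_finite[OF finite_kernelD(1)[OF \<kappa> that]] by (auto simp: m_def)
  have [measurable]: "m \<in> borel_measurable M"
    unfolding m_def using finite_kernelD(4)[OF \<kappa> sets.top] by measurable
  have "(\<lambda>x. scale_measure (inverse (m x)) (\<kappa> x)) \<in> M \<rightarrow>\<^sub>M subprob_algebra N"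
  proof (rule measurable_subprob_algebra)
    fix x assume x: "x \<in> space M"
    show "sets (scale_measure (inverse (m x)) (\<kappa> x)) = sets N"
      using finite_kernelD(2)[OF \<kappa> x] by simp
    have "emeasure (\<kappa> x) (space N) \<le> m x" by (simp add: m_def)
    then have "emeasure (\<kappa> x) (space N) / m x \<le> 1"
      using m[OF x] by (metis divide_right_mono_ennreal ennreal_divide_self infinity_ennreal_def top.not_eq_extremum)
    then show "subprob_space (scale_measure (inverse (m x)) (\<kappa> x))"
      using False finite_kernelD(3)[OF \<kappa> x]
      by (intro subprob_spaceI) (auto simp: space_scale_measure divide_ennreal_def mult.commute)
  next
    fix A assume "A \<in> sets N"
    then have [measurable]: "(\<lambda>x. emeasure (\<kappa> x) A) \<in> borel_measurable M"
      by (rule finite_kernelD(4)[OF \<kappa>])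
    show "(\<lambda>x. emeasure (scale_measure (inverse (m x)) (\<kappa> x)) A) \<in> borel_measurable M"
      by simp
  qed
  from nn_integral_measurable_subprob_algebra2[OF f this]
  have [measurable]: "(\<lambda>x. \<integral>\<^sup>+y. f x y \<partial>scale_measure (inverse (m x)) (\<kappa> x)) \<in> borel_measurable M" .
  have "(\<lambda>x. m x * (\<integral>\<^sup>+y. f x y \<partial>scale_measure (inverse (m x)) (\<kappa> x))) \<in> borel_measurable M"
    by measurable
  moreover have "(\<integral>\<^sup>+y. f x y \<partial>\<kappa> x) = m x * (\<integral>\<^sup>+y. f x y \<partial>scale_measure (inverse (m x)) (\<kappa> x))"
    if x: "x \<in> space M" for x
  proof -
    have "f x \<in> borel_measurable (\<kappa> x)"
      using measurable_Pair2[OF f x] measurable_cong_sets[OF finite_kernelD(2)[OF \<kappa> x] refl] by auto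
    then have "m x * (\<integral>\<^sup>+y. f x y \<partial>scale_measure (inverse (m x)) (\<kappa> x))
        = (m x * inverse (m x)) * (\<integral>\<^sup>+y. f x y \<partial>\<kappa> x)"
      by (simp add: nn_integral_scale_measure mult.assoc)
    also have "m x * inverse (m x) = 1"
      using m[OF x] ennreal_divide_self[of "m x"] by (simp add: divide_ennreal_def less_top)
    finally show ?thesis by simp
  qed
  ultimately show ?thesis by (simp cong: measurable_cong)
qed

lemma finite_kernel_const:
  assumes "finite_measure m" "sets m = sets N"
  shows "finite_kernel L N (\<lambda>_. m)"
  using assms by (intro finite_kernelI) auto

lemma borel_measurable_nn_integral_comp:
  assumes "finite_kernel M N \<kappa>" "k \<in> L \<rightarrow>\<^sub>M M" "(\<lambda>z. h (fst z) (snd z)) \<in> borel_measurable (L \<Otimes>\<^sub>M N)"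
  shows "(\<lambda>w. \<integral>\<^sup>+t. h w t \<partial>\<kappa> (k w)) \<in> borel_measurable L"
  using assms(3) by (intro borel_measurable_nn_integral_kernel[OF finite_kernel_comp[OF assms(1,2)]])
    (simp add: case_prod_beta')

lemma nn_integral_swap:
  assumes "finite_measure M1" "finite_measure M2" "sets M1 = sets N1" "sets M2 = sets N2"
    and f: "(\<lambda>(a, b). f a b) \<in> borel_measurable (N1 \<Otimes>\<^sub>M N2)"
  shows "(\<integral>\<^sup>+a. (\<integral>\<^sup>+b. f a b \<partial>M2) \<partial>M1) = (\<integral>\<^sup>+b. (\<integral>\<^sup>+a. f a b \<partial>M1) \<partial>M2)"
proof -
  interpret M1: finite_measure M1 by fact
  interpret M2: finite_measure M2 by fact
  interpret pair_sigma_finite M2 M1 ..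
  have "(\<lambda>(b, a). f a b) \<in> borel_measurable (N2 \<Otimes>\<^sub>M N1)"
    using measurable_compose[OF measurable_pair_swap' f] by (simp add: case_prod_beta')
  then have "(\<lambda>(b, a). f a b) \<in> borel_measurable (M2 \<Otimes>\<^sub>M M1)"
    using measurable_cong_sets[OF sets_pair_measure_cong[OF assms(4,3)] refl] by blast
  from Fubini'[OF this] show ?thesis by simp
qed

lemma nn_integral_le_1:
  assumes "prob_space M" "\<And>x. x \<in> space M \<Longrightarrow> h x \<le> (1::ennreal)"
  shows "(\<integral>\<^sup>+x. h x \<partial>M) \<le> 1"
proof -
  have "(\<integral>\<^sup>+x. h x \<partial>M) \<le> (\<integral>\<^sup>+x. 1 \<partial>M)" using assms(2) by (rule nn_integral_mono)
  also have "\<dots> = 1" using prob_space.emeasure_space_1[OF assms(1)] by simp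
  finally show ?thesis .
qed

text \<open>With a positive finite weight \<open>w\<close> of finite integral, \<open>M\<close> is the finite measure with density \<open>w\<close>
  multiplied by the finite density \<open>1/w\<close>.\<close>

lemma sigma_finite_measure_if_weight:
  assumes w[measurable]: "w \<in> borel_measurable M"
    and w0: "\<And>z. z \<in> space M \<Longrightarrow> w z \<noteq> 0 \<and> w z \<noteq> \<infinity>"
    and fin: "(\<integral>\<^sup>+z. w z \<partial>M) \<noteq> \<infinity>"
  shows "sigma_finite_measure M"
proof -
  have "emeasure (density M w) (space (density M w)) = (\<integral>\<^sup>+z. w z \<partial>M)"
    by (simp add: emeasure_density cong: nn_integral_cong)
  with fin have "finite_measure (density M w)" by (intro finite_measureI) simp
  then interpret D: finite_measure "density M w" .
  have "density (density M w) (\<lambda>z. inverse (w z)) = density M (\<lambda>z. w z * inverse (w z))"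
    by (rule density_density_eq) measurable
  also have "\<dots> = density M (\<lambda>_. 1)"
  proof (intro density_cong AE_I2)
    fix z assume "z \<in> space M"
    then show "w z * inverse (w z) = 1"
      using w0[of z] ennreal_divide_self[of "w z"] by (simp add: divide_ennreal_def less_top)
  qed measurable
  finally have "density (density M w) (\<lambda>z. inverse (w z)) = M" by (simp add: density_1)
  moreover have "sigma_finite_measure (density (density M w) (\<lambda>z. inverse (w z)))"
    using w0 by (subst D.sigma_finite_iff_density_finite) (auto simp: AE_density intro!: AE_I2)
  ultimately show ?thesis by simp
qed

lemma emeasure_distr_eq_nn_integral:
  assumes f: "f \<in> M \<rightarrow>\<^sub>M N" and C: "C \<in> sets N"
  shows "emeasure (distr M N f) C = (\<integral>\<^sup>+z. indicator C (f z) \<partial>M)"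
proof -
  have "emeasure (distr M N f) C = (\<integral>\<^sup>+y. indicator C y \<partial>distr M N f)" using C by simp
  also have "\<dots> = (\<integral>\<^sup>+z. indicator C (f z) \<partial>M)" using f C by (intro nn_integral_distr) auto
  finally show ?thesis .
qed

lemma measure_eqI_nn_integral_distr:
  assumes f: "f \<in> M \<rightarrow>\<^sub>M N" and sets: "sets L = sets N"
    and eq: "\<And>h. h \<in> borel_measurable N \<Longrightarrow> (\<integral>\<^sup>+z. h z \<partial>L) = (\<integral>\<^sup>+z. h (f z) \<partial>M)"
  shows "L = distr M N f"
proof (rule measure_eqI)
  fix C assume "C \<in> sets L"
  then have C: "C \<in> sets N" by (simp only: sets)
  have "emeasure L C = (\<integral>\<^sup>+z. indicator C z \<partial>L)" using \<open>C \<in> sets L\<close> by simp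
  also have "\<dots> = emeasure (distr M N f) C"
    unfolding emeasure_distr_eq_nn_integral[OF f C] using C by (intro eq) simp
  finally show "emeasure L C = emeasure (distr M N f) C" .
qed (simp add: sets)

text \<open>The measures below are given by iterated integrals. It is convenient to calculate with the integrals
  as functionals; the four axioms are those of the nonnegative integral, and each such functional is
  the integral of a measure.\<close>

locale integral_functional =
  fixes M :: "'a measure" and \<Phi> :: "('a \<Rightarrow> ennreal) \<Rightarrow> ennreal"
  assumes cong: "\<And>f g. (\<And>x. x \<in> space M \<Longrightarrow> f x = g x) \<Longrightarrow> \<Phi> f = \<Phi> g"
    and cmult: "\<And>f c. f \<in> borel_measurable M \<Longrightarrow> \<Phi> (\<lambda>x. c * f x) = c * \<Phi> f"
    and add: "\<And>f g. f \<in> borel_measurable M \<Longrightarrow> g \<in> borel_measurable M \<Longrightarrow>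
      \<Phi> (\<lambda>x. f x + g x) = \<Phi> f + \<Phi> g"
    and monotone_convergence: "\<And>U. (\<And>i. U i \<in> borel_measurable M) \<Longrightarrow>
      incseq U \<Longrightarrow> \<Phi> (\<lambda>x. SUP i. U i x) = (SUP i. \<Phi> (U i))"
begin

definition as_measure :: "'a measure" where
  "as_measure = measure_of (space M) (sets M) (\<lambda>A. \<Phi> (indicator A))"

lemma sets_as_measure[simp, measurable_cong]: "sets as_measure = sets M"
  by (simp add: as_measure_def sets.sets_measure_of_eq)

lemma space_as_measure[simp]: "space as_measure = space M"
  by (simp add: as_measure_def)

lemma zero: "\<Phi> (\<lambda>x. 0) = 0"
  using cmult[of "\<lambda>x. 0" 0] by simp

lemma sum: "(\<And>i. i \<in> I \<Longrightarrow> f i \<in> borel_measurable M) \<Longrightarrow> \<Phi> (\<lambda>x. \<Sum>i\<in>I. f i x) = (\<Sum>i\<in>I. \<Phi> (f i))"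
  by (induction I rule: infinite_finite_induct) (auto simp: zero add)

lemma emeasure_as_measure:
  assumes "A \<in> sets M"
  shows "emeasure as_measure A = \<Phi> (indicator A)"
  unfolding as_measure_def
proof (rule emeasure_measure_of_sigma)
  show "sigma_algebra (space M) (sets M)" ..
  have [simp]: "indicator {} = (\<lambda>x. 0::ennreal)" by (auto simp: indicator_def)
  show "positive (sets M) (\<lambda>A. \<Phi> (indicator A))"
    by (auto simp: positive_def zero)
  show "countably_additive (sets M) (\<lambda>A. \<Phi> (indicator A))"
  proof (rule countably_additiveI)
    fix A :: "nat \<Rightarrow> 'a set" assume A: "range A \<subseteq> sets M" "disjoint_family A"
    have [measurable]: "A i \<in> sets M" for i using A by auto
    have "indicator (\<Union>i. A i) = (\<lambda>x. SUP n. \<Sum>i<n. indicator (A i) x :: ennreal)"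
      using suminf_indicator[OF A(2)] by (auto simp: fun_eq_iff suminf_eq_SUP)
    then have "\<Phi> (indicator (\<Union>i. A i)) = (SUP n. \<Phi> (\<lambda>x. \<Sum>i<n. indicator (A i) x))"
      by (simp only:) (rule monotone_convergence,
          auto simp: incseq_def le_fun_def intro!: sum_mono2)
    also have "\<dots> = (SUP n. \<Sum>i<n. \<Phi> (indicator (A i)))"
      by (subst sum) auto
    finally show "(\<Sum>i. \<Phi> (indicator (A i))) = \<Phi> (indicator (\<Union>i. A i))"
      by (simp add: suminf_eq_SUP)
  qed
qed fact

lemma nn_integral_as_measure:
  assumes "f \<in> borel_measurable M"
  shows "(\<integral>\<^sup>+x. f x \<partial>as_measure) = \<Phi> f"
  using assms
proof induction
  case (cong f g)
  then show ?case
    using integral_functional.cong[OF integral_functional_axioms, of f g] nn_integral_cong[of as_measure f g]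
    by auto
next
  case (set A)
  then show ?case by (simp add: emeasure_as_measure)
next
  case (mult u c)
  then show ?case by (simp add: cmult nn_integral_cmult measurable_cong_sets[OF sets_as_measure refl])
next
  case (add u v)
  then show ?case
    using integral_functional.add[OF integral_functional_axioms, of v u]
    by (simp add: nn_integral_add measurable_cong_sets[OF sets_as_measure refl])
next
  case (seq U)
  have "(\<integral>\<^sup>+x. (SUP i. U i x) \<partial>as_measure) = (SUP i. \<integral>\<^sup>+x. U i x \<partial>as_measure)"
    using seq by (intro nn_integral_monotone_convergence_SUP)
      (auto simp: measurable_cong_sets[OF sets_as_measure refl])
  with seq monotone_convergence[of U] show ?case by (simp add: SUP_apply[abs_def])
qed

end

lemma integral_functional_kernel:
  assumes \<nu>: "sets \<nu> = sets L"
    and \<kappa>: "finite_kernel L N \<kappa>"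
    and T: "(\<lambda>(x, y). T x y) \<in> L \<Otimes>\<^sub>M N \<rightarrow>\<^sub>M M"
  shows "integral_functional M (\<lambda>f. \<integral>\<^sup>+x. (\<integral>\<^sup>+y. f (T x y) \<partial>\<kappa> x) \<partial>\<nu>)"
proof -
  have sp: "space \<nu> = space L" by (rule sets_eq_imp_space_eq[OF \<nu>])
  have [simp]: "borel_measurable \<nu> = borel_measurable L" by (rule measurable_cong_sets[OF \<nu> refl])
  have TM: "T x y \<in> space M" if "x \<in> space L" "y \<in> space N" for x y
    using measurable_space[OF T, of "(x, y)"] that by (simp add: space_pair_measure)
  have out: "(\<lambda>x. \<integral>\<^sup>+y. f (T x y) \<partial>\<kappa> x) \<in> borel_measurable L" if "f \<in> borel_measurable M" for f
    using borel_measurable_nn_integral_kernel[OF \<kappa>, of "\<lambda>x y. f (T x y)"] measurable_compose[OF T that]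
    by (simp add: case_prod_beta')
  have inn: "(\<lambda>y. f (T x y)) \<in> borel_measurable (\<kappa> x)" if "f \<in> borel_measurable M" "x \<in> space L" for f x
  proof -
    have "(\<lambda>y. f (T x y)) \<in> borel_measurable N"
      using measurable_compose[OF measurable_Pair2[OF T that(2)], of f borel] that(1) by simp
    then show ?thesis using measurable_cong_sets[OF finite_kernelD(2)[OF \<kappa> that(2)] refl] by auto
  qed
  show ?thesis
  proof
    fix f g :: "_ \<Rightarrow> ennreal" assume "\<And>x. x \<in> space M \<Longrightarrow> f x = g x"
    then show "(\<integral>\<^sup>+x. (\<integral>\<^sup>+y. f (T x y) \<partial>\<kappa> x) \<partial>\<nu>) = (\<integral>\<^sup>+x. (\<integral>\<^sup>+y. g (T x y) \<partial>\<kappa> x) \<partial>\<nu>)"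
      using TM by (auto intro!: nn_integral_cong simp: sp finite_kernelD(3)[OF \<kappa>])
  next
    fix f :: "_ \<Rightarrow> ennreal" and c assume f: "f \<in> borel_measurable M"
    have "(\<integral>\<^sup>+x. (\<integral>\<^sup>+y. c * f (T x y) \<partial>\<kappa> x) \<partial>\<nu>) = (\<integral>\<^sup>+x. c * (\<integral>\<^sup>+y. f (T x y) \<partial>\<kappa> x) \<partial>\<nu>)"
      using inn[OF f] by (auto intro!: nn_integral_cong nn_integral_cmult simp: sp)
    then show "(\<integral>\<^sup>+x. (\<integral>\<^sup>+y. c * f (T x y) \<partial>\<kappa> x) \<partial>\<nu>) = c * (\<integral>\<^sup>+x. (\<integral>\<^sup>+y. f (T x y) \<partial>\<kappa> x) \<partial>\<nu>)"
      using out[OF f] by (simp add: nn_integral_cmult)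
  next
    fix f g :: "_ \<Rightarrow> ennreal" assume f: "f \<in> borel_measurable M" and g: "g \<in> borel_measurable M"
    have "(\<integral>\<^sup>+x. (\<integral>\<^sup>+y. f (T x y) + g (T x y) \<partial>\<kappa> x) \<partial>\<nu>)
        = (\<integral>\<^sup>+x. (\<integral>\<^sup>+y. f (T x y) \<partial>\<kappa> x) + (\<integral>\<^sup>+y. g (T x y) \<partial>\<kappa> x) \<partial>\<nu>)"
      using inn[OF f] inn[OF g] by (auto intro!: nn_integral_cong nn_integral_add simp: sp)
    then show "(\<integral>\<^sup>+x. (\<integral>\<^sup>+y. f (T x y) + g (T x y) \<partial>\<kappa> x) \<partial>\<nu>)
        = (\<integral>\<^sup>+x. (\<integral>\<^sup>+y. f (T x y) \<partial>\<kappa> x) \<partial>\<nu>) + (\<integral>\<^sup>+x. (\<integral>\<^sup>+y. g (T x y) \<partial>\<kappa> x) \<partial>\<nu>)"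
      using out[OF f] out[OF g] by (simp add: nn_integral_add)
  next
    fix U :: "nat \<Rightarrow> _ \<Rightarrow> ennreal" assume U: "\<And>i. U i \<in> borel_measurable M" and inc: "incseq U"
    have "(\<integral>\<^sup>+x. (\<integral>\<^sup>+y. (SUP i. U i (T x y)) \<partial>\<kappa> x) \<partial>\<nu>) = (\<integral>\<^sup>+x. (SUP i. \<integral>\<^sup>+y. U i (T x y) \<partial>\<kappa> x) \<partial>\<nu>)"
      using inn[OF U] inc
      by (intro nn_integral_cong nn_integral_monotone_convergence_SUP) (auto simp: sp incseq_def le_fun_def)
    also have "\<dots> = (SUP i. \<integral>\<^sup>+x. (\<integral>\<^sup>+y. U i (T x y) \<partial>\<kappa> x) \<partial>\<nu>)"
      using out[OF U] inc
      by (intro nn_integral_monotone_convergence_SUP)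
         (auto simp: incseq_def le_fun_def intro!: nn_integral_mono)
    finally show "(\<integral>\<^sup>+x. (\<integral>\<^sup>+y. (SUP i. U i (T x y)) \<partial>\<kappa> x) \<partial>\<nu>) = (SUP i. \<integral>\<^sup>+x. (\<integral>\<^sup>+y. U i (T x y) \<partial>\<kappa> x) \<partial>\<nu>)" .
  qed
qed

text \<open>Rectangles are closed under intersections and generate the product sigma-algebra, so a finite measure
  that agrees with \<open>\<nu>(dy) \<kappa>\<^sub>y(dx)\<close> on them is equal to it.\<close>

lemma nn_integral_disintegration:
  assumes m: "finite_measure m" "sets m = sets (\<nu> \<Otimes>\<^sub>M N)"
    and \<kappa>: "finite_kernel \<nu> N \<kappa>"
    and rect: "\<And>B A. B \<in> sets \<nu> \<Longrightarrow> A \<in> sets N \<Longrightarrow>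
      emeasure m (B \<times> A) = (\<integral>\<^sup>+y. emeasure (\<kappa> y) A * indicator B y \<partial>\<nu>)"
    and f: "f \<in> borel_measurable (\<nu> \<Otimes>\<^sub>M N)"
  shows "(\<integral>\<^sup>+z. f z \<partial>m) = (\<integral>\<^sup>+y. (\<integral>\<^sup>+x. f (y, x) \<partial>\<kappa> y) \<partial>\<nu>)"
proof -
  interpret F: integral_functional "\<nu> \<Otimes>\<^sub>M N" "\<lambda>f. \<integral>\<^sup>+y. (\<integral>\<^sup>+x. f (y, x) \<partial>\<kappa> y) \<partial>\<nu>"
    by (rule integral_functional_kernel[OF refl \<kappa>]) simp
  have "m = F.as_measure"
  proof (rule measure_eqI_generator_eq[where A="\<lambda>_. space \<nu> \<times> space N"])
    show "Int_stable {B \<times> A |B A. B \<in> sets \<nu> \<and> A \<in> sets N}" by (rule Int_stable_pair_measure_generator)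
    show "{B \<times> A |B A. B \<in> sets \<nu> \<and> A \<in> sets N} \<subseteq> Pow (space \<nu> \<times> space N)"
      by (rule pair_measure_closed)
    show "sets m = sigma_sets (space \<nu> \<times> space N) {B \<times> A |B A. B \<in> sets \<nu> \<and> A \<in> sets N}"
      "sets F.as_measure = sigma_sets (space \<nu> \<times> space N) {B \<times> A |B A. B \<in> sets \<nu> \<and> A \<in> sets N}"
      using m by (simp_all add: sets_pair_measure)
    show "emeasure m (space \<nu> \<times> space N) \<noteq> \<infinity>"
      using finite_measure.emeasure_finite[OF m(1)] by simp
    fix X assume "X \<in> {B \<times> A |B A. B \<in> sets \<nu> \<and> A \<in> sets N}"
    then obtain B A where X: "X = B \<times> A" "B \<in> sets \<nu>" "A \<in> sets N" by auto
    have "emeasure F.as_measure X = (\<integral>\<^sup>+y. (\<integral>\<^sup>+x. indicator X (y, x) \<partial>\<kappa> y) \<partial>\<nu>)"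
      using X by (intro F.emeasure_as_measure) simp
    also have "\<dots> = (\<integral>\<^sup>+y. emeasure (\<kappa> y) A * indicator B y \<partial>\<nu>)"
      using X finite_kernelD(2)[OF \<kappa>]
      by (intro nn_integral_cong) (simp add: indicator_times mult.commute nn_integral_cmult_indicator)
    finally show "emeasure m X = emeasure F.as_measure X" using rect X by simp
  qed auto
  then show ?thesis using F.nn_integral_as_measure[OF f] by simp
qed

section \<open>Disintegration over a standard Borel space\<close>

lemma borel_eq_rational_atMost: "borel = sigma UNIV (range (\<lambda>q::rat. {..of_rat q :: real}))"
proof (rule borel_eq_sigmaI1[OF borel_eq_atMost])
  let ?S = "sigma UNIV (range (\<lambda>q::rat. {..of_rat q :: real}))"
  fix x assume "x \<in> range (\<lambda>a::real. {..a})"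
  then obtain a where x: "x = {..a}" by blast
  obtain q0 where q0: "a < real_of_rat q0" using of_rat_dense[of a "a + 1"] by auto
  have "(t \<le> a) = (\<forall>q. a < real_of_rat q \<longrightarrow> t \<le> of_rat q)" for t
    using of_rat_dense[of a t] by (meson less_imp_le not_le order_trans)
  then have "x = (\<Inter>q\<in>{q::rat. a < of_rat q}. {..of_rat q})" unfolding x by blast
  moreover have "\<dots> \<in> sets ?S"
  proof (rule sets.countable_INT'')
    show "UNIV \<in> sets ?S" using sets.top[of ?S] by simp
    show "{..real_of_rat q} \<in> sets ?S" for q by (simp add: sigma_sets.Basic)
  qed auto
  ultimately show "x \<in> sets ?S" by simp
qed (metis (no_types) borel_closed closed_atMost)

text \<open>Distribution functions of finite measures on \<open>[0, 1]\<close>, restricted to the rationals: these are countably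
  many conditions, so they can be required for almost all points at once.\<close>

definition rational_cdf :: "(rat \<Rightarrow> ennreal) \<Rightarrow> bool" where
  "rational_cdf F \<longleftrightarrow>
     (\<forall>q r. q \<le> r \<longrightarrow> F q \<le> F r) \<and> (\<forall>q. F q \<noteq> \<infinity>) \<and> (\<forall>q<0. F q = 0) \<and> (\<forall>q\<ge>1. F q \<le> F 1) \<and>
     (\<forall>q. (INF n. F (q + 1 / of_nat (Suc n))) = F q)"

definition cdf_measure :: "(rat \<Rightarrow> ennreal) \<Rightarrow> real measure" where
  "cdf_measure F = (if rational_cdf F
     then interval_measure (\<lambda>t. INF q\<in>{q. t < of_rat q}. enn2real (F q)) else null_measure borel)"

lemma sets_cdf_measure[simp, measurable_cong]: "sets (cdf_measure F) = sets borel"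
  by (simp add: cdf_measure_def)

lemma space_cdf_measure[simp]: "space (cdf_measure F) = UNIV"
  by (simp add: cdf_measure_def)

lemma emeasure_cdf_measure:
  assumes F: "rational_cdf F"
  shows "emeasure (cdf_measure F) {..of_rat q} = F q"
    and "emeasure (cdf_measure F) UNIV = F 1"
proof -
  define H :: "real \<Rightarrow> real" where "H t = (INF q\<in>{q. t < of_rat q}. enn2real (F q))" for t
  have mono: "F q \<le> F r" if "q \<le> r" for q r using F that by (auto simp: rational_cdf_def)
  have fin: "F q \<noteq> \<infinity>" for q using F by (auto simp: rational_cdf_def)
  have F_real: "ennreal (enn2real (F q)) = F q" for q using fin[of q] by (cases "F q") auto
  have neg: "F q = 0" if "q < 0" for q using F that by (auto simp: rational_cdf_def)
  have big: "F q = F 1" if "1 \<le> q" for q using F that mono[OF that] unfolding rational_cdf_def by (metis antisym)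
  have inf: "(INF n. F (q + 1 / of_nat (Suc n))) = F q" for q using F by (auto simp: rational_cdf_def)
  have bdd: "bdd_below ((\<lambda>q. enn2real (F q)) ` S)" for S
    by (rule bdd_belowI[of _ 0]) auto
  have ne: "{q. t < real_of_rat q} \<noteq> {}" for t
    using of_rat_dense[of t "t + 1"] by auto
  have H_mono: "H s \<le> H t" if "s \<le> t" for s t
    unfolding H_def using that by (intro cINF_superset_mono bdd ne) auto
  have H_right: "continuous (at_right t) H" for t
  proof -
   have "\<forall>e>0. \<exists>d>0. H (t + d) - H t < e"
   proof safe
    fix e :: real assume "0 < e"
    then have "\<exists>q\<in>{q. t < of_rat q}. enn2real (F q) < H t + e"
      using cINF_less_iff[OF ne bdd, of t "H t + e"] by (simp add: H_def)
    then obtain q where q: "t < of_rat q" "enn2real (F q) < H t + e" by auto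
    let ?d = "(of_rat q - t) / 2"
    have "H (t + ?d) \<le> enn2real (F q)"
      unfolding H_def using q by (intro cINF_lower bdd) (auto simp: field_simps)
    then show "\<exists>d>0. H (t + d) - H t < e"
      using q by (intro exI[of _ ?d]) auto
   qed
   then show ?thesis using continuous_at_right_real_increasing[of H t] H_mono by blast
  qed
  \<comment> \<open>Right continuity along \<open>1 / Suc n\<close>, part of \<open>rational_cdf\<close>, makes \<open>H\<close> extend \<open>F\<close>.\<close>
  have H_F: "ennreal (H (of_rat q)) = F q" for q
  proof (rule antisym)
    have "ennreal (H (of_rat q)) \<le> F (q + 1 / of_nat (Suc n))" for n
    proof -
      have "(0::rat) < 1 / of_nat (Suc n)" by simp
      then have "H (of_rat q) \<le> enn2real (F (q + 1 / of_nat (Suc n)))"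
        unfolding H_def by (intro cINF_lower bdd) (simp only: mem_Collect_eq of_rat_less)
      then show ?thesis by (subst F_real[symmetric]) (rule ennreal_leI)
    qed
    then have "ennreal (H (of_rat q)) \<le> (INF n. F (q + 1 / of_nat (Suc n)))" by (rule INF_greatest)
    then show "ennreal (H (of_rat q)) \<le> F q" by (simp only: inf)
    have "enn2real (F q) \<le> H (of_rat q)"
      unfolding H_def
      using fin mono gt_ex[of q] by (intro cINF_greatest) (auto simp: of_rat_less less_top intro!: enn2real_mono)
    then show "F q \<le> ennreal (H (of_rat q))" by (subst F_real[symmetric]) (rule ennreal_leI)
  qed
  have \<kappa>: "cdf_measure F = interval_measure H"
    using F by (simp add: cdf_measure_def H_def[abs_def])
  have H_neg: "H (- real (Suc n)) = 0" for n
  proof -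
    have "ennreal (H (- real (Suc n))) = F (- of_nat (Suc n))"
      using H_F[of "- of_nat (Suc n)"] by (simp add: of_rat_diff of_rat_minus)
    also have "\<dots> = 0" by (rule neg) simp
    finally have "H (- real (Suc n)) \<le> 0" by (simp add: ennreal_eq_0_iff)
    moreover have "0 \<le> H (- real (Suc n))" unfolding H_def by (intro cINF_greatest ne) auto
    ultimately show ?thesis by simp
  qed
  have Ioc: "emeasure (cdf_measure F) {- real (Suc n)<..of_rat r} = F r"
    if "- real (Suc n) \<le> of_rat r" for n r
    using that by (simp only: \<kappa> emeasure_interval_measure_Ioc[OF _ H_mono H_right] H_neg) (simp add: H_F)
  show "emeasure (cdf_measure F) {..of_rat q} = F q"
  proof (rule LIMSEQ_unique)
    have "(\<lambda>n. emeasure (cdf_measure F) {- real (Suc n)<..of_rat q})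
        \<longlonglongrightarrow> emeasure (cdf_measure F) (\<Union>n. {- real (Suc n)<..of_rat q})"
      by (rule Lim_emeasure_incseq) (auto simp: incseq_def)
    also have "(\<Union>n. {- real (Suc n)<..of_rat q}) = {..of_rat q}"
    proof (safe, goal_cases)
      case (2 t)
      obtain n where "- t < real n" using reals_Archimedean2 by blast
      then show ?case using 2 by (intro UN_I[of n]) auto
    qed auto
    finally show "(\<lambda>n. emeasure (cdf_measure F) {- real (Suc n)<..of_rat q})
        \<longlonglongrightarrow> emeasure (cdf_measure F) {..of_rat q}" .
    obtain N where N: "- real_of_rat q < real N" using reals_Archimedean2 by blast
    show "(\<lambda>n. emeasure (cdf_measure F) {- real (Suc n)<..of_rat q}) \<longlonglongrightarrow> F q"
      using N by (intro tendsto_eventually eventually_sequentiallyI[of N] Ioc) auto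
  qed
  show "emeasure (cdf_measure F) UNIV = F 1"
  proof (rule LIMSEQ_unique)
    have "(\<lambda>n. emeasure (cdf_measure F) {- real (Suc n)<..of_rat (of_nat (Suc n))})
        \<longlonglongrightarrow> emeasure (cdf_measure F) (\<Union>n. {- real (Suc n)<..of_rat (of_nat (Suc n))})"
      by (rule Lim_emeasure_incseq) (auto simp: incseq_def of_rat_add)
    also have "(\<Union>n. {- real (Suc n)<..of_rat (of_nat (Suc n))}) = UNIV"
    proof -
      have "t \<in> (\<Union>n. {- real (Suc n)<..of_rat (of_nat (Suc n))})" for t
      proof -
        obtain n where "\<bar>t\<bar> < real n" using reals_Archimedean2 by blast
        then show ?thesis by (intro UN_I[of n]) (auto simp: of_rat_add)
      qed
      then show ?thesis by blast
    qed
    finally show "(\<lambda>n. emeasure (cdf_measure F) {- real (Suc n)<..of_rat (of_nat (Suc n))})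
        \<longlonglongrightarrow> emeasure (cdf_measure F) UNIV" .
    have "emeasure (cdf_measure F) {- real (Suc n)<..of_rat (of_nat (Suc n))} = F 1" for n
      by (rule trans[OF Ioc big]) (simp_all add: of_rat_add)
    then show "(\<lambda>n. emeasure (cdf_measure F) {- real (Suc n)<..of_rat (of_nat (Suc n))}) \<longlonglongrightarrow> F 1"
      by simp
  qed
qed

lemma measurable_rational_cdf[measurable]:
  assumes [measurable]: "\<And>q. (\<lambda>y. F y q) \<in> borel_measurable M"
  shows "Measurable.pred M (\<lambda>y. rational_cdf (F y))"
  unfolding rational_cdf_def by measurable

lemma finite_measure_cdf_measure: "finite_measure (cdf_measure F)"
proof (cases "rational_cdf F")
  case True
  then have "F 1 \<noteq> \<infinity>" unfolding rational_cdf_def by blast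
  then show ?thesis
    by (intro finite_measureI) (simp add: emeasure_cdf_measure(2)[OF True])
next
  case False
  then show ?thesis by (intro finite_measureI) (simp add: cdf_measure_def)
qed

text \<open>The conditional distribution functions \<open>F y q\<close> are the densities of \<open>B \<mapsto> m (B \<times> {c \<le> q})\<close> with
  respect to \<open>\<nu>\<close>, one for every rational \<open>q\<close>. For almost all \<open>y\<close> they satisfy \<open>rational_cdf\<close> and define a
  measure on the line, which \<open>g\<close> maps to \<open>N\<close>. Only rectangles remain to be compared, and for these the
  sets on the line with the right integrals form a Dynkin system containing all rational half-lines.\<close>

lemma disintegration_exists:
  fixes c :: "'a \<Rightarrow> real" and \<nu> :: "'b measure"
  assumes "sigma_finite_measure \<nu>" "finite_measure m" and sets_m: "sets m = sets (\<nu> \<Otimes>\<^sub>M N)"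
    and ac: "absolutely_continuous \<nu> (distr m \<nu> fst)"
    and c[measurable]: "c \<in> borel_measurable N" and g[measurable]: "g \<in> borel \<rightarrow>\<^sub>M N"
    and gc: "\<And>x. x \<in> space N \<Longrightarrow> g (c x) = x" and c01: "\<And>x. 0 \<le> c x" "\<And>x. c x \<le> 1"
  obtains \<kappa> where "finite_kernel \<nu> N \<kappa>"
    "\<And>f. f \<in> borel_measurable (\<nu> \<Otimes>\<^sub>M N) \<Longrightarrow> (\<integral>\<^sup>+z. f z \<partial>m) = (\<integral>\<^sup>+y. (\<integral>\<^sup>+x. f (y, x) \<partial>\<kappa> y) \<partial>\<nu>)"
proof -
  interpret \<nu>: sigma_finite_measure \<nu> by fact
  interpret m: finite_measure m by fact
  have sp_m: "space m = space \<nu> \<times> space N"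
    using sets_eq_imp_space_eq[OF sets_m] by (simp add: space_pair_measure)
  note [measurable_cong] = sets_m
  define w where "w B Z = emeasure m (B \<times> (c -` Z \<inter> space N))" for B Z
  have cZ[measurable]: "c -` Z \<inter> space N \<in> sets N" if "Z \<in> sets borel" for Z
    using that by measurable
  have w_rect: "B \<times> (c -` Z \<inter> space N) \<in> sets m" if "B \<in> sets \<nu>" "Z \<in> sets borel" for B Z
    using that cZ by (simp add: sets_m)
  \<comment> \<open>Restricting \<open>m\<close> to a strip keeps its marginal absolutely continuous, so Radon-Nikodym applies.\<close>
  have dens: "\<exists>f\<in>borel_measurable \<nu>. \<forall>B\<in>sets \<nu>. (\<integral>\<^sup>+y. f y * indicator B y \<partial>\<nu>) = w B Z"
    if Z: "Z \<in> sets borel" for Z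
  proof -
    let ?A = "space \<nu> \<times> (c -` Z \<inter> space N)"
    have A: "?A \<in> sets m" using w_rect[OF sets.top Z] .
    let ?D = "distr (density m (indicator ?A)) \<nu> fst"
    have D: "emeasure ?D B = w B Z" if B: "B \<in> sets \<nu>" for B
    proof -
      have "fst -` B \<inter> space m \<in> sets m" using B by measurable
      moreover have "?A \<inter> (fst -` B \<inter> space m) = B \<times> (c -` Z \<inter> space N)"
        using sets.sets_into_space[OF B] by (auto simp: sp_m)
      ultimately show ?thesis
        using A B w_rect[OF B Z] by (simp add: emeasure_distr emeasure_density_const w_def emeasure_density
            indicator_inter_arith[symmetric] sets.Int)
    qed
    have "absolutely_continuous \<nu> ?D"
      unfolding absolutely_continuous_def
    proof
      fix B assume B: "B \<in> null_sets \<nu>"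
      then have "B \<in> null_sets (distr m \<nu> fst)" using ac by (auto simp: absolutely_continuous_def)
      then have "emeasure m (fst -` B \<inter> space m) = 0"
        using emeasure_distr[of fst m \<nu> B] by (auto simp: null_sets_def)
      moreover have "w B Z \<le> emeasure m (fst -` B \<inter> space m)"
        unfolding w_def using B sets.sets_into_space[of B \<nu>] by (intro emeasure_mono) (auto simp: sp_m)
      ultimately show "B \<in> null_sets ?D" using D[of B] B by (auto simp: null_sets_def)
    qed
    then have *: "density \<nu> (RN_deriv \<nu> ?D) = ?D" by (intro \<nu>.density_RN_deriv) auto
    show ?thesis
    proof (rule bexI[of _ "RN_deriv \<nu> ?D"], safe)
      fix B assume B: "B \<in> sets \<nu>"
      then show "(\<integral>\<^sup>+y. RN_deriv \<nu> ?D y * indicator B y \<partial>\<nu>) = w B Z"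
        using D[OF B] by (subst (asm) *[symmetric]) (simp add: emeasure_density)
    qed simp
  qed
  then obtain f where f: "\<And>Z. Z \<in> sets borel \<Longrightarrow> f Z \<in> borel_measurable \<nu>"
    and fw: "\<And>Z B. Z \<in> sets borel \<Longrightarrow> B \<in> sets \<nu> \<Longrightarrow> (\<integral>\<^sup>+y. f Z y * indicator B y \<partial>\<nu>) = w B Z"
    by metis
  define F where "F y q = f {..of_rat q} y" for y and q :: rat
  have [measurable]: "(\<lambda>y. F y q) \<in> borel_measurable \<nu>" for q unfolding F_def by (rule f) simp
  have Fw: "(\<integral>\<^sup>+y. F y q * indicator B y \<partial>\<nu>) = w B {..of_rat q}" if "B \<in> sets \<nu>" for B q
    unfolding F_def using that by (rule fw[rotated]) simp
  have AE_eqI: "AE y in \<nu>. h y = h' y"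
    if "h \<in> borel_measurable \<nu>" "h' \<in> borel_measurable \<nu>"
      "\<And>B. B \<in> sets \<nu> \<Longrightarrow> (\<integral>\<^sup>+y. h y * indicator B y \<partial>\<nu>) = (\<integral>\<^sup>+y. h' y * indicator B y \<partial>\<nu>)" for h h'
    using that by (intro \<nu>.density_unique measure_eqI) (auto simp: emeasure_density)
  have w_fin: "w B Z \<noteq> \<infinity>" for B Z by (simp add: w_def)
  have AE_mono: "AE y in \<nu>. \<forall>q r. q \<le> r \<longrightarrow> F y q \<le> F y r"
  proof (unfold AE_all_countable, intro allI)
    fix q r :: rat
    show "AE y in \<nu>. q \<le> r \<longrightarrow> F y q \<le> F y r"
    proof (cases "q \<le> r")
      case True
      let ?Z = "{of_rat q<..of_rat r} :: real set"
      have [measurable]: "f ?Z \<in> borel_measurable \<nu>" by (rule f) simp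
      \<comment> \<open>Monotonicity follows from an equation, since equal integrals give equal densities.\<close>
      have "AE y in \<nu>. F y q + f ?Z y = F y r"
      proof (rule AE_eqI)
        fix B assume B[measurable]: "B \<in> sets \<nu>"
        have "(\<integral>\<^sup>+y. (F y q + f ?Z y) * indicator B y \<partial>\<nu>) = w B {..of_rat q} + w B ?Z"
          using B by (simp add: distrib_right nn_integral_add Fw fw)
        also have "\<dots> = w B {..of_rat r}"
          unfolding w_def using True[folded of_rat_less_eq[where 'a=real]] w_rect[OF B]
          by (subst plus_emeasure) (auto intro!: arg_cong2[where f=emeasure])
        finally show "(\<integral>\<^sup>+y. (F y q + f ?Z y) * indicator B y \<partial>\<nu>) = (\<integral>\<^sup>+y. F y r * indicator B y \<partial>\<nu>)"
          using B by (simp add: Fw)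
      qed auto
      then show ?thesis
      proof eventually_elim
        case (elim y)
        show ?case unfolding elim[symmetric] by simp
      qed
    qed simp
  qed
  have AE_fin: "AE y in \<nu>. \<forall>q. F y q \<noteq> \<infinity>"
  proof (unfold AE_all_countable, intro allI)
    fix q
    have "(\<integral>\<^sup>+y. F y q \<partial>\<nu>) = (\<integral>\<^sup>+y. F y q * indicator (space \<nu>) y \<partial>\<nu>)"
      by (intro nn_integral_cong) simp
    also have "\<dots> = w (space \<nu>) {..of_rat q}" by (rule Fw) simp
    finally have "(\<integral>\<^sup>+y. F y q \<partial>\<nu>) = w (space \<nu>) {..of_rat q}" .
    then show "AE y in \<nu>. F y q \<noteq> \<infinity>"
      using w_fin by (intro nn_integral_PInf_AE) auto
  qed
  have AE_neg: "AE y in \<nu>. \<forall>q<0. F y q = 0"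
  proof (unfold AE_all_countable, intro allI)
    fix q
    show "AE y in \<nu>. q < 0 \<longrightarrow> F y q = 0"
    proof (cases "q < 0")
      case True
      then have "\<not> c x \<le> of_rat q" for x
        using c01(1)[of x] of_rat_less_0_iff[of q, where 'a=real] by linarith
      then have "c -` {..of_rat q} \<inter> space N = {}"
by auto
      then have "w B {..of_rat q} = 0" for B by (simp add: w_def)
      then have "AE y in \<nu>. F y q = 0" by (intro AE_eqI) (auto simp: Fw)
      then show ?thesis by auto
    qed simp
  qed
  have AE_big: "AE y in \<nu>. \<forall>q\<ge>1. F y q \<le> F y 1"
  proof (unfold AE_all_countable, intro allI)
    fix q :: rat
    show "AE y in \<nu>. 1 \<le> q \<longrightarrow> F y q \<le> F y 1"
    proof (cases "1 \<le> q")
      case True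
      then have "c x \<le> of_rat q" for x
        using c01(2)[of x] one_le_of_rat_iff[of q, where 'a=real] by linarith
      then have "c -` {..of_rat q} \<inter> space N = c -` {..of_rat 1} \<inter> space N"
        using c01(2) by auto
      then have "w B {..of_rat q} = w B {..of_rat 1}" for B by (simp only: w_def)
      then have "AE y in \<nu>. F y q = F y 1" by (intro AE_eqI) (auto simp: Fw)
      then show ?thesis by auto
    qed simp
  qed
  have AE_inf: "AE y in \<nu>. \<forall>q. (INF n. F y (q + 1 / of_nat (Suc n))) = F y q"
  proof (unfold AE_all_countable, intro allI, rule AE_eqI)
    fix q :: rat and B assume B[measurable]: "B \<in> sets \<nu>"
    define r :: "nat \<Rightarrow> rat" where "r n = q + 1 / of_nat (Suc n)" for n
    have r_dec: "r (Suc n) \<le> r n" for n by (simp add: r_def field_simps)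
    have r_q: "of_rat (r n) = real_of_rat q + 1 / real (Suc n)" for n
      by (simp add: r_def of_rat_add of_rat_divide del: of_nat_Suc)
    have "(\<integral>\<^sup>+y. (INF n. F y (r n)) * indicator B y \<partial>\<nu>) = (\<integral>\<^sup>+y. (INF n. F y (r n) * indicator B y) \<partial>\<nu>)"
      by (intro nn_integral_cong) (auto simp: indicator_def)
    also have "\<dots> = (INF n. \<integral>\<^sup>+y. F y (r n) * indicator B y \<partial>\<nu>)"
    proof (rule nn_integral_monotone_convergence_INF_AE')
      fix n
      show "AE y in \<nu>. F y (r (Suc n)) * indicator B y \<le> F y (r n) * indicator B y"
        using AE_mono
      proof eventually_elim
        case (elim y)
        with r_dec[of n] have "F y (r (Suc n)) \<le> F y (r n)" by blast
        then show ?case by (rule mult_right_mono) simp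
      qed
    qed (use B w_fin in \<open>auto simp: Fw less_top\<close>)
    also have "\<dots> = (INF n. w B {..of_rat (r n)})" using B by (simp add: Fw)
    also have "\<dots> = emeasure m (\<Inter>n. B \<times> (c -` {..of_rat (r n)} \<inter> space N))"
      unfolding w_def
    proof (rule INF_emeasure_decseq)
      have "real_of_rat (r (Suc n)) \<le> of_rat (r n)" for n using r_dec by (simp add: of_rat_less_eq)
      from order_trans[OF _ this] show "decseq (\<lambda>n. B \<times> (c -` {..of_rat (r n)} \<inter> space N))"
        by (intro decseq_SucI) auto
    qed (use w_rect[OF B] in auto)
    also have "(\<Inter>n. B \<times> (c -` {..of_rat (r n)} \<inter> space N)) = B \<times> (c -` {..of_rat q} \<inter> space N)"
    proof -
      have "t \<le> of_rat q" if "\<And>n. t \<le> of_rat (r n)" for t :: real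
      proof (rule field_le_epsilon)
        fix e :: real assume "0 < e"
        then obtain n where "1 / real (Suc n) < e" using nat_approx_posE by blast
        with that[of n] show "t \<le> of_rat q + e" by (simp add: r_q)
      qed
      moreover have "t \<le> of_rat (r n)" if "t \<le> of_rat q" for t :: real and n
        using that by (simp add: r_q add_increasing2)
      ultimately show ?thesis by auto
    qed
    finally show "(\<integral>\<^sup>+y. (INF n. F y (q + 1 / of_nat (Suc n))) * indicator B y \<partial>\<nu>)
        = (\<integral>\<^sup>+y. F y q * indicator B y \<partial>\<nu>)"
      using B by (simp add: Fw w_def r_def)
  qed auto
  have good: "AE y in \<nu>. rational_cdf (F y)"
    using AE_mono AE_fin AE_neg AE_big AE_inf unfolding rational_cdf_def
    by eventually_elim (intro conjI; assumption)
  \<comment> \<open>Off the exceptional null set \<open>cdf_measure\<close> is the null measure, so every fibre stays finite.\<close>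
  let ?K = "\<lambda>y. cdf_measure (F y)"
  have K_if: "emeasure (?K y) {..of_rat q} = (if rational_cdf (F y) then F y q else 0)"
    "emeasure (?K y) UNIV = (if rational_cdf (F y) then F y 1 else 0)" for y q
    by (auto simp: emeasure_cdf_measure) (auto simp: cdf_measure_def)
  have K_fin: "emeasure (?K y) Z \<noteq> \<infinity>" for y Z
    using finite_measure.emeasure_finite[OF finite_measure_cdf_measure] by simp
  have UNIV_case: "(\<lambda>y. emeasure (?K y) UNIV) \<in> borel_measurable \<nu> \<and>
      (\<forall>B\<in>sets \<nu>. (\<integral>\<^sup>+y. emeasure (?K y) UNIV * indicator B y \<partial>\<nu>) = w B UNIV)"
  proof (safe, goal_cases)
    case 1 then show ?case by (simp add: K_if)
  next
    case (2 B)
    have "(\<integral>\<^sup>+y. emeasure (?K y) UNIV * indicator B y \<partial>\<nu>) = (\<integral>\<^sup>+y. F y 1 * indicator B y \<partial>\<nu>)"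
      using good by (intro nn_integral_cong_AE) (auto simp: K_if)
    also have "\<dots> = w B {..1}" using 2 by (simp add: Fw)
    also have "\<dots> = w B UNIV"
    proof -
      have "c -` {..1} \<inter> space N = c -` UNIV \<inter> space N" using c01(2) by auto
      then show ?thesis by (simp only: w_def)
    qed
    finally show ?case .
  qed
  have borel_sets: "sets borel = sigma_sets UNIV (range (\<lambda>q::rat. {..of_rat q :: real}))"
    by (subst borel_eq_rational_atMost) simp
  have main: "(\<lambda>y. emeasure (?K y) Z) \<in> borel_measurable \<nu> \<and>
      (\<forall>B\<in>sets \<nu>. (\<integral>\<^sup>+y. emeasure (?K y) Z * indicator B y \<partial>\<nu>) = w B Z)"
    if Z: "Z \<in> sets borel" for Z
  proof -
    have "Int_stable (range (\<lambda>q::rat. {..of_rat q :: real}))"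
    proof (rule Int_stableI, safe)
      fix q r :: rat
      show "{..of_rat q :: real} \<inter> {..of_rat r} \<in> range (\<lambda>q::rat. {..of_rat q :: real})"
        by (rule range_eqI[of _ _ "min q r"]) (simp add: min_def of_rat_less_eq)
    qed
    moreover have "range (\<lambda>q::rat. {..of_rat q :: real}) \<subseteq> Pow UNIV" by simp
    moreover note Z[unfolded borel_sets]
    ultimately show ?thesis
    proof (induction rule: sigma_sets_induct_disjoint)
      case (basic A)
      then obtain q where A: "A = {..real_of_rat q}" by auto
      have "(\<integral>\<^sup>+y. emeasure (?K y) A * indicator B y \<partial>\<nu>) = w B A" if "B \<in> sets \<nu>" for B
      proof -
        have "(\<integral>\<^sup>+y. emeasure (?K y) A * indicator B y \<partial>\<nu>) = (\<integral>\<^sup>+y. F y q * indicator B y \<partial>\<nu>)"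
          using good by (intro nn_integral_cong_AE) (auto simp: K_if A)
        then show ?thesis using that by (simp add: Fw A)
      qed
      then show ?case by (simp add: A K_if)
    next
      case empty
      then show ?case by (simp add: w_def)
    next
      case (compl A)
      then have A: "A \<in> sets borel" by (simp add: borel_sets)
      have eq: "emeasure (?K y) (UNIV - A) = emeasure (?K y) UNIV - emeasure (?K y) A" for y
        using emeasure_compl[of A "?K y"] A K_fin by simp
      note [measurable] = compl.IH[THEN conjunct1] UNIV_case[THEN conjunct1]
      have "(\<integral>\<^sup>+y. emeasure (?K y) (UNIV - A) * indicator B y \<partial>\<nu>) = w B (UNIV - A)"
        if B[measurable]: "B \<in> sets \<nu>" for B
      proof -
        have "(\<integral>\<^sup>+y. emeasure (?K y) (UNIV - A) * indicator B y \<partial>\<nu>)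
          = (\<integral>\<^sup>+y. emeasure (?K y) UNIV * indicator B y - emeasure (?K y) A * indicator B y \<partial>\<nu>)"
          by (intro nn_integral_cong) (simp add: eq indicator_def)
        also have "\<dots> = w B UNIV - w B A"
          using B compl.IH UNIV_case w_fin
          by (subst nn_integral_diff) (auto intro!: mult_right_mono emeasure_mono simp: A)
        also have "\<dots> = w B (UNIV - A)"
          unfolding w_def using w_rect[OF B] A
          by (subst emeasure_Diff[symmetric]) (auto intro!: arg_cong2[where f=emeasure])
        finally show ?thesis .
      qed
      then show ?case by (simp add: eq)
    next
      case (union A)
      have A: "A i \<in> sets borel" for i using union by (auto simp: borel_sets)
      have eq: "emeasure (?K y) (\<Union>i. A i) = (\<Sum>i. emeasure (?K y) (A i))" for y
        using A union by (intro suminf_emeasure[symmetric]) auto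
      have [measurable]: "(\<lambda>y. emeasure (?K y) (A i)) \<in> borel_measurable \<nu>" for i using union by auto
      have "(\<integral>\<^sup>+y. emeasure (?K y) (\<Union>i. A i) * indicator B y \<partial>\<nu>) = w B (\<Union>i. A i)"
        if B[measurable]: "B \<in> sets \<nu>" for B
      proof -
        have "(\<integral>\<^sup>+y. emeasure (?K y) (\<Union>i. A i) * indicator B y \<partial>\<nu>) = (\<integral>\<^sup>+y. (\<Sum>i. emeasure (?K y) (A i) * indicator B y) \<partial>\<nu>)"
          by (simp only: eq ennreal_suminf_multc)
        also have "\<dots> = (\<Sum>i. \<integral>\<^sup>+y. emeasure (?K y) (A i) * indicator B y \<partial>\<nu>)"
          by (rule nn_integral_suminf) measurable
        also have "\<dots> = (\<Sum>i. w B (A i))"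
          using B union by (intro arg_cong[where f=suminf] ext) blast
        also have "\<dots> = w B (\<Union>i. A i)"
          unfolding w_def using w_rect[OF B] A union(1)
          by (subst suminf_emeasure) (auto simp: disjoint_family_on_def intro!: arg_cong2[where f=emeasure])
        finally show ?thesis .
      qed
      then show ?case by (simp add: eq)
    qed
  qed
  define \<kappa> where "\<kappa> y = distr (?K y) N g" for y
  have emeasure_\<kappa>: "emeasure (\<kappa> y) A = emeasure (?K y) (g -` A)" if "A \<in> sets N" for y A
    using that by (simp add: \<kappa>_def emeasure_distr)
  have gA: "g -` A \<in> sets borel" if "A \<in> sets N" for A
    using measurable_sets[OF g that] by simp
  have kern: "finite_kernel \<nu> N \<kappa>"
  proof (rule finite_kernelI)
    fix y
    show "finite_measure (\<kappa> y)"
      unfolding \<kappa>_def by (intro finite_measure.finite_measure_distr finite_measure_cdf_measure) simp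
    show "sets (\<kappa> y) = sets N" by (simp add: \<kappa>_def)
  next
    fix A assume "A \<in> sets N"
    then show "(\<lambda>y. emeasure (\<kappa> y) A) \<in> borel_measurable \<nu>"
      using main[OF gA] by (simp add: emeasure_\<kappa>)
  qed
  have rect: "emeasure m (B \<times> A) = (\<integral>\<^sup>+y. emeasure (\<kappa> y) A * indicator B y \<partial>\<nu>)"
    if "B \<in> sets \<nu>" "A \<in> sets N" for B A
  proof -
    have "A \<subseteq> space N" using that(2) by (rule sets.sets_into_space)
    then have "c -` (g -` A) \<inter> space N = A" by (auto simp: gc subset_eq)
    then have "w B (g -` A) = emeasure m (B \<times> A)" by (simp only: w_def)
    moreover have "(\<integral>\<^sup>+y. emeasure (?K y) (g -` A) * indicator B y \<partial>\<nu>) = w B (g -` A)"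
      by (rule main[OF gA[OF that(2)], THEN conjunct2, rule_format, OF that(1)])
    ultimately show ?thesis by (simp only: emeasure_\<kappa>[OF that(2)])
  qed
  show ?thesis
  proof (rule that[of \<kappa>])
    show "finite_kernel \<nu> N \<kappa>" by (rule kern)
    fix f :: "'b \<times> 'a \<Rightarrow> ennreal" assume "f \<in> borel_measurable (\<nu> \<Otimes>\<^sub>M N)"
    then show "(\<integral>\<^sup>+z. f z \<partial>m) = (\<integral>\<^sup>+y. (\<integral>\<^sup>+x. f (y, x) \<partial>\<kappa> y) \<partial>\<nu>)"
      by (rule nn_integral_disintegration[where \<kappa>=\<kappa> and N=N, OF assms(2) sets_m kern, rotated])
         (rule rect)
  qed
qed

section \<open>Reversible kernels and the distribution of stars\<close>

text \<open>On boxes the mass is a finite product of measurable functions, and boxes generate the power.\<close>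

lemma measurable_power_kernel:
  assumes P: "P \<in> M \<rightarrow>\<^sub>M prob_algebra N" and I: "finite I"
  shows "(\<lambda>x. \<Pi>\<^sub>M i\<in>I. P x) \<in> M \<rightarrow>\<^sub>M prob_algebra (\<Pi>\<^sub>M i\<in>I. N)"
proof (rule measurable_prob_algebra_generated)
  show "sets (\<Pi>\<^sub>M i\<in>I. N) = sigma_sets (\<Pi>\<^sub>E i\<in>I. space N) {Pi\<^sub>E I X |X. X \<in> I \<rightarrow> sets N}"
    by (simp add: sets_PiM prod_algebra_eq_finite I)
  show "Int_stable {Pi\<^sub>E I X |X. X \<in> I \<rightarrow> sets N}"
  proof (rule Int_stableI, clarify)
    fix X Y assume "X \<in> I \<rightarrow> sets N" "Y \<in> I \<rightarrow> sets N"
    then show "\<exists>Z. Pi\<^sub>E I X \<inter> Pi\<^sub>E I Y = Pi\<^sub>E I Z \<and> Z \<in> I \<rightarrow> sets N"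
      by (intro exI[of _ "\<lambda>i. X i \<inter> Y i"]) (auto simp: PiE_Int)
  qed
  show "{Pi\<^sub>E I X |X. X \<in> I \<rightarrow> sets N} \<subseteq> Pow (\<Pi>\<^sub>E i\<in>I. space N)"
  proof (clarify)
    fix X f assume "X \<in> I \<rightarrow> sets N" "f \<in> Pi\<^sub>E I X"
    moreover have "X i \<subseteq> space N" if "i \<in> I" for i
      using \<open>X \<in> I \<rightarrow> sets N\<close> that by (intro sets.sets_into_space) auto
    ultimately show "f \<in> (\<Pi>\<^sub>E i\<in>I. space N)" using PiE_mono[of I X "\<lambda>_. space N"] by blast
  qed
next
  fix x assume "x \<in> space M"
  then have *: "prob_space (P x)" "sets (P x) = sets N"
    using measurable_space[OF P] by (auto simp: space_prob_algebra)
  then show "prob_space (\<Pi>\<^sub>M i\<in>I. P x)" by (intro prob_space_PiM)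
  show "sets (\<Pi>\<^sub>M i\<in>I. P x) = sets (\<Pi>\<^sub>M i\<in>I. N)" using * by (intro sets_PiM_cong) auto
next
  fix A assume "A \<in> {Pi\<^sub>E I X |X. X \<in> I \<rightarrow> sets N}"
  then obtain X where A: "A = Pi\<^sub>E I X" and X: "X \<in> I \<rightarrow> sets N" by auto
  have "emeasure (\<Pi>\<^sub>M i\<in>I. P x) A = (\<Prod>i\<in>I. emeasure (P x) (X i))" if "x \<in> space M" for x
  proof -
    have *: "prob_space (P x)" "sets (P x) = sets N"
      using measurable_space[OF P that] by (auto simp: space_prob_algebra)
    then interpret product_prob_space "\<lambda>_. P x" I by (simp add: product_prob_spaceI)
    show ?thesis unfolding A using X * I by (intro emeasure_PiM) auto
  qed
  moreover have "(\<lambda>x. \<Prod>i\<in>I. emeasure (P x) (X i)) \<in> borel_measurable M"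
    using X finite_kernelD(4)[OF finite_kernel_prob_algebra[OF P]]
    by (intro borel_measurable_prod_ennreal) auto
  ultimately show "(\<lambda>x. emeasure (\<Pi>\<^sub>M i\<in>I. P x) A) \<in> borel_measurable M"
    by (simp cong: measurable_cong)
qed

lemma emeasure_power_reindex:
  assumes "prob_space Q" and h: "inj_on h I" "h \<in> I \<rightarrow> K" and B: "B \<in> sets (\<Pi>\<^sub>M i\<in>I. Q)"
  shows "emeasure (\<Pi>\<^sub>M i\<in>K. Q) ((\<lambda>\<omega>. \<lambda>n\<in>I. \<omega> (h n)) -` B \<inter> space (\<Pi>\<^sub>M i\<in>K. Q))
    = emeasure (\<Pi>\<^sub>M i\<in>I. Q) B"
proof -
  have [measurable]: "(\<lambda>\<omega>. \<lambda>n\<in>I. \<omega> (h n)) \<in> (\<Pi>\<^sub>M i\<in>K. Q) \<rightarrow>\<^sub>M (\<Pi>\<^sub>M i\<in>I. Q)"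
    using h(2) by (intro measurable_restrict measurable_component_singleton) auto
  have "distr (\<Pi>\<^sub>M i\<in>K. Q) (\<Pi>\<^sub>M i\<in>I. Q) (\<lambda>\<omega>. \<lambda>n\<in>I. \<omega> (h n)) = (\<Pi>\<^sub>M i\<in>I. Q)"
    using distr_PiM_reindex[of K "\<lambda>_. Q", OF _ h] assms(1) by simp
  then show ?thesis using B emeasure_distr[of "\<lambda>\<omega>. \<lambda>n\<in>I. \<omega> (h n)" "\<Pi>\<^sub>M i\<in>K. Q" "\<Pi>\<^sub>M i\<in>I. Q" B]
    by simp
qed

locale reversible_kernel = prob_space \<pi>
  for J :: "'a measure" and \<pi> :: "'a measure" and P :: "'a \<Rightarrow> 'a measure" +
  assumes sets_pi[measurable_cong]: "sets \<pi> = sets J"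
    and P: "P \<in> J \<rightarrow>\<^sub>M prob_algebra J"
    and reversible: "\<And>f. f \<in> borel_measurable (J \<Otimes>\<^sub>M J) \<Longrightarrow>
      (\<integral>\<^sup>+x. (\<integral>\<^sup>+y. f (x, y) \<partial>P x) \<partial>\<pi>) = (\<integral>\<^sup>+x. (\<integral>\<^sup>+y. f (y, x) \<partial>P x) \<partial>\<pi>)"

lemma (in markov_space) marginal:
  shows "prob_space (marginal J \<eta>)" "sets (marginal J \<eta>) = sets J"
proof -
  have "fst \<in> \<eta> \<rightarrow>\<^sub>M J" using measurable_cong_sets[OF sets_eta refl] measurable_fst by blast
  then show "prob_space (marginal J \<eta>)" "sets (marginal J \<eta>) = sets J"
    by (auto simp: marginal_def intro: prob_space_distr)
qed

lemma (in markov_space) nn_integral_eta: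
  assumes P: "transition_kernel J \<eta> P" and f: "f \<in> borel_measurable (J \<Otimes>\<^sub>M J)"
  shows "(\<integral>\<^sup>+z. f z \<partial>\<eta>) = (\<integral>\<^sup>+x. (\<integral>\<^sup>+y. f (x, y) \<partial>P x) \<partial>marginal J \<eta>)"
proof (rule nn_integral_disintegration)
  note [measurable_cong] = marginal(2)
  have [simp]: "sets (marginal J \<eta> \<Otimes>\<^sub>M J) = sets (J \<Otimes>\<^sub>M J)"
    by (intro sets_pair_measure_cong marginal refl)
  show "finite_measure \<eta>" by (rule finite_measure_axioms)
  show "sets \<eta> = sets (marginal J \<eta> \<Otimes>\<^sub>M J)" by (simp add: sets_eta)
  have "P \<in> J \<rightarrow>\<^sub>M prob_algebra J" using P by (simp add: transition_kernel_def)
  then show "finite_kernel (marginal J \<eta>) J P"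
    by (intro finite_kernel_prob_algebra) (simp cong: measurable_cong_sets)
  show "f \<in> borel_measurable (marginal J \<eta> \<Otimes>\<^sub>M J)" using f by (simp cong: measurable_cong_sets)
qed (use P in \<open>simp add: transition_kernel_def marginal(2)\<close>)

text \<open>Symmetry is only assumed on rectangles, which determine a finite measure.\<close>

lemma (in markov_space) distr_eta_swap: "distr \<eta> (J \<Otimes>\<^sub>M J) (\<lambda>(x, y). (y, x)) = \<eta>"
proof (rule measure_eqI_generator_eq[where A="\<lambda>_. space J \<times> space J"])
  note [measurable_cong] = sets_eta
  show "Int_stable {A \<times> B |A B. A \<in> sets J \<and> B \<in> sets J}" by (rule Int_stable_pair_measure_generator)
  show "{A \<times> B |A B. A \<in> sets J \<and> B \<in> sets J} \<subseteq> Pow (space J \<times> space J)"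
    by (rule pair_measure_closed)
  show "sets (distr \<eta> (J \<Otimes>\<^sub>M J) (\<lambda>(x, y). (y, x))) = sigma_sets (space J \<times> space J) {A \<times> B |A B. A \<in> sets J \<and> B \<in> sets J}"
    "sets \<eta> = sigma_sets (space J \<times> space J) {A \<times> B |A B. A \<in> sets J \<and> B \<in> sets J}"
    by (simp_all add: sets_pair_measure sets_eta)
  show "emeasure (distr \<eta> (J \<Otimes>\<^sub>M J) (\<lambda>(x, y). (y, x))) (space J \<times> space J) \<noteq> \<infinity>"
    using emeasure_finite by (subst emeasure_distr) auto
  fix X assume "X \<in> {A \<times> B |A B. A \<in> sets J \<and> B \<in> sets J}"
  then obtain A B where X: "X = A \<times> B" "A \<in> sets J" "B \<in> sets J" by auto
  have "space \<eta> = space J \<times> space J"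
    using sets_eq_imp_space_eq[OF sets_eta] by (simp add: space_pair_measure)
  then have "(\<lambda>(x, y). (y, x)) -` X \<inter> space \<eta> = B \<times> A"
    using X sets.sets_into_space by (auto simp: X(1))
  then show "emeasure (distr \<eta> (J \<Otimes>\<^sub>M J) (\<lambda>(x, y). (y, x))) X = emeasure \<eta> X"
    using X symmetric by (subst emeasure_distr) auto
qed auto

lemma (in markov_space) reversible_kernel_transition_kernel:
  assumes P: "transition_kernel J \<eta> P"
  shows "reversible_kernel J (marginal J \<eta>) P"
proof (intro reversible_kernel.intro reversible_kernel_axioms.intro marginal)
  show "P \<in> J \<rightarrow>\<^sub>M prob_algebra J" using P by (simp add: transition_kernel_def)
  fix f :: "'a \<times> 'a \<Rightarrow> ennreal" assume f[measurable]: "f \<in> borel_measurable (J \<Otimes>\<^sub>M J)"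
  note [measurable_cong] = sets_eta
  have "(\<integral>\<^sup>+x. (\<integral>\<^sup>+y. f (x, y) \<partial>P x) \<partial>marginal J \<eta>) = (\<integral>\<^sup>+z. f z \<partial>distr \<eta> (J \<Otimes>\<^sub>M J) (\<lambda>(x, y). (y, x)))"
    by (simp add: nn_integral_eta[OF P] distr_eta_swap)
  also have "\<dots> = (\<integral>\<^sup>+z. f (snd z, fst z) \<partial>\<eta>)"
    by (subst nn_integral_distr) (auto simp: case_prod_beta')
  also have "\<dots> = (\<integral>\<^sup>+x. (\<integral>\<^sup>+y. f (y, x) \<partial>P x) \<partial>marginal J \<eta>)"
    by (subst nn_integral_eta[OF P]) auto
  finally show "(\<integral>\<^sup>+x. (\<integral>\<^sup>+y. f (x, y) \<partial>P x) \<partial>marginal J \<eta>)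
    = (\<integral>\<^sup>+x. (\<integral>\<^sup>+y. f (y, x) \<partial>P x) \<partial>marginal J \<eta>)" .
qed

context reversible_kernel
begin

lemma space_pi: "space \<pi> = space J" by (rule sets_eq_imp_space_eq[OF sets_pi])

lemma prob_P: "x \<in> space J \<Longrightarrow> prob_space (P x)" "x \<in> space J \<Longrightarrow> sets (P x) = sets J"
  using measurable_space[OF P] by (auto simp: space_prob_algebra)

lemma sets_power_pi[measurable_cong]: "sets (\<Pi>\<^sub>M i\<in>I. \<pi>) = sets (\<Pi>\<^sub>M i\<in>I. J)"
  by (intro sets_PiM_cong sets_pi refl)

lemma sets_power_P: "x \<in> space J \<Longrightarrow> sets (\<Pi>\<^sub>M i\<in>I. P x) = sets (\<Pi>\<^sub>M i\<in>I. J)"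
  by (intro sets_PiM_cong prob_P refl)

lemma finite_kernel_power: "finite I \<Longrightarrow> finite_kernel J (\<Pi>\<^sub>M i\<in>I. J) (\<lambda>x. \<Pi>\<^sub>M i\<in>I. P x)"
  by (intro finite_kernel_prob_algebra measurable_power_kernel P)

text \<open>Looseness is assumed for \<open>k\<close> neighbors numbered by \<open>{..<k}\<close>. For an index set with at most \<open>k\<close> elements
  it follows by an injection into \<open>{..<k}\<close>: powers of probability measures are mapped to powers.\<close>

lemma absolutely_continuous_neighbors:
  assumes ac: "absolutely_continuous (\<Pi>\<^sub>M i\<in>{..<k}. \<pi>) (\<pi> \<bind> (\<lambda>x. \<Pi>\<^sub>M i\<in>{..<k}. P x))"
    and I: "finite I" "card I \<le> k" and B: "B \<in> null_sets (\<Pi>\<^sub>M i\<in>I. \<pi>)"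
  shows "AE x in \<pi>. emeasure (\<Pi>\<^sub>M i\<in>I. P x) B = 0"
proof -
  obtain h where h: "h ` I \<subseteq> {..<k}" "inj_on h I"
    using card_le_inj[of I "{..<k}"] I by auto
  then have h': "h \<in> I \<rightarrow> {..<k}" by auto
  define B' where "B' = (\<lambda>\<omega>. \<lambda>n\<in>I. \<omega> (h n)) -` B \<inter> space (\<Pi>\<^sub>M i\<in>{..<k}. J)"
  have B_sets: "B \<in> sets (\<Pi>\<^sub>M i\<in>I. J)" using B by (auto simp: sets_power_pi)
  have "(\<lambda>\<omega>. \<lambda>n\<in>I. \<omega> (h n)) \<in> (\<Pi>\<^sub>M i\<in>{..<k}. J) \<rightarrow>\<^sub>M (\<Pi>\<^sub>M i\<in>I. J)"
    using h' by (intro measurable_restrict measurable_component_singleton) auto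
  then have B'_sets: "B' \<in> sets (\<Pi>\<^sub>M i\<in>{..<k}. J)"
    unfolding B'_def using B_sets by (rule measurable_sets)
  have "emeasure (\<Pi>\<^sub>M i\<in>{..<k}. \<pi>) B' = emeasure (\<Pi>\<^sub>M i\<in>I. \<pi>) B"
    unfolding B'_def sets_eq_imp_space_eq[OF sets_power_pi, symmetric]
    by (rule emeasure_power_reindex[OF prob_space_axioms h(2) h']) (simp only: sets_power_pi B_sets)
  then have "B' \<in> null_sets (\<Pi>\<^sub>M i\<in>{..<k}. \<pi>)"
    using B B'_sets by (auto simp: null_sets_def sets_power_pi)
  with ac have "emeasure (\<pi> \<bind> (\<lambda>x. \<Pi>\<^sub>M i\<in>{..<k}. P x)) B' = 0"
    by (auto simp: absolutely_continuous_def)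
  moreover have K: "(\<lambda>x. \<Pi>\<^sub>M i\<in>{..<k}. P x) \<in> \<pi> \<rightarrow>\<^sub>M subprob_algebra (\<Pi>\<^sub>M i\<in>{..<k}. J)"
    using measurable_prob_algebraD[OF measurable_power_kernel[OF P, of "{..<k}"]] by simp
  ultimately have "(\<integral>\<^sup>+x. emeasure (\<Pi>\<^sub>M i\<in>{..<k}. P x) B' \<partial>\<pi>) = 0"
    using emeasure_bind[OF not_empty K B'_sets] by simp
  moreover have "(\<lambda>x. emeasure (\<Pi>\<^sub>M i\<in>{..<k}. P x) B') \<in> borel_measurable \<pi>"
    using finite_kernelD(4)[OF finite_kernel_power B'_sets] by simp
  ultimately have "AE x in \<pi>. emeasure (\<Pi>\<^sub>M i\<in>{..<k}. P x) B' = 0"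
    by (simp add: nn_integral_0_iff_AE)
  with AE_space show ?thesis
  proof eventually_elim
    case (elim x)
    then have x: "x \<in> space J" by (simp only: space_pi)
    have sp: "space (\<Pi>\<^sub>M i\<in>{..<k}. P x) = space (\<Pi>\<^sub>M i\<in>{..<k}. J)"
      by (rule sets_eq_imp_space_eq[OF sets_power_P[OF x]])
    have "emeasure (\<Pi>\<^sub>M i\<in>{..<k}. P x) B' = emeasure (\<Pi>\<^sub>M i\<in>I. P x) B"
      unfolding B'_def sp[symmetric]
      by (rule emeasure_power_reindex[OF prob_P(1)[OF x] h(2) h']) (simp only: sets_power_P[OF x] B_sets)
    with elim(2) show ?case by (simp only:)
  qed
qed

text \<open>Choose \<open>x\<close> from \<open>\<pi>\<close> and its neighbors \<open>y\<close> indexed by \<open>I\<close> independently from \<open>P x\<close>. Looseness says that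
  the distribution of \<open>y\<close> is absolutely continuous with respect to \<open>\<pi>\<^sup>I\<close>; disintegrating over \<open>\<pi>\<^sup>I\<close>, instead of
  over that distribution, gives finite measures \<open>\<rho> y\<close> for the center, whose masses are the values of the
  density.\<close>

lemma star_kernel_exists:
  assumes J: "standard_borel J"
    and ac: "absolutely_continuous (\<Pi>\<^sub>M i\<in>{..<k}. \<pi>) (\<pi> \<bind> (\<lambda>x. \<Pi>\<^sub>M i\<in>{..<k}. P x))"
    and I: "finite I" "card I \<le> k"
  shows "\<exists>\<rho>. finite_kernel (\<Pi>\<^sub>M i\<in>I. J) J \<rho> \<and>
    (\<forall>f\<in>borel_measurable ((\<Pi>\<^sub>M i\<in>I. J) \<Otimes>\<^sub>M J).
      (\<integral>\<^sup>+x. (\<integral>\<^sup>+y. f (y, x) \<partial>\<Pi>\<^sub>M i\<in>I. P x) \<partial>\<pi>) = (\<integral>\<^sup>+y. (\<integral>\<^sup>+x. f (y, x) \<partial>\<rho> y) \<partial>\<Pi>\<^sub>M i\<in>I. \<pi>))"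
proof -
  let ?M = "(\<Pi>\<^sub>M i\<in>I. J) \<Otimes>\<^sub>M J"
  interpret S: integral_functional ?M "\<lambda>f. \<integral>\<^sup>+x. (\<integral>\<^sup>+y. f (y, x) \<partial>\<Pi>\<^sub>M i\<in>I. P x) \<partial>\<pi>"
    by (rule integral_functional_kernel[OF sets_pi finite_kernel_power[OF I(1)]]) measurable
  interpret PI: prob_space "\<Pi>\<^sub>M i\<in>I. \<pi>" by (rule prob_space_PiM) unfold_locales
  have sets_eq: "sets ((\<Pi>\<^sub>M i\<in>I. \<pi>) \<Otimes>\<^sub>M J) = sets ?M"
    by (intro sets_pair_measure_cong sets_power_pi refl)
  have em: "emeasure S.as_measure (B \<times> A) = (\<integral>\<^sup>+x. emeasure (\<Pi>\<^sub>M i\<in>I. P x) B * indicator A x \<partial>\<pi>)"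
    if "B \<in> sets (\<Pi>\<^sub>M i\<in>I. J)" "A \<in> sets J" for A B
  proof -
    have "emeasure S.as_measure (B \<times> A) = (\<integral>\<^sup>+x. (\<integral>\<^sup>+y. indicator (B \<times> A) (y, x) \<partial>\<Pi>\<^sub>M i\<in>I. P x) \<partial>\<pi>)"
      using that by (intro S.emeasure_as_measure) simp
    also have "\<dots> = (\<integral>\<^sup>+x. emeasure (\<Pi>\<^sub>M i\<in>I. P x) B * indicator A x \<partial>\<pi>)"
    proof (intro nn_integral_cong)
      fix x assume "x \<in> space \<pi>"
      with that have [measurable]: "B \<in> sets (\<Pi>\<^sub>M i\<in>I. P x)" by (simp add: space_pi sets_power_P)
      have "(\<integral>\<^sup>+y. indicator B y * indicator A x \<partial>\<Pi>\<^sub>M i\<in>I. P x) = emeasure (\<Pi>\<^sub>M i\<in>I. P x) B * indicator A x"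
        by (subst nn_integral_multc) auto
      then show "(\<integral>\<^sup>+y. indicator (B \<times> A) (y, x) \<partial>\<Pi>\<^sub>M i\<in>I. P x)
        = emeasure (\<Pi>\<^sub>M i\<in>I. P x) B * indicator A x" by (simp add: indicator_times)
    qed
    finally show ?thesis .
  qed
  have fin: "finite_measure S.as_measure"
  proof
    have "emeasure S.as_measure (space ?M) = (\<integral>\<^sup>+x. emeasure (\<Pi>\<^sub>M i\<in>I. P x) (space (\<Pi>\<^sub>M i\<in>I. J)) * indicator (space J) x \<partial>\<pi>)"
      unfolding space_pair_measure by (intro em) auto
    also have "\<dots> \<le> (\<integral>\<^sup>+x. 1 \<partial>\<pi>)"
    proof (intro nn_integral_mono)
      fix x assume "x \<in> space \<pi>"
      then have x: "x \<in> space J" by (simp add: space_pi)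
      have "prob_space (\<Pi>\<^sub>M i\<in>I. P x)" by (intro prob_space_PiM prob_P(1)[OF x])
      note prob_space.emeasure_space_1[OF this]
      then show "emeasure (\<Pi>\<^sub>M i\<in>I. P x) (space (\<Pi>\<^sub>M i\<in>I. J)) * indicator (space J) x \<le> 1"
        using x sets_eq_imp_space_eq[OF sets_power_P[OF x, of I]] by simp
    qed
    finally show "emeasure S.as_measure (space S.as_measure) \<noteq> \<infinity>"
      using emeasure_space_1 by (auto simp: top_unique)
  qed
  have marg: "absolutely_continuous (\<Pi>\<^sub>M i\<in>I. \<pi>) (distr S.as_measure (\<Pi>\<^sub>M i\<in>I. \<pi>) fst)"
    unfolding absolutely_continuous_def
  proof
    fix B assume B: "B \<in> null_sets (\<Pi>\<^sub>M i\<in>I. \<pi>)"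
    then have B': "B \<in> sets (\<Pi>\<^sub>M i\<in>I. J)" by (auto simp: sets_power_pi)
    have "fst -` B \<inter> space S.as_measure = B \<times> space J"
      using sets.sets_into_space[OF B'] by (auto simp: space_pair_measure)
    then have "emeasure (distr S.as_measure (\<Pi>\<^sub>M i\<in>I. \<pi>) fst) B
      = (\<integral>\<^sup>+x. emeasure (\<Pi>\<^sub>M i\<in>I. P x) B * indicator (space J) x \<partial>\<pi>)"
      using B B' em[OF B' sets.top] by (subst emeasure_distr) auto
    also have "\<dots> = (\<integral>\<^sup>+x. 0 \<partial>\<pi>)"
      using absolutely_continuous_neighbors[OF ac I B] by (intro nn_integral_cong_AE) auto
    finally show "B \<in> null_sets (distr S.as_measure (\<Pi>\<^sub>M i\<in>I. \<pi>) fst)"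
      using B by (auto simp: null_sets_def)
  qed
  have "space J \<noteq> {}" using not_empty by (simp add: space_pi)
  with J obtain c :: "'a \<Rightarrow> real" and g where cg: "c \<in> borel_measurable J" "g \<in> borel \<rightarrow>\<^sub>M J"
    "\<And>x. x \<in> space J \<Longrightarrow> g (c x) = x" "\<And>x. 0 \<le> c x" "\<And>x. c x \<le> 1"
    by (rule standard_borel_real_coding) (rule that)
  have "sets S.as_measure = sets ((\<Pi>\<^sub>M i\<in>I. \<pi>) \<Otimes>\<^sub>M J)" by (simp add: sets_eq)
  note disint = disintegration_exists[OF PI.sigma_finite_measure_axioms fin this marg cg]
  obtain \<rho> where \<rho>: "finite_kernel (\<Pi>\<^sub>M i\<in>I. \<pi>) J \<rho>"
    and int: "\<And>f. f \<in> borel_measurable ((\<Pi>\<^sub>M i\<in>I. \<pi>) \<Otimes>\<^sub>M J) \<Longrightarrow>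
      (\<integral>\<^sup>+z. f z \<partial>S.as_measure) = (\<integral>\<^sup>+y. (\<integral>\<^sup>+x. f (y, x) \<partial>\<rho> y) \<partial>\<Pi>\<^sub>M i\<in>I. \<pi>)"
    by (rule disint, assumption) (rule that)
  show ?thesis
  proof (intro exI[of _ \<rho>] conjI ballI)
    show "finite_kernel (\<Pi>\<^sub>M i\<in>I. J) J \<rho>"
      using \<rho> unfolding finite_kernel_def sets_eq_imp_space_eq[OF sets_power_pi[of I]]
        measurable_cong_sets[OF sets_power_pi[of I] refl] .
    fix f :: "('b \<Rightarrow> 'a) \<times> 'a \<Rightarrow> ennreal" assume f: "f \<in> borel_measurable ?M"
    then have "f \<in> borel_measurable ((\<Pi>\<^sub>M i\<in>I. \<pi>) \<Otimes>\<^sub>M J)"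
      using measurable_cong_sets[OF sets_eq refl] by blast
    from int[OF this] S.nn_integral_as_measure[OF f]
    show "(\<integral>\<^sup>+x. (\<integral>\<^sup>+y. f (y, x) \<partial>\<Pi>\<^sub>M i\<in>I. P x) \<partial>\<pi>) = (\<integral>\<^sup>+y. (\<integral>\<^sup>+x. f (y, x) \<partial>\<rho> y) \<partial>\<Pi>\<^sub>M i\<in>I. \<pi>)"
      by simp
  qed
qed

end

section \<open>Iterated star integrals\<close>

text \<open>The data for the sequential construction. The kernels \<open>\<rho> N\<close> reverse the stars with leaves \<open>N\<close>, where \<open>N\<close>
  consists of neighbors of a single vertex. The last graph conditions exclude cycles of length 3 and 4:
  for adjacent \<open>u\<close> and \<open>v\<close> the remaining neighbors of \<open>u\<close> and of \<open>v\<close> form an independent set.\<close>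

locale star_system = reversible_kernel J \<pi> P
  for J :: "'a measure" and \<pi> :: "'a measure" and P :: "'a \<Rightarrow> 'a measure" +
  fixes nbr :: "'v \<Rightarrow> 'v set" and \<rho> :: "'v set \<Rightarrow> ('v \<Rightarrow> 'a) \<Rightarrow> 'a measure"
  assumes finite_nbr: "finite (nbr v)"
    and nbr_irrefl: "v \<notin> nbr v"
    and nbr_sym: "u \<in> nbr v \<Longrightarrow> v \<in> nbr u"
    and no_triangle: "a \<in> nbr v \<Longrightarrow> b \<in> nbr v \<Longrightarrow> a \<notin> nbr b"
    and no_square: "u \<in> nbr v \<Longrightarrow> a \<in> nbr u \<Longrightarrow> a \<noteq> v \<Longrightarrow> b \<in> nbr v \<Longrightarrow> b \<noteq> u \<Longrightarrow> a \<notin> nbr b"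
    and finite_kernel_rho: "N \<subseteq> nbr v \<Longrightarrow> finite_kernel (\<Pi>\<^sub>M i\<in>N. J) J (\<rho> N)"
    and star: "N \<subseteq> nbr v \<Longrightarrow> f \<in> borel_measurable ((\<Pi>\<^sub>M i\<in>N. J) \<Otimes>\<^sub>M J) \<Longrightarrow>
      (\<integral>\<^sup>+x. (\<integral>\<^sup>+y. f (y, x) \<partial>\<Pi>\<^sub>M i\<in>N. P x) \<partial>\<pi>) = (\<integral>\<^sup>+y. (\<integral>\<^sup>+x. f (y, x) \<partial>\<rho> N y) \<partial>\<Pi>\<^sub>M i\<in>N. \<pi>)"
begin

abbreviation pow :: "'v set \<Rightarrow> ('v \<Rightarrow> 'a) measure" where
  "pow S \<equiv> \<Pi>\<^sub>M i\<in>S. J"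

definition ext_kernel :: "'v set \<Rightarrow> 'v \<Rightarrow> ('v \<Rightarrow> 'a) \<Rightarrow> 'a measure" where
  "ext_kernel S v x = \<rho> (nbr v \<inter> S) (restrict x (nbr v \<inter> S))"

text \<open>Integration over the coordinates in the list, added in this order to the coordinates in \<open>S\<close>. The
  coordinate of a new vertex is distributed by the star kernel for those of its neighbors that are
  already present.\<close>

primrec iter :: "'v set \<Rightarrow> 'v list \<Rightarrow> (('v \<Rightarrow> 'a) \<Rightarrow> ennreal) \<Rightarrow> ('v \<Rightarrow> 'a) \<Rightarrow> ennreal" where
  "iter S [] f x = f x"
| "iter S (v # vs) f x = (\<integral>\<^sup>+t. iter (insert v S) vs f (x(v := t)) \<partial>ext_kernel S v x)"

lemma finite_kernel_ext: "finite_kernel (pow S) J (ext_kernel S v)"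
  unfolding ext_kernel_def[abs_def]
  by (rule finite_kernel_comp[OF finite_kernel_rho[of _ v] measurable_restrict_subset]) auto

lemmas ext_kernel = finite_kernelD[OF finite_kernel_ext]

lemma measurable_ext_kernel: "x \<in> space (pow S) \<Longrightarrow> borel_measurable (ext_kernel S v x) = borel_measurable J"
  by (rule measurable_cong_sets[OF ext_kernel(2) refl])

lemma measurable_upd: "(\<lambda>(x, t). x(v := t)) \<in> pow S \<Otimes>\<^sub>M J \<rightarrow>\<^sub>M pow (insert v S)"
  using measurable_add_dim[of v S "\<lambda>_. J"] by simp

lemma space_upd: "x \<in> space (pow S) \<Longrightarrow> t \<in> space J \<Longrightarrow> x(v := t) \<in> space (pow (insert v S))"
  using measurable_space[OF measurable_upd, of "(x, t)" S v] by (simp add: space_pair_measure)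

lemma measurable_upd2:
  assumes "f \<in> borel_measurable (pow (insert v S))"
  shows "(\<lambda>(x, t). f (x(v := t))) \<in> borel_measurable (pow S \<Otimes>\<^sub>M J)"
  using measurable_compose[OF measurable_upd assms] by (simp add: case_prod_beta')

lemma measurable_upd1:
  assumes "f \<in> borel_measurable (pow (insert v S))" "x \<in> space (pow S)"
  shows "(\<lambda>t. f (x(v := t))) \<in> borel_measurable J"
  using measurable_Pair2[OF measurable_upd2[OF assms(1)] assms(2)] by simp

lemma measurable_iter:
  "f \<in> borel_measurable (pow (S \<union> set vs)) \<Longrightarrow> iter S vs f \<in> borel_measurable (pow S)"
proof (induction vs arbitrary: S)
  case Nil
  then show ?case by (simp add: iter.simps(1)[abs_def])
next
  case (Cons v vs)
  then have "iter (insert v S) vs f \<in> borel_measurable (pow (insert v S))" by simp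
  from borel_measurable_nn_integral_kernel[OF finite_kernel_ext measurable_upd2[OF this]]
  show ?case by (subst iter.simps(2)[abs_def])
qed

lemma measurable_iter_upd:
  assumes "f \<in> borel_measurable (pow (S \<union> set (v # vs)))" "x \<in> space (pow S)"
  shows "(\<lambda>t. iter (insert v S) vs f (x(v := t))) \<in> borel_measurable (ext_kernel S v x)"
  unfolding measurable_ext_kernel[OF assms(2)]
  by (rule measurable_upd1[OF measurable_iter]) (use assms in simp_all)

lemma iter_cong:
  assumes "x \<in> space (pow S)" "\<And>z. z \<in> space (pow (S \<union> set vs)) \<Longrightarrow> f z = g z"
  shows "iter S vs f x = iter S vs g x"
  using assms
proof (induction vs arbitrary: S x)
  case (Cons v vs)
  then show ?case
    by (auto intro!: nn_integral_cong Cons.IH space_upd simp: ext_kernel(3))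
qed simp

text \<open>The coordinates in \<open>S\<close> keep their values during the integration.\<close>

lemma iter_cong_fibre:
  assumes "x \<in> space (pow S)" "distinct vs" "set vs \<inter> S = {}"
    and "\<And>z. z \<in> space (pow (S \<union> set vs)) \<Longrightarrow> restrict z S = x \<Longrightarrow> f z = g z"
  shows "iter S vs f x = iter S vs g x"
  using assms
proof (induction vs arbitrary: S x)
  case Nil
  then show ?case by (auto simp: space_PiM PiE_restrict)
next
  case (Cons v vs)
  show ?case
    unfolding iter.simps
  proof (intro nn_integral_cong Cons.IH)
    fix t z assume "t \<in> space (ext_kernel S v x)"
    then have t: "t \<in> space J" using Cons.prems(1) by (simp add: ext_kernel(3))
    then show "x(v := t) \<in> space (pow (insert v S))" using Cons.prems(1) by (intro space_upd)
    assume z: "z \<in> space (pow (insert v S \<union> set vs))" "restrict z (insert v S) = x(v := t)"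
    have "restrict z S = x"
    proof
      fix i show "restrict z S i = x i"
        using z(2)[THEN fun_cong, of i] Cons.prems(1,3) by (auto simp: restrict_def space_PiM PiE_def extensional_def split: if_splits)
    qed
    then show "f z = g z" using z(1) by (intro Cons.prems) simp_all
  qed (use Cons.prems in auto)
qed

lemma integral_functional_iter:
  assumes "x \<in> space (pow S)"
  shows "integral_functional (pow (S \<union> set vs)) (\<lambda>f. iter S vs f x)"
proof
  fix f g :: "('v \<Rightarrow> 'a) \<Rightarrow> ennreal" assume "\<And>z. z \<in> space (pow (S \<union> set vs)) \<Longrightarrow> f z = g z"
  then show "iter S vs f x = iter S vs g x" by (rule iter_cong[OF assms])
next
  fix f :: "('v \<Rightarrow> 'a) \<Rightarrow> ennreal" and c assume "f \<in> borel_measurable (pow (S \<union> set vs))"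
  then show "iter S vs (\<lambda>x. c * f x) x = c * iter S vs f x"
    using assms
  proof (induction vs arbitrary: S x)
    case (Cons v vs)
    have "iter S (v # vs) (\<lambda>x. c * f x) x = (\<integral>\<^sup>+t. c * iter (insert v S) vs f (x(v := t)) \<partial>ext_kernel S v x)"
      unfolding iter.simps using Cons.prems
      by (intro nn_integral_cong Cons.IH space_upd) (simp_all add: ext_kernel(3))
    also have "\<dots> = c * iter S (v # vs) f x"
      unfolding iter.simps by (intro nn_integral_cmult measurable_iter_upd Cons.prems)
    finally show ?case .
  qed simp
next
  fix f g :: "('v \<Rightarrow> 'a) \<Rightarrow> ennreal"
  assume "f \<in> borel_measurable (pow (S \<union> set vs))" "g \<in> borel_measurable (pow (S \<union> set vs))"
  then show "iter S vs (\<lambda>x. f x + g x) x = iter S vs f x + iter S vs g x"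
    using assms
  proof (induction vs arbitrary: S x)
    case (Cons v vs)
    have "iter S (v # vs) (\<lambda>x. f x + g x) x
      = (\<integral>\<^sup>+t. iter (insert v S) vs f (x(v := t)) + iter (insert v S) vs g (x(v := t)) \<partial>ext_kernel S v x)"
      unfolding iter.simps using Cons.prems
      by (intro nn_integral_cong Cons.IH space_upd) (simp_all add: ext_kernel(3))
    also have "\<dots> = iter S (v # vs) f x + iter S (v # vs) g x"
      unfolding iter.simps by (intro nn_integral_add measurable_iter_upd Cons.prems)
    finally show ?case .
  qed simp
next
  fix U :: "nat \<Rightarrow> ('v \<Rightarrow> 'a) \<Rightarrow> ennreal"
  assume "\<And>i. U i \<in> borel_measurable (pow (S \<union> set vs))" and inc: "incseq U"
  then show "iter S vs (\<lambda>x. SUP i. U i x) x = (SUP i. iter S vs (U i) x)"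
    using assms
  proof (induction vs arbitrary: S x)
    case (Cons v vs)
    have mono: "iter T ws (U i) y \<le> iter T ws (U j) y" if "i \<le> j" for T ws y i j
    proof (induction ws arbitrary: T y)
      case Nil then show ?case using inc that by (simp add: incseq_def le_fun_def)
    qed (auto intro: nn_integral_mono)
    have "iter S (v # vs) (\<lambda>x. SUP i. U i x) x
      = (\<integral>\<^sup>+t. (SUP i. iter (insert v S) vs (U i) (x(v := t))) \<partial>ext_kernel S v x)"
      unfolding iter.simps using Cons.prems
      by (intro nn_integral_cong Cons.IH space_upd) (simp_all add: ext_kernel(3))
    also have "\<dots> = (SUP i. iter S (v # vs) (U i) x)"
      unfolding iter.simps using mono
      by (intro nn_integral_monotone_convergence_SUP measurable_iter_upd Cons.prems)
         (simp add: incseq_def le_fun_def)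
    finally show ?case .
  qed simp
qed

definition iter_measure :: "'v set \<Rightarrow> 'v list \<Rightarrow> ('v \<Rightarrow> 'a) \<Rightarrow> ('v \<Rightarrow> 'a) measure" where
  "iter_measure S vs x = integral_functional.as_measure (pow (S \<union> set vs)) (\<lambda>f. iter S vs f x)"

lemma sets_iter_measure: "x \<in> space (pow S) \<Longrightarrow> sets (iter_measure S vs x) = sets (pow (S \<union> set vs))"
  unfolding iter_measure_def by (rule integral_functional.sets_as_measure[OF integral_functional_iter])

lemma nn_integral_iter_measure:
  "x \<in> space (pow S) \<Longrightarrow> f \<in> borel_measurable (pow (S \<union> set vs)) \<Longrightarrow>
    (\<integral>\<^sup>+z. f z \<partial>iter_measure S vs x) = iter S vs f x"
  unfolding iter_measure_def by (rule integral_functional.nn_integral_as_measure[OF integral_functional_iter])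

lemma iter_zero: "x \<in> space (pow S) \<Longrightarrow> iter S vs (\<lambda>z. 0) x = 0"
  by (rule integral_functional.zero[OF integral_functional_iter])

lemma iter_append: "iter S (us @ vs) f x = iter S us (iter (S \<union> set us) vs f) x"
  by (induction us arbitrary: S x) simp_all

text \<open>The fibre masses of the kernels are finite but unbounded, so \<open>iter\<close> yields only sigma-finite measures;
  the product of the inverses of one plus these masses is a weight of integral at most one.\<close>

lemma iter_weight_exists:
  "distinct vs \<Longrightarrow> set vs \<inter> S = {} \<Longrightarrow>
    \<exists>w. w \<in> borel_measurable (pow (S \<union> set vs)) \<and> (\<forall>z\<in>space (pow (S \<union> set vs)). w z \<noteq> 0 \<and> w z \<noteq> \<infinity>) \<and>
      (\<forall>x\<in>space (pow S). iter S vs w x \<le> 1)"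
proof (induction vs arbitrary: S)
  case Nil
  then show ?case by (intro exI[of _ "\<lambda>_. 1"]) simp
next
  case (Cons v vs)
  let ?T = "S \<union> set (v # vs)"
  have T: "insert v S \<union> set vs = ?T" by simp
  have "distinct vs" "set vs \<inter> insert v S = {}" using Cons.prems by auto
  from Cons.IH[OF this] obtain w
    where w: "w \<in> borel_measurable (pow ?T)" "\<And>z. z \<in> space (pow ?T) \<Longrightarrow> w z \<noteq> 0 \<and> w z \<noteq> \<infinity>"
      and le: "\<And>x. x \<in> space (pow (insert v S)) \<Longrightarrow> iter (insert v S) vs w x \<le> 1"
    unfolding T by blast
  \<comment> \<open>Dividing by \<open>1 +\<close> the mass of the kernel keeps every integration step at most \<open>1\<close>.\<close>
  define m where "m x = 1 + emeasure (ext_kernel S v x) (space J)" for x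
  have m_fin: "m x \<noteq> \<infinity>" "m x \<noteq> 0" if "x \<in> space (pow S)" for x
    using finite_measure.emeasure_finite[OF ext_kernel(1)[OF that]] by (auto simp: m_def)
  have m: "m \<in> borel_measurable (pow S)"
    unfolding m_def using ext_kernel(4)[OF sets.top] by measurable
  have restr: "(\<lambda>z. restrict z S) \<in> pow ?T \<rightarrow>\<^sub>M pow S" by (rule measurable_restrict_subset) auto
  let ?w = "\<lambda>z. inverse (m (restrict z S)) * w z"
  show ?case
  proof (intro exI[of _ ?w] conjI ballI)
    have "(\<lambda>z. m (restrict z S)) \<in> borel_measurable (pow ?T)"
      using measurable_compose[OF restr m] .
    then show "?w \<in> borel_measurable (pow ?T)" using w(1) by measurable
  next
    fix z assume z: "z \<in> space (pow ?T)"
    with m_fin[OF measurable_space[OF restr z]] w(2)[OF z] show "?w z \<noteq> 0" "?w z \<noteq> \<infinity>"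
      by (auto simp: ennreal_mult_eq_top_iff)
  next
    fix x assume x: "x \<in> space (pow S)"
    interpret F: integral_functional "pow ?T" "\<lambda>f. iter S (v # vs) f x"
      by (rule integral_functional_iter[OF x])
    have "iter S (v # vs) ?w x = iter S (v # vs) (\<lambda>z. inverse (m x) * w z) x"
      by (rule iter_cong_fibre[OF x Cons.prems]) simp
    also have "\<dots> = inverse (m x) * iter S (v # vs) w x" by (rule F.cmult[OF w(1)])
    also have "iter S (v # vs) w x \<le> (\<integral>\<^sup>+t. 1 \<partial>ext_kernel S v x)"
      unfolding iter.simps by (intro nn_integral_mono le space_upd x) (simp add: ext_kernel(3)[OF x])
    also have "\<dots> \<le> m x" by (simp add: m_def ext_kernel(3)[OF x])
    finally have "iter S (v # vs) ?w x \<le> inverse (m x) * m x" by (simp add: mult_left_mono)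
    also have "\<dots> = 1"
      using m_fin[OF x] ennreal_divide_self[of "m x"]
      by (simp add: divide_ennreal_def less_top mult.commute)
    finally show "iter S (v # vs) ?w x \<le> 1" .
  qed
qed

lemma sigma_finite_iter_measure:
  assumes x: "x \<in> space (pow S)" and vs: "distinct vs" "set vs \<inter> S = {}"
  shows "sigma_finite_measure (iter_measure S vs x)"
proof -
  obtain w where w: "w \<in> borel_measurable (pow (S \<union> set vs))"
      "\<And>z. z \<in> space (pow (S \<union> set vs)) \<Longrightarrow> w z \<noteq> 0 \<and> w z \<noteq> \<infinity>" "iter S vs w x \<le> 1"
    using iter_weight_exists[OF vs] x by blast
  show ?thesis
  proof (rule sigma_finite_measure_if_weight)
    show "w \<in> borel_measurable (iter_measure S vs x)"
      unfolding measurable_cong_sets[OF sets_iter_measure[OF x] refl] by (rule w(1))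
    show "w z \<noteq> 0 \<and> w z \<noteq> \<infinity>" if "z \<in> space (iter_measure S vs x)" for z
      using that w(2) sets_eq_imp_space_eq[OF sets_iter_measure[OF x]] by blast
    show "(\<integral>\<^sup>+z. w z \<partial>iter_measure S vs x) \<noteq> \<infinity>"
      using w(3) by (auto simp: nn_integral_iter_measure[OF x w(1)] top_unique)
  qed
qed

lemma measurable_upd_pair:
  assumes x: "x \<in> space (pow S)"
  shows "(\<lambda>(a, b). x(u := a, v := b)) \<in> J \<Otimes>\<^sub>M J \<rightarrow>\<^sub>M pow (insert v (insert u S))"
proof -
  have "(\<lambda>z. x(u := fst z)) \<in> J \<Otimes>\<^sub>M J \<rightarrow>\<^sub>M pow (insert u S)"
    using measurable_compose[OF measurable_fst measurable_Pair2[OF measurable_upd x]] by simp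
  then have "(\<lambda>z. (x(u := fst z), snd z)) \<in> J \<Otimes>\<^sub>M J \<rightarrow>\<^sub>M pow (insert u S) \<Otimes>\<^sub>M J"
    by (rule measurable_Pair) simp
  from measurable_compose[OF this measurable_upd[of v]] show ?thesis by (simp add: case_prod_beta')
qed

text \<open>Neither kernel depends on the other new coordinate, so this is Fubini's theorem. It holds for every
  \<open>x\<close>, which is why the Markov property will hold without exceptional sets.\<close>

lemma iter_swap_nonadjacent:
  assumes x: "x \<in> space (pow S)" and uv: "u \<noteq> v" "u \<notin> S" "v \<notin> S" "u \<notin> nbr v"
    and g: "g \<in> borel_measurable (pow (insert u (insert v S)))"
  shows "iter S [u, v] g x = iter S [v, u] g x"
proof -
  have "v \<notin> nbr u" using uv(4) nbr_sym by blast
  then have K: "ext_kernel (insert u S) v (x(u := a)) = ext_kernel S v x"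
    "ext_kernel (insert v S) u (x(v := a)) = ext_kernel S u x" for a
    using uv unfolding ext_kernel_def
    by (auto intro!: arg_cong2[where f=\<rho>] simp: fun_eq_iff restrict_def)
  note upd = measurable_upd_pair[OF x, of u v]
  have g': "g \<in> borel_measurable (pow (insert v (insert u S)))" using g by (simp add: insert_commute)
  have "(\<integral>\<^sup>+a. (\<integral>\<^sup>+b. g (x(u := a, v := b)) \<partial>ext_kernel S v x) \<partial>ext_kernel S u x)
    = (\<integral>\<^sup>+b. (\<integral>\<^sup>+a. g (x(u := a, v := b)) \<partial>ext_kernel S u x) \<partial>ext_kernel S v x)"
    using measurable_compose[OF upd g']
    by (intro nn_integral_swap[of _ _ J J] ext_kernel x) (simp_all add: case_prod_beta')
  then show ?thesis using uv(1) by (simp add: K fun_upd_twist)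
qed

text \<open>Coordinates in \<open>R\<close> do not occur in the kernels of vertices without neighbors in \<open>R\<close>: they are mere
  parameters of the integrand.\<close>

lemma iter_local:
  assumes "x \<in> space (pow (S \<union> R))" "distinct vs" "set vs \<inter> (S \<union> R) = {}" "S \<inter> R = {}"
    and "\<And>v r. v \<in> set vs \<Longrightarrow> r \<in> R \<Longrightarrow> r \<notin> nbr v"
  shows "iter (S \<union> R) vs f x = iter S vs (\<lambda>z. f (\<lambda>i. if i \<in> R then x i else z i)) (restrict x S)"
  using assms
proof (induction vs arbitrary: S x)
  case Nil
  have eq: "(\<lambda>i. if i \<in> R then x i else restrict x S i) = x"
    using Nil.prems(1) by (auto simp: space_PiM PiE_def extensional_def)
  show ?case by (simp only: iter.simps eq)
next
  case (Cons v vs)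
  have v: "v \<notin> S" "v \<notin> R" "v \<notin> set vs" using Cons.prems by auto
  have nb: "nbr v \<inter> (S \<union> R) = nbr v \<inter> S" using Cons.prems(5)[of v] by auto
  have K: "ext_kernel (S \<union> R) v x = ext_kernel S v (restrict x S)"
    unfolding ext_kernel_def nb by (simp add: inf.absorb2)
  show ?case
    unfolding iter.simps K
  proof (intro nn_integral_cong)
    fix t assume "t \<in> space (ext_kernel S v (restrict x S))"
    then have t: "t \<in> space J"
      using Cons.prems(1) by (subst (asm) ext_kernel(3)) (auto simp: space_PiM intro!: restrict_PiE)
    have up: "x(v := t) \<in> space (pow (insert v S \<union> R))"
      using space_upd[OF Cons.prems(1) t, of v] by (simp only: Un_insert_left)
    have "iter (insert v S \<union> R) vs f (x(v := t)) = iter (insert v S) vs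
        (\<lambda>z. f (\<lambda>i. if i \<in> R then (x(v := t)) i else z i)) (restrict (x(v := t)) (insert v S))"
      using Cons.prems v by (intro Cons.IH[OF up]) auto
    also have "restrict (x(v := t)) (insert v S) = (restrict x S)(v := t)"
      using v by (auto simp: restrict_def)
    also have "(\<lambda>z. f (\<lambda>i. if i \<in> R then (x(v := t)) i else z i)) = (\<lambda>z. f (\<lambda>i. if i \<in> R then x i else z i))"
      using v by (intro ext arg_cong[where f=f]) auto
    finally show "iter (insert v (S \<union> R)) vs f (x(v := t))
      = iter (insert v S) vs (\<lambda>z. f (\<lambda>i. if i \<in> R then x i else z i)) ((restrict x S)(v := t))"
      by (simp only: Un_insert_left)
  qed
qed

abbreviation \<omega> :: "'v \<Rightarrow> 'a" where "\<omega> \<equiv> \<lambda>_. undefined"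

text \<open>A star without leaves is a single point chosen from \<open>\<pi>\<close>.\<close>

lemma nn_integral_rho_empty:
  assumes h: "h \<in> borel_measurable J"
  shows "(\<integral>\<^sup>+t. h t \<partial>\<rho> {} \<omega>) = (\<integral>\<^sup>+t. h t \<partial>\<pi>)"
proof -
  have "(\<lambda>z. h (snd z)) \<in> borel_measurable (pow {} \<Otimes>\<^sub>M J)" using h by measurable
  from star[OF empty_subsetI this] show ?thesis
    by (simp add: PiM_empty nn_integral_count_space_finite emeasure_count_space_finite)
qed

text \<open>In an independent set every vertex is added without neighbors, hence independently and from \<open>\<pi>\<close>.\<close>

lemma iter_independent:
  assumes "distinct vs" "\<And>a b. a \<in> set vs \<Longrightarrow> b \<in> set vs \<Longrightarrow> a \<notin> nbr b"
    and "f \<in> borel_measurable (pow (set vs))"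
  shows "iter {} vs f \<omega> = (\<integral>\<^sup>+x. f x \<partial>\<Pi>\<^sub>M i\<in>set vs. \<pi>)"
  using assms
proof (induction vs arbitrary: f rule: rev_induct)
  case Nil
  then show ?case by (simp add: PiM_empty nn_integral_count_space_finite)
next
  case (snoc w vs)
  interpret product_sigma_finite "\<lambda>_::'v. \<pi>" by unfold_locales
  have w: "w \<notin> set vs" "nbr w \<inter> set vs = {}" using snoc.prems by auto
  have f: "f \<in> borel_measurable (pow (insert w (set vs)))" using snoc.prems by simp
  have "iter {} (vs @ [w]) f \<omega> = iter {} vs (iter (set vs) [w] f) \<omega>" by (simp only: iter_append Un_empty_left)
  also have "\<dots> = (\<integral>\<^sup>+x. iter (set vs) [w] f x \<partial>\<Pi>\<^sub>M i\<in>set vs. \<pi>)"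
    using snoc.prems f by (intro snoc.IH measurable_iter) simp_all
  also have "\<dots> = (\<integral>\<^sup>+x. (\<integral>\<^sup>+t. f (x(w := t)) \<partial>\<pi>) \<partial>\<Pi>\<^sub>M i\<in>set vs. \<pi>)"
  proof (intro nn_integral_cong)
    fix x assume "x \<in> space (\<Pi>\<^sub>M i\<in>set vs. \<pi>)"
    then have x: "x \<in> space (pow (set vs))" by (simp only: sets_eq_imp_space_eq[OF sets_power_pi])
    have "ext_kernel (set vs) w x = \<rho> {} \<omega>" by (simp add: ext_kernel_def w restrict_def)
    then show "iter (set vs) [w] f x = (\<integral>\<^sup>+t. f (x(w := t)) \<partial>\<pi>)"
      using nn_integral_rho_empty[OF measurable_upd1[OF f x]] by simp
  qed
  also have "\<dots> = (\<integral>\<^sup>+x. f x \<partial>\<Pi>\<^sub>M i\<in>insert w (set vs). \<pi>)"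
    using w f measurable_cong_sets[OF sets_power_pi refl, of "insert w (set vs)"]
    by (intro product_nn_integral_insert[symmetric]) auto
  finally show ?case by simp
qed

section \<open>Two adjacent centers\<close>

lemma finite_measure_power_pi: "finite_measure (\<Pi>\<^sub>M i\<in>I. \<pi>)"
  by (intro prob_space.finite_measure prob_space_PiM prob_space_axioms)

lemma finite_measure_power_P: "x \<in> space J \<Longrightarrow> finite_measure (\<Pi>\<^sub>M i\<in>I. P x)"
  by (intro prob_space.finite_measure prob_space_PiM prob_P)

lemma space_power_pi: "space (\<Pi>\<^sub>M i\<in>I. \<pi>) = space (pow I)"
  by (rule sets_eq_imp_space_eq[OF sets_power_pi])

lemma measurable_double_upd:
  assumes f: "f \<in> borel_measurable (pow (insert v (insert u (A \<union> B))))"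
    and yz: "y \<in> L \<rightarrow>\<^sub>M pow A" "z \<in> L \<rightarrow>\<^sub>M pow B" and ab: "a \<in> L \<rightarrow>\<^sub>M J" "b \<in> L \<rightarrow>\<^sub>M J"
  shows "(\<lambda>w. f ((merge A B (y w, z w))(u := a w, v := b w))) \<in> borel_measurable L"
proof -
  have "(\<lambda>w. merge A B (y w, z w)) \<in> L \<rightarrow>\<^sub>M pow (A \<union> B)"
    using yz by (intro measurable_compose[OF _ measurable_merge] measurable_Pair)
  with ab have "(\<lambda>w. (merge A B (y w, z w), a w)) \<in> L \<rightarrow>\<^sub>M pow (A \<union> B) \<Otimes>\<^sub>M J" by measurable
  from measurable_compose[OF this measurable_upd[of u]]
  have "(\<lambda>w. (merge A B (y w, z w))(u := a w)) \<in> L \<rightarrow>\<^sub>M pow (insert u (A \<union> B))" by simp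
  with ab have "(\<lambda>w. ((merge A B (y w, z w))(u := a w), b w)) \<in> L \<rightarrow>\<^sub>M pow (insert u (A \<union> B)) \<Otimes>\<^sub>M J"
    by measurable
  from measurable_compose[OF this measurable_upd[of v]]
  have "(\<lambda>w. (merge A B (y w, z w))(u := a w, v := b w)) \<in> L \<rightarrow>\<^sub>M pow (insert v (insert u (A \<union> B)))" by simp
  from measurable_compose[OF this f] show ?thesis .
qed

text \<open>Here \<open>b\<close> is the coordinate of \<open>v\<close>, \<open>a\<close> that of \<open>u\<close>, and \<open>y\<close>, \<open>z\<close> are those of the leaves \<open>A\<close> of \<open>u\<close> and
  \<open>B\<close> of \<open>v\<close>. The left side starts from independent leaves and adds first \<open>u\<close>, then \<open>v\<close> as the center of a star with leaves
  \<open>B\<close> and \<open>u\<close>. Reversing the star of \<open>u\<close> and then the star of \<open>v\<close> leads to the right side, where \<open>v\<close> comes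
  first, \<open>u\<close> is one of its random neighbors, and the leaves are random neighbors of \<open>u\<close> and \<open>v\<close>.\<close>

lemma iter_star_pair:
  assumes uv: "u \<in> nbr v" "u \<noteq> v" "u \<notin> A \<union> B" "v \<notin> A \<union> B" and AB: "A \<inter> B = {}"
    and A: "nbr u \<inter> (A \<union> B) = A" and B: "nbr v \<inter> insert u (A \<union> B) = insert u B"
    and f: "f \<in> borel_measurable (pow (insert v (insert u (A \<union> B))))"
  shows "(\<integral>\<^sup>+x. iter (A \<union> B) [u, v] f x \<partial>\<Pi>\<^sub>M i\<in>A \<union> B. \<pi>) =
    (\<integral>\<^sup>+b. (\<integral>\<^sup>+a. (\<integral>\<^sup>+z. (\<integral>\<^sup>+y. f ((merge A B (y, z))(u := a, v := b))
      \<partial>\<Pi>\<^sub>M i\<in>A. P a) \<partial>\<Pi>\<^sub>M i\<in>B. P b) \<partial>P b) \<partial>\<pi>)"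
proof -
  have A_nbr: "A \<subseteq> nbr u" and B_nbr: "insert u B \<subseteq> nbr v" using A B by auto
  have fin: "finite A" "finite B"
    using finite_subset[OF A_nbr finite_nbr] finite_subset[OF B_nbr finite_nbr] by auto
  define F where "F y z a b = f ((merge A B (y, z))(u := a, v := b))" for y z a b
  have F_meas[measurable (raw)]: "(\<lambda>w. F (y w) (z w) (a w) (b w)) \<in> borel_measurable L"
    if "y \<in> L \<rightarrow>\<^sub>M pow A" "z \<in> L \<rightarrow>\<^sub>M pow B" "a \<in> L \<rightarrow>\<^sub>M J" "b \<in> L \<rightarrow>\<^sub>M J"
    for y z a b and L :: "'c measure"
    unfolding F_def by (rule measurable_double_upd[OF f that])
  let ?K = "\<rho> (insert u B)"
  have kA: "finite_kernel (pow A) J (\<rho> A)" by (rule finite_kernel_rho[OF A_nbr])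
  have kB: "finite_kernel (pow (insert u B)) J ?K" by (rule finite_kernel_rho[OF B_nbr])
  have kPA: "finite_kernel J (pow A) (\<lambda>x. \<Pi>\<^sub>M i\<in>A. P x)" by (rule finite_kernel_power[OF fin(1)])
  have kpB: "finite_kernel L (pow B) (\<lambda>_. \<Pi>\<^sub>M i\<in>B. \<pi>)" for L :: "'c measure"
    by (rule finite_kernel_const[OF finite_measure_power_pi sets_power_pi])
  have upd_raw[measurable (raw)]: "(\<lambda>w. (z w)(u := a w)) \<in> L \<rightarrow>\<^sub>M pow (insert u B)"
    if "z \<in> L \<rightarrow>\<^sub>M pow B" "a \<in> L \<rightarrow>\<^sub>M J" for z a and L :: "'c measure"
  proof -
    have "(\<lambda>w. (z w, a w)) \<in> L \<rightarrow>\<^sub>M pow B \<Otimes>\<^sub>M J" using that by measurable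
    from measurable_compose[OF this measurable_upd[of u]] show ?thesis by simp
  qed
  define H where "H y z a = (\<integral>\<^sup>+b. F y z a b \<partial>?K (z(u := a)))" for y z a
  have H_meas[measurable (raw)]: "(\<lambda>w. H (y w) (z w) (a w)) \<in> borel_measurable L"
    if [measurable]: "y \<in> L \<rightarrow>\<^sub>M pow A" "z \<in> L \<rightarrow>\<^sub>M pow B" "a \<in> L \<rightarrow>\<^sub>M J" for y z a and L :: "'c measure"
    unfolding H_def by (rule borel_measurable_nn_integral_comp[OF kB]) measurable
  \<comment> \<open>\<open>H\<close> keeps \<open>y\<close> fixed and integrates the coordinate of \<open>v\<close>; \<open>\<Lambda>\<close> keeps that coordinate and integrates \<open>y\<close>.\<close>
  define \<Lambda> where "\<Lambda> w b = (\<integral>\<^sup>+y. F y (restrict w B) (w u) b \<partial>\<Pi>\<^sub>M i\<in>A. P (w u))" for w b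
  have restr[measurable (raw)]: "(\<lambda>x. restrict (w x) B) \<in> L \<rightarrow>\<^sub>M pow B"
    "(\<lambda>x. w x u) \<in> L \<rightarrow>\<^sub>M J" if "w \<in> L \<rightarrow>\<^sub>M pow (insert u B)" for w and L :: "'c measure"
    using measurable_compose[OF that measurable_restrict_subset[of B "insert u B"]]
      measurable_compose[OF that measurable_component_singleton[of u "insert u B"]] by auto
  have \<Lambda>_meas[measurable (raw)]: "(\<lambda>x. \<Lambda> (w x) (b x)) \<in> borel_measurable L"
    if [measurable]: "w \<in> L \<rightarrow>\<^sub>M pow (insert u B)" "b \<in> L \<rightarrow>\<^sub>M J" for w b and L :: "'c measure"
    unfolding \<Lambda>_def by (rule borel_measurable_nn_integral_comp[OF kPA]) measurable
  have \<Lambda>_upd: "\<Lambda> (z(u := a)) b = (\<integral>\<^sup>+y. F y z a b \<partial>\<Pi>\<^sub>M i\<in>A. P a)" if "z \<in> space (pow B)" for z a b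
  proof -
    have "restrict (z(u := a)) B = z"
      using that uv(3) by (auto simp: space_PiM PiE_def extensional_def restrict_def fun_eq_iff)
    then show ?thesis by (simp add: \<Lambda>_def)
  qed
  interpret PS: product_sigma_finite "\<lambda>_::'v. \<pi>" by unfold_locales
  have G: "iter (A \<union> B) [u, v] f (merge A B (y, z)) = (\<integral>\<^sup>+a. H y z a \<partial>\<rho> A y)"
    if y: "y \<in> space (pow A)" and z: "z \<in> space (pow B)" for y z
  proof -
    have "restrict (merge A B (y, z)) A = y" "restrict ((merge A B (y, z))(u := a)) (insert u B) = z(u := a)" for a
      using y z AB uv by (auto simp: space_PiM PiE_def extensional_def restrict_def fun_eq_iff merge_def)
    then show ?thesis unfolding iter.simps ext_kernel_def A B H_def F_def by simp
  qed
  have "(\<integral>\<^sup>+x. iter (A \<union> B) [u, v] f x \<partial>\<Pi>\<^sub>M i\<in>A \<union> B. \<pi>)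
    = (\<integral>\<^sup>+y. (\<integral>\<^sup>+z. iter (A \<union> B) [u, v] f (merge A B (y, z)) \<partial>\<Pi>\<^sub>M i\<in>B. \<pi>) \<partial>\<Pi>\<^sub>M i\<in>A. \<pi>)"
  proof (rule PS.product_nn_integral_fold[OF AB fin])
    have "iter (A \<union> B) [u, v] f \<in> borel_measurable (pow (A \<union> B))"
      using f by (intro measurable_iter) (simp add: insert_commute)
    then show "iter (A \<union> B) [u, v] f \<in> borel_measurable (\<Pi>\<^sub>M i\<in>A \<union> B. \<pi>)"
      unfolding measurable_cong_sets[OF sets_power_pi refl] .
  qed
  also have "\<dots> = (\<integral>\<^sup>+y. (\<integral>\<^sup>+z. (\<integral>\<^sup>+a. H y z a \<partial>\<rho> A y) \<partial>\<Pi>\<^sub>M i\<in>B. \<pi>) \<partial>\<Pi>\<^sub>M i\<in>A. \<pi>)"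
    by (intro nn_integral_cong G) (simp_all only: space_power_pi)
  also have "\<dots> = (\<integral>\<^sup>+y. (\<integral>\<^sup>+a. (\<integral>\<^sup>+z. H y z a \<partial>\<Pi>\<^sub>M i\<in>B. \<pi>) \<partial>\<rho> A y) \<partial>\<Pi>\<^sub>M i\<in>A. \<pi>)"
  proof (intro nn_integral_cong)
    fix y assume "y \<in> space (\<Pi>\<^sub>M i\<in>A. \<pi>)"
    then have y[measurable]: "y \<in> space (pow A)" by (simp only: space_power_pi)
    show "(\<integral>\<^sup>+z. (\<integral>\<^sup>+a. H y z a \<partial>\<rho> A y) \<partial>\<Pi>\<^sub>M i\<in>B. \<pi>) = (\<integral>\<^sup>+a. (\<integral>\<^sup>+z. H y z a \<partial>\<Pi>\<^sub>M i\<in>B. \<pi>) \<partial>\<rho> A y)"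
      by (rule nn_integral_swap[OF finite_measure_power_pi finite_kernelD(1)[OF kA y] sets_power_pi
            finite_kernelD(2)[OF kA y]]) measurable
  qed
  also have "\<dots> = (\<integral>\<^sup>+a. (\<integral>\<^sup>+y. (\<integral>\<^sup>+z. H y z a \<partial>\<Pi>\<^sub>M i\<in>B. \<pi>) \<partial>\<Pi>\<^sub>M i\<in>A. P a) \<partial>\<pi>)"
  proof -
    have "(\<lambda>w. \<integral>\<^sup>+z. H (fst w) z (snd w) \<partial>\<Pi>\<^sub>M i\<in>B. \<pi>) \<in> borel_measurable (pow A \<Otimes>\<^sub>M J)"
      by (rule borel_measurable_nn_integral_kernel[OF kpB]) measurable
    \<comment> \<open>First use of the star identity, for the star with center \<open>u\<close> and leaves \<open>A\<close>.\<close>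
    from star[OF A_nbr this] show ?thesis by simp
  qed
  also have "\<dots> = (\<integral>\<^sup>+a. (\<integral>\<^sup>+z. (\<integral>\<^sup>+b. \<Lambda> (z(u := a)) b \<partial>?K (z(u := a))) \<partial>\<Pi>\<^sub>M i\<in>B. \<pi>) \<partial>\<pi>)"
  proof (intro nn_integral_cong)
    fix a assume "a \<in> space \<pi>"
    then have a[measurable]: "a \<in> space J" by (simp only: space_pi)
    have "(\<integral>\<^sup>+y. (\<integral>\<^sup>+z. H y z a \<partial>\<Pi>\<^sub>M i\<in>B. \<pi>) \<partial>\<Pi>\<^sub>M i\<in>A. P a)
      = (\<integral>\<^sup>+z. (\<integral>\<^sup>+y. H y z a \<partial>\<Pi>\<^sub>M i\<in>A. P a) \<partial>\<Pi>\<^sub>M i\<in>B. \<pi>)"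
      by (rule nn_integral_swap[OF finite_measure_power_P[OF a] finite_measure_power_pi
            sets_power_P[OF a] sets_power_pi]) measurable
    also have "\<dots> = (\<integral>\<^sup>+z. (\<integral>\<^sup>+b. \<Lambda> (z(u := a)) b \<partial>?K (z(u := a))) \<partial>\<Pi>\<^sub>M i\<in>B. \<pi>)"
    proof (intro nn_integral_cong)
      fix z assume "z \<in> space (\<Pi>\<^sub>M i\<in>B. \<pi>)"
      then have z[measurable]: "z \<in> space (pow B)" by (simp only: space_power_pi)
      have za: "z(u := a) \<in> space (pow (insert u B))" by (rule space_upd[OF z a])
      have "(\<integral>\<^sup>+y. H y z a \<partial>\<Pi>\<^sub>M i\<in>A. P a) = (\<integral>\<^sup>+b. (\<integral>\<^sup>+y. F y z a b \<partial>\<Pi>\<^sub>M i\<in>A. P a) \<partial>?K (z(u := a)))"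
        unfolding H_def
        by (rule nn_integral_swap[OF finite_measure_power_P[OF a] finite_kernelD(1)[OF kB za]
              sets_power_P[OF a] finite_kernelD(2)[OF kB za]]) measurable
      then show "(\<integral>\<^sup>+y. H y z a \<partial>\<Pi>\<^sub>M i\<in>A. P a) = (\<integral>\<^sup>+b. \<Lambda> (z(u := a)) b \<partial>?K (z(u := a)))"
        by (simp only: \<Lambda>_upd[OF z])
    qed
    finally show "(\<integral>\<^sup>+y. (\<integral>\<^sup>+z. H y z a \<partial>\<Pi>\<^sub>M i\<in>B. \<pi>) \<partial>\<Pi>\<^sub>M i\<in>A. P a)
      = (\<integral>\<^sup>+z. (\<integral>\<^sup>+b. \<Lambda> (z(u := a)) b \<partial>?K (z(u := a))) \<partial>\<Pi>\<^sub>M i\<in>B. \<pi>)" .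
  qed
  also have "\<dots> = (\<integral>\<^sup>+w. (\<integral>\<^sup>+b. \<Lambda> w b \<partial>?K w) \<partial>\<Pi>\<^sub>M i\<in>insert u B. \<pi>)"
  proof (rule PS.product_nn_integral_insert_rev[symmetric])
    have "(\<lambda>w. \<integral>\<^sup>+b. \<Lambda> w b \<partial>?K w) \<in> borel_measurable (pow (insert u B))"
      by (rule borel_measurable_nn_integral_kernel[OF kB]) measurable
    then show "(\<lambda>w. \<integral>\<^sup>+b. \<Lambda> w b \<partial>?K w) \<in> borel_measurable (\<Pi>\<^sub>M i\<in>insert u B. \<pi>)"
      unfolding measurable_cong_sets[OF sets_power_pi refl] .
  qed (use fin uv in auto)
  also have "\<dots> = (\<integral>\<^sup>+b. (\<integral>\<^sup>+w. \<Lambda> w b \<partial>\<Pi>\<^sub>M i\<in>insert u B. P b) \<partial>\<pi>)"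
  proof -
    have "(\<lambda>z. \<Lambda> (fst z) (snd z)) \<in> borel_measurable (pow (insert u B) \<Otimes>\<^sub>M J)" by measurable
    \<comment> \<open>Second use, for the star with center \<open>v\<close>; now \<open>u\<close> is one of its leaves.\<close>
    from star[OF B_nbr this] show ?thesis by simp
  qed
  also have "\<dots> = (\<integral>\<^sup>+b. (\<integral>\<^sup>+a. (\<integral>\<^sup>+z. (\<integral>\<^sup>+y. F y z a b \<partial>\<Pi>\<^sub>M i\<in>A. P a) \<partial>\<Pi>\<^sub>M i\<in>B. P b) \<partial>P b) \<partial>\<pi>)"
  proof (intro nn_integral_cong)
    fix b assume "b \<in> space \<pi>"
    then have b[measurable]: "b \<in> space J" by (simp only: space_pi)
    interpret Pb: product_sigma_finite "\<lambda>_::'v. P b"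
      by (intro product_sigma_finite.intro prob_space_imp_sigma_finite prob_P b)
    have "(\<lambda>w. \<Lambda> w b) \<in> borel_measurable (pow (insert u B))" by measurable
    then have "(\<integral>\<^sup>+w. \<Lambda> w b \<partial>\<Pi>\<^sub>M i\<in>insert u B. P b)
      = (\<integral>\<^sup>+a. (\<integral>\<^sup>+z. \<Lambda> (z(u := a)) b \<partial>\<Pi>\<^sub>M i\<in>B. P b) \<partial>P b)"
      unfolding measurable_cong_sets[OF sets_power_P[OF b] refl, symmetric]
      using fin uv by (intro Pb.product_nn_integral_insert_rev) auto
    also have "\<dots> = (\<integral>\<^sup>+a. (\<integral>\<^sup>+z. (\<integral>\<^sup>+y. F y z a b \<partial>\<Pi>\<^sub>M i\<in>A. P a) \<partial>\<Pi>\<^sub>M i\<in>B. P b) \<partial>P b)"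
      by (intro nn_integral_cong \<Lambda>_upd) (simp only: sets_eq_imp_space_eq[OF sets_power_P[OF b]])
    finally show "(\<integral>\<^sup>+w. \<Lambda> w b \<partial>\<Pi>\<^sub>M i\<in>insert u B. P b)
      = (\<integral>\<^sup>+a. (\<integral>\<^sup>+z. (\<integral>\<^sup>+y. F y z a b \<partial>\<Pi>\<^sub>M i\<in>A. P a) \<partial>\<Pi>\<^sub>M i\<in>B. P b) \<partial>P b)" .
  qed
  finally show ?thesis by (simp only: F_def)
qed

end

section \<open>Almost sure uniqueness of kernels, and permutations\<close>

definition countably_generated :: "'a measure \<Rightarrow> bool" where
  "countably_generated N \<longleftrightarrow> (\<exists>\<E>. countable \<E> \<and> Int_stable \<E> \<and> \<E> \<subseteq> Pow (space N) \<and>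
     space N \<in> \<E> \<and> sets N = sigma_sets (space N) \<E>)"

text \<open>The real coding pulls the rational half-lines back to a generator, because it has a measurable left
  inverse.\<close>

lemma countably_generated_standard_borel:
  assumes "standard_borel J"
  shows "countably_generated J"
proof (cases "space J = {}")
  case True
  then have "sets J = sigma_sets (space J) {space J}"
    using sets.sets_into_space[of _ J] sets.top[of J] by (auto intro: sigma_sets.Basic)
  then show ?thesis
    unfolding countably_generated_def by (intro exI[of _ "{space J}"]) (auto simp: Int_stable_def)
next
  case False
  obtain c :: "'a \<Rightarrow> real" and g where c: "c \<in> borel_measurable J" and g: "g \<in> borel \<rightarrow>\<^sub>M J"
    and gc: "\<And>x. x \<in> space J \<Longrightarrow> g (c x) = x" and "\<And>x. 0 \<le> c x" and c1: "\<And>x. c x \<le> 1"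
    by (rule standard_borel_real_coding[OF assms False]) (rule that)
  let ?G = "range (\<lambda>q::rat. {..of_rat q :: real})"
  let ?\<E> = "range (\<lambda>q::rat. {x \<in> space J. c x \<le> of_rat q})"
  have "{x \<in> space J. c x \<le> of_rat q} = c -` {..of_rat q} \<inter> space J" for q by auto
  then have \<E>: "?\<E> = {c -` Z \<inter> space J |Z. Z \<in> ?G}" by blast
  have borel: "sets borel = sigma_sets UNIV ?G" by (subst borel_eq_rational_atMost) simp
  have "sets J = {c -` Z \<inter> space J |Z. Z \<in> sigma_sets UNIV ?G}"
  proof (intro equalityI subsetI)
    fix A assume A: "A \<in> sets J"
    have "g -` A \<in> sets borel" using measurable_sets[OF g A] by simp
    moreover have "A = c -` (g -` A) \<inter> space J" using sets.sets_into_space[OF A] by (auto simp: gc subset_eq)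
    ultimately show "A \<in> {c -` Z \<inter> space J |Z. Z \<in> sigma_sets UNIV ?G}"
      unfolding borel by blast
  next
    fix A assume "A \<in> {c -` Z \<inter> space J |Z. Z \<in> sigma_sets UNIV ?G}"
    then show "A \<in> sets J" unfolding borel[symmetric] using measurable_sets[OF c] by blast
  qed
  also have "\<dots> = sigma_sets (space J) ?\<E>"
    unfolding \<E> by (rule sigma_sets_vimage_commute) auto
  finally have "sets J = sigma_sets (space J) ?\<E>" .
  moreover have "Int_stable ?\<E>"
  proof (rule Int_stableI)
    fix A B assume "A \<in> ?\<E>" "B \<in> ?\<E>"
    then obtain q r where "A = {x \<in> space J. c x \<le> of_rat q}" "B = {x \<in> space J. c x \<le> of_rat r}" by blast
    then have "A \<inter> B = {x \<in> space J. c x \<le> min (of_rat q) (of_rat r)}" by auto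
    also have "min (real_of_rat q) (of_rat r) = of_rat (min q r)" by (simp add: min_def of_rat_less_eq)
    finally show "A \<inter> B \<in> ?\<E>" by blast
  qed
  moreover have "space J \<in> ?\<E>" using c1 by (intro range_eqI[of _ _ 1]) auto
  ultimately show ?thesis
    unfolding countably_generated_def by (intro exI[of _ ?\<E>]) auto
qed

lemma countably_generated_pair:
  assumes "countably_generated M" "countably_generated N"
  shows "countably_generated (M \<Otimes>\<^sub>M N)"
proof -
  from assms obtain \<E> \<F> where
    E: "countable \<E>" "Int_stable \<E>" "\<E> \<subseteq> Pow (space M)" "space M \<in> \<E>" "sets M = sigma_sets (space M) \<E>" and
    F: "countable \<F>" "Int_stable \<F>" "\<F> \<subseteq> Pow (space N)" "space N \<in> \<F>" "sets N = sigma_sets (space N) \<F>"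
    unfolding countably_generated_def by blast
  let ?G = "{a \<times> b |a b. a \<in> \<E> \<and> b \<in> \<F>}"
  have "?G = (\<lambda>(a, b). a \<times> b) ` (\<E> \<times> \<F>)" by auto
  then have "countable ?G" using E(1) F(1) by simp
  moreover have "Int_stable ?G"
  proof (rule Int_stableI)
    fix A B assume "A \<in> ?G" "B \<in> ?G"
    then obtain a b a' b' where *: "A = a \<times> b" "B = a' \<times> b'" "a \<in> \<E>" "a' \<in> \<E>" "b \<in> \<F>" "b' \<in> \<F>" by blast
    then have "A \<inter> B = (a \<inter> a') \<times> (b \<inter> b')" by auto
    moreover have "a \<inter> a' \<in> \<E>" "b \<inter> b' \<in> \<F>" using * E(2) F(2) by (auto simp: Int_stable_def)
    ultimately show "A \<inter> B \<in> ?G" by blast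
  qed
  moreover have "?G \<subseteq> Pow (space (M \<Otimes>\<^sub>M N))" using E(3) F(3) by (auto simp: space_pair_measure)
  moreover have "space (M \<Otimes>\<^sub>M N) \<in> ?G" using E(4) F(4) by (auto simp: space_pair_measure)
  moreover have "sets (M \<Otimes>\<^sub>M N) = sets (sigma (space M \<times> space N) ?G)"
    by (rule sets_pair_eq[where Ca="{space M}" and Cb="{space N}"]) (use E F in auto)
  then have "sets (M \<Otimes>\<^sub>M N) = sigma_sets (space (M \<Otimes>\<^sub>M N)) ?G"
    using E(3) F(3) by (subst (asm) sets_measure_of) (auto simp: space_pair_measure)
  ultimately show ?thesis unfolding countably_generated_def by blast
qed

text \<open>For each fixed set the masses agree almost everywhere, as their integrals agree. A countable generator
  closed under intersections allows a common null set.\<close>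

lemma AE_kernels_eq:
  assumes "sigma_finite_measure \<nu>" and gen: "countably_generated N"
    and sets1: "\<And>x. x \<in> space \<nu> \<Longrightarrow> sets (\<kappa> x) = sets N"
    and sets2: "\<And>x. x \<in> space \<nu> \<Longrightarrow> sets (\<kappa>' x) = sets N"
    and meas1: "\<And>A. A \<in> sets N \<Longrightarrow> (\<lambda>x. emeasure (\<kappa> x) A) \<in> borel_measurable \<nu>"
    and meas2: "\<And>A. A \<in> sets N \<Longrightarrow> (\<lambda>x. emeasure (\<kappa>' x) A) \<in> borel_measurable \<nu>"
    and fin: "(\<integral>\<^sup>+x. emeasure (\<kappa> x) (space N) \<partial>\<nu>) \<noteq> \<infinity>"
    and eq: "\<And>A B. A \<in> sets N \<Longrightarrow> B \<in> sets \<nu> \<Longrightarrow>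
      (\<integral>\<^sup>+x. emeasure (\<kappa> x) A * indicator B x \<partial>\<nu>) = (\<integral>\<^sup>+x. emeasure (\<kappa>' x) A * indicator B x \<partial>\<nu>)"
  shows "AE x in \<nu>. \<kappa> x = \<kappa>' x"
proof -
  interpret sigma_finite_measure \<nu> by fact
  from gen obtain \<E> where E: "countable \<E>" "Int_stable \<E>" "\<E> \<subseteq> Pow (space N)" "space N \<in> \<E>"
    "sets N = sigma_sets (space N) \<E>"
    unfolding countably_generated_def by blast
  have "AE x in \<nu>. emeasure (\<kappa> x) A = emeasure (\<kappa>' x) A" if "A \<in> \<E>" for A
  proof -
    have A: "A \<in> sets N" using that unfolding E(5) by (rule sigma_sets.Basic)
    show ?thesis
      using meas1[OF A] meas2[OF A] eq[OF A]
      by (intro density_unique measure_eqI) (simp_all add: emeasure_density)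
  qed
  then have "AE x in \<nu>. \<forall>A\<in>\<E>. emeasure (\<kappa> x) A = emeasure (\<kappa>' x) A"
    using E(1) by (simp add: AE_ball_countable)
  moreover have "AE x in \<nu>. emeasure (\<kappa> x) (space N) \<noteq> \<infinity>"
    using meas1[OF sets.top] fin by (rule nn_integral_PInf_AE)
  ultimately show ?thesis
    using AE_space
  proof eventually_elim
    case (elim x)
    show ?case
    proof (rule measure_eqI_generator_eq[OF E(2,3), where A="\<lambda>_. space N"])
      show "emeasure (\<kappa> x) X = emeasure (\<kappa>' x) X" if "X \<in> \<E>" for X using elim(1) that by blast
      show "sets (\<kappa> x) = sigma_sets (space N) \<E>" "sets (\<kappa>' x) = sigma_sets (space N) \<E>"
        using sets1[OF elim(3)] sets2[OF elim(3)] E(5) by simp_all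
    qed (use E(4) elim(2) in auto)
  qed
qed

text \<open>Bubble sort: the first element of one list is moved to the front of the other by adjacent swaps, and
  the rest follows by induction.\<close>

lemma adjacent_swaps_imp_permutation_invariant:
  assumes swap: "\<And>as u v bs. distinct (as @ [u, v] @ bs) \<Longrightarrow> set (as @ [u, v] @ bs) = X \<Longrightarrow>
      F (as @ [u, v] @ bs) = F (as @ [v, u] @ bs)"
    and "distinct vs" "distinct ws" "set vs = X" "set ws = X"
  shows "F vs = F ws"
proof -
  have front: "F (as @ bs @ [v] @ cs) = F (as @ [v] @ bs @ cs)"
    if "distinct (as @ bs @ [v] @ cs)" "set (as @ bs @ [v] @ cs) = X" for as bs v cs
    using that
  proof (induction bs arbitrary: cs rule: rev_induct)
    case (snoc b bs)
    have vb: "v \<noteq> b" using snoc.prems by auto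
    have "F ((as @ bs) @ [b, v] @ cs) = F ((as @ bs) @ [v, b] @ cs)"
      using snoc.prems by (intro swap) auto
    also have "\<dots> = F (as @ [v] @ bs @ b # cs)"
      using snoc.IH[of "b # cs"] snoc.prems vb by (simp add: insert_commute)
    finally show ?case by simp
  qed simp
  have "F (as @ vs) = F (as @ ws)"
    if "distinct (as @ vs)" "distinct (as @ ws)" "set vs = set ws" "set (as @ vs) = X" for as
    using that
  proof (induction vs arbitrary: as ws)
    case (Cons v vs)
    then have "v \<in> set ws" by auto
    then obtain bs cs where ws: "ws = bs @ v # cs" by (meson split_list)
    have "set vs = set (bs @ cs)" using Cons.prems ws by auto
    then have "F ((as @ [v]) @ vs) = F ((as @ [v]) @ (bs @ cs))"
      using Cons.prems ws by (intro Cons.IH) auto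
    also have "\<dots> = F (as @ bs @ [v] @ cs)"
      using Cons.prems ws by (subst front) auto
    finally show ?case by (simp add: ws)
  qed simp
  from this[of "[]"] assms show ?thesis by simp
qed

context star_system
begin

section \<open>Independence of the order of the vertices\<close>

text \<open>By \<open>iter_star_pair\<close> the left side is a random edge with end \<open>v\<close> chosen first, together with random
  neighbors of both ends. On the right side \<open>u\<close> is chosen first, and the kernel is reversible.\<close>

lemma iter_double_star:
  assumes uv: "u \<in> nbr v" "u \<noteq> v" "u \<notin> A \<union> B" "v \<notin> A \<union> B" and AB: "A \<inter> B = {}"
    and A: "nbr u \<inter> (A \<union> B) = A" and B: "nbr v \<inter> (A \<union> B) = B"
    and f: "f \<in> borel_measurable (pow (insert v (insert u (A \<union> B))))"
  shows "(\<integral>\<^sup>+x. iter (A \<union> B) [u, v] f x \<partial>\<Pi>\<^sub>M i\<in>A \<union> B. \<pi>) = (\<integral>\<^sup>+x. iter (A \<union> B) [v, u] f x \<partial>\<Pi>\<^sub>M i\<in>A \<union> B. \<pi>)"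
proof -
  have vu: "v \<in> nbr u" using uv(1) by (rule nbr_sym)
  define F where "F y z a b = f ((merge A B (y, z))(u := a, v := b))" for y z a b
  have fin: "finite A" "finite B" using A B finite_nbr[of u] finite_nbr[of v] by (metis finite_Int)+
  have F_meas[measurable (raw)]: "(\<lambda>w. F (y w) (z w) (a w) (b w)) \<in> borel_measurable L"
    if "y \<in> L \<rightarrow>\<^sub>M pow A" "z \<in> L \<rightarrow>\<^sub>M pow B" "a \<in> L \<rightarrow>\<^sub>M J" "b \<in> L \<rightarrow>\<^sub>M J"
    for y z a b and L :: "'c measure"
    unfolding F_def by (rule measurable_double_upd[OF f that])
  let ?Q = "\<lambda>a b. \<integral>\<^sup>+z. (\<integral>\<^sup>+y. F y z a b \<partial>\<Pi>\<^sub>M i\<in>A. P a) \<partial>\<Pi>\<^sub>M i\<in>B. P b"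
  have kPA: "finite_kernel J (pow A) (\<lambda>x. \<Pi>\<^sub>M i\<in>A. P x)" and kPB: "finite_kernel J (pow B) (\<lambda>x. \<Pi>\<^sub>M i\<in>B. P x)"
    by (rule finite_kernel_power[OF fin(1)], rule finite_kernel_power[OF fin(2)])
  have Q_meas: "(\<lambda>x. ?Q (snd x) (fst x)) \<in> borel_measurable (J \<Otimes>\<^sub>M J)"
    by (rule borel_measurable_nn_integral_comp[OF kPB], measurable)
       (rule borel_measurable_nn_integral_comp[OF kPA], measurable)
  have "(\<integral>\<^sup>+x. iter (A \<union> B) [u, v] f x \<partial>\<Pi>\<^sub>M i\<in>A \<union> B. \<pi>) = (\<integral>\<^sup>+b. (\<integral>\<^sup>+a. ?Q a b \<partial>P b) \<partial>\<pi>)"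
    unfolding F_def using uv AB A B f by (intro iter_star_pair) auto
  also have "\<dots> = (\<integral>\<^sup>+a. (\<integral>\<^sup>+b. ?Q a b \<partial>P a) \<partial>\<pi>)"
    using reversible[OF Q_meas] by simp
  also have "\<dots> = (\<integral>\<^sup>+a. (\<integral>\<^sup>+b. (\<integral>\<^sup>+y. (\<integral>\<^sup>+z. F y z a b \<partial>\<Pi>\<^sub>M i\<in>B. P b) \<partial>\<Pi>\<^sub>M i\<in>A. P a) \<partial>P a) \<partial>\<pi>)"
  proof (intro nn_integral_cong)
    fix a b assume "a \<in> space \<pi>" "b \<in> space (P a)"
    then have a[measurable]: "a \<in> space J" and b[measurable]: "b \<in> space J"
      using sets_eq_imp_space_eq[OF prob_P(2)] by (auto simp: space_pi)
    show "?Q a b = (\<integral>\<^sup>+y. (\<integral>\<^sup>+z. F y z a b \<partial>\<Pi>\<^sub>M i\<in>B. P b) \<partial>\<Pi>\<^sub>M i\<in>A. P a)"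
      by (rule nn_integral_swap[OF finite_measure_power_P[OF b] finite_measure_power_P[OF a]
            sets_power_P[OF b] sets_power_P[OF a]]) measurable
  qed
  also have "\<dots> = (\<integral>\<^sup>+x. iter (B \<union> A) [v, u] f x \<partial>\<Pi>\<^sub>M i\<in>B \<union> A. \<pi>)"
  proof -
    have "F y z a b = f ((merge B A (z, y))(v := b, u := a))" for y z a b
    proof -
      have "merge A B (y, z) = merge B A (z, y)" by (rule merge_commute[OF AB])
      then show ?thesis using uv(2) by (simp add: F_def fun_upd_twist)
    qed
    then show ?thesis
      using uv vu AB A B f by (subst iter_star_pair) (auto simp: Un_commute insert_commute)
  qed
  finally show ?thesis by (simp add: Un_commute)
qed

text \<open>Applied to functions that vanish outside of a set of leaf coordinates, \<open>iter_double_star\<close> says that the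
  two conditional distributions of the coordinates of \<open>u\<close> and \<open>v\<close> have the same integrals over that set.
  The total mass is at most one, so \<open>AE_kernels_eq\<close> applies.\<close>

lemma AE_iter_swap_adjacent:
  assumes J: "standard_borel J"
    and uv: "u \<in> nbr v" "u \<noteq> v" "u \<notin> A \<union> B" "v \<notin> A \<union> B" and AB: "A \<inter> B = {}"
    and A: "nbr u \<inter> (A \<union> B) = A" and B: "nbr v \<inter> (A \<union> B) = B"
  shows "AE y in \<Pi>\<^sub>M i\<in>A \<union> B. \<pi>. \<forall>\<phi>\<in>borel_measurable (J \<Otimes>\<^sub>M J).
    iter (A \<union> B) [u, v] (\<lambda>z. \<phi> (z u, z v)) y = iter (A \<union> B) [v, u] (\<lambda>z. \<phi> (z u, z v)) y"
proof -
  let ?I = "A \<union> B" and ?T = "insert v (insert u (A \<union> B))" and ?\<nu> = "\<Pi>\<^sub>M i\<in>A \<union> B. \<pi>"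
  interpret \<nu>: prob_space ?\<nu> by (intro prob_space_PiM prob_space_axioms)
  have sp: "space ?\<nu> = space (pow ?I)" by (rule space_power_pi)
  have sets_T: "pow (?I \<union> set us) = pow ?T" if "us \<in> {[u, v], [v, u]}" for us
    using that by (auto simp: insert_commute)
  have pair: "(\<lambda>z. (z u, z v)) \<in> pow ?T \<rightarrow>\<^sub>M J \<Otimes>\<^sub>M J"
    by (intro measurable_Pair measurable_component_singleton) auto
  define \<kappa> where "\<kappa> us y = distr (iter_measure ?I us y) (J \<Otimes>\<^sub>M J) (\<lambda>z. (z u, z v))" for us y
  have sets_\<kappa>: "sets (\<kappa> us y) = sets (J \<Otimes>\<^sub>M J)" for us y by (simp add: \<kappa>_def)
  have int_\<kappa>: "(\<integral>\<^sup>+p. \<phi> p \<partial>\<kappa> us y) = iter ?I us (\<lambda>z. \<phi> (z u, z v)) y"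
    if us: "us \<in> {[u, v], [v, u]}" and y: "y \<in> space (pow ?I)" and \<phi>: "\<phi> \<in> borel_measurable (J \<Otimes>\<^sub>M J)" for us y \<phi>
  proof -
    have s: "sets (iter_measure ?I us y) = sets (pow ?T)"
      by (simp only: sets_iter_measure[OF y] sets_T[OF us])
    have "(\<lambda>z. (z u, z v)) \<in> iter_measure ?I us y \<rightarrow>\<^sub>M J \<Otimes>\<^sub>M J"
      unfolding measurable_cong_sets[OF s refl] by (rule pair)
    then have "(\<integral>\<^sup>+p. \<phi> p \<partial>\<kappa> us y) = (\<integral>\<^sup>+z. \<phi> (z u, z v) \<partial>iter_measure ?I us y)"
      unfolding \<kappa>_def by (intro nn_integral_distr) (simp_all add: \<phi>)
    also have "\<dots> = iter ?I us (\<lambda>z. \<phi> (z u, z v)) y"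
      using measurable_compose[OF pair \<phi>] by (intro nn_integral_iter_measure[OF y]) (simp only: sets_T[OF us])
    finally show ?thesis .
  qed
  have em_\<kappa>: "emeasure (\<kappa> us y) C = iter ?I us (\<lambda>z. indicator C (z u, z v)) y"
    if us: "us \<in> {[u, v], [v, u]}" and y: "y \<in> space (pow ?I)" and C: "C \<in> sets (J \<Otimes>\<^sub>M J)" for us y C
    using int_\<kappa>[OF us y, of "indicator C"] C sets_\<kappa>[of us y] by simp
  have meas_C: "(\<lambda>z. indicator C (z u, z v) :: ennreal) \<in> borel_measurable (pow ?T)" if "C \<in> sets (J \<Otimes>\<^sub>M J)" for C
    using measurable_compose[OF pair borel_measurable_indicator[OF that]] .
  have meas: "(\<lambda>y. emeasure (\<kappa> us y) C) \<in> borel_measurable ?\<nu>"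
    if us: "us \<in> {[u, v], [v, u]}" and C: "C \<in> sets (J \<Otimes>\<^sub>M J)" for us C
  proof -
    have "iter ?I us (\<lambda>z. indicator C (z u, z v)) \<in> borel_measurable (pow ?I)"
      using meas_C[OF C] by (intro measurable_iter) (simp only: sets_T[OF us])
    then have "iter ?I us (\<lambda>z. indicator C (z u, z v)) \<in> borel_measurable ?\<nu>"
      unfolding measurable_cong_sets[OF sets_power_pi refl] .
    then show ?thesis
      by (rule measurable_cong[THEN iffD2, rotated]) (simp only: sp em_\<kappa>[OF us _ C])
  qed
  have int_eq: "(\<integral>\<^sup>+y. emeasure (\<kappa> us y) C * indicator D y \<partial>?\<nu>)
      = (\<integral>\<^sup>+y. iter ?I us (\<lambda>z. indicator C (z u, z v) * indicator D (restrict z ?I)) y \<partial>?\<nu>)"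
    if us: "us \<in> {[u, v], [v, u]}" and C: "C \<in> sets (J \<Otimes>\<^sub>M J)" for us C D
  proof (intro nn_integral_cong)
    fix y assume "y \<in> space ?\<nu>"
    then have y: "y \<in> space (pow ?I)" by (simp only: sp)
    interpret F: integral_functional "pow (?I \<union> set us)" "\<lambda>f. iter ?I us f y"
      by (rule integral_functional_iter[OF y])
    have "distinct us" "set us \<inter> ?I = {}" using us uv by auto
    then have "iter ?I us (\<lambda>z. indicator C (z u, z v) * indicator D (restrict z ?I)) y
      = iter ?I us (\<lambda>z. indicator D y * indicator C (z u, z v)) y"
      by (intro iter_cong_fibre[OF y]) (simp_all add: mult.commute)
    also have "\<dots> = indicator D y * iter ?I us (\<lambda>z. indicator C (z u, z v)) y"
      using meas_C[OF C] by (intro F.cmult) (simp only: sets_T[OF us])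
    finally show "emeasure (\<kappa> us y) C * indicator D y
      = iter ?I us (\<lambda>z. indicator C (z u, z v) * indicator D (restrict z ?I)) y"
      by (simp only: em_\<kappa>[OF us y C] mult.commute)
  qed
  have "AE y in ?\<nu>. \<kappa> [u, v] y = \<kappa> [v, u] y"
  proof (rule AE_kernels_eq)
    show "sigma_finite_measure ?\<nu>" ..
    show "countably_generated (J \<Otimes>\<^sub>M J)"
      by (intro countably_generated_pair countably_generated_standard_borel J)
    fix C assume C: "C \<in> sets (J \<Otimes>\<^sub>M J)"
    show "(\<lambda>y. emeasure (\<kappa> [u, v] y) C) \<in> borel_measurable ?\<nu>"
      "(\<lambda>y. emeasure (\<kappa> [v, u] y) C) \<in> borel_measurable ?\<nu>"
      by (rule meas[OF _ C], simp)+
    fix D assume D: "D \<in> sets ?\<nu>"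
    then have D': "D \<in> sets (pow ?I)" by (simp only: sets_power_pi)
    have "(\<lambda>z. indicator D (restrict z ?I) :: ennreal) \<in> borel_measurable (pow ?T)"
      by (rule measurable_compose[OF measurable_restrict_subset borel_measurable_indicator[OF D']]) auto
    then have "(\<lambda>z. indicator C (z u, z v) * indicator D (restrict z ?I) :: ennreal) \<in> borel_measurable (pow ?T)"
      using meas_C[OF C] by measurable
    note swap = iter_double_star[OF uv AB A B this]
    have us: "[u, v] \<in> {[u, v], [v, u]}" "[v, u] \<in> {[u, v], [v, u]}" by simp_all
    show "(\<integral>\<^sup>+y. emeasure (\<kappa> [u, v] y) C * indicator D y \<partial>?\<nu>)
      = (\<integral>\<^sup>+y. emeasure (\<kappa> [v, u] y) C * indicator D y \<partial>?\<nu>)"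
      by (simp only: int_eq[OF us(1) C] int_eq[OF us(2) C] swap)
  next
    have "(\<integral>\<^sup>+y. emeasure (\<kappa> [u, v] y) (space (J \<Otimes>\<^sub>M J)) \<partial>?\<nu>)
      = (\<integral>\<^sup>+y. iter ?I [u, v] (\<lambda>z. indicator (space (J \<Otimes>\<^sub>M J)) (z u, z v)) y \<partial>?\<nu>)"
      by (intro nn_integral_cong em_\<kappa>) (simp_all only: sp sets.top insert_iff simp_thms)
    also have "\<dots> \<le> 1"
    proof (subst iter_star_pair[OF uv AB A _ meas_C[OF sets.top]])
      show "nbr v \<inter> insert u ?I = insert u B" using uv(1) B by auto
    qed (intro nn_integral_le_1 prob_space_axioms prob_P prob_space_PiM;
         simp add: space_pi sets_eq_imp_space_eq[OF prob_P(2)] indicator_def)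
    finally show "(\<integral>\<^sup>+y. emeasure (\<kappa> [u, v] y) (space (J \<Otimes>\<^sub>M J)) \<partial>?\<nu>) \<noteq> \<infinity>"
      by (auto simp: top_unique)
  qed (rule sets_\<kappa>)+
  with AE_space show ?thesis
  proof eventually_elim
    case (elim y)
    then have y: "y \<in> space (pow ?I)" by (simp only: sp)
    show ?case
    proof
      fix \<phi> :: "'a \<times> 'a \<Rightarrow> ennreal" assume \<phi>: "\<phi> \<in> borel_measurable (J \<Otimes>\<^sub>M J)"
      show "iter ?I [u, v] (\<lambda>z. \<phi> (z u, z v)) y = iter ?I [v, u] (\<lambda>z. \<phi> (z u, z v)) y"
        using int_\<kappa>[OF _ y \<phi>, of "[u, v]"] int_\<kappa>[OF _ y \<phi>, of "[v, u]"] elim(2) by simp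
    qed
  qed
qed

text \<open>Induction on the number of vertices; it suffices to swap two consecutive vertices \<open>u\<close> and \<open>v\<close>. If they are
  adjacent, their earlier neighbors form an independent set \<open>I\<close>, and the swap is justified unless the
  coordinates in \<open>I\<close> lie in an exceptional null set of \<open>\<pi>\<^sup>I\<close>. The earlier vertices are fewer, so by induction
  they may be reordered to begin with \<open>I\<close>, whose coordinates then have distribution \<open>\<pi>\<^sup>I\<close>.\<close>

lemma iter_permute:
  assumes J: "standard_borel J"
  shows "distinct vs \<Longrightarrow> distinct ws \<Longrightarrow> set vs = set ws \<Longrightarrow> f \<in> borel_measurable (pow (set vs)) \<Longrightarrow>
    iter {} vs f \<omega> = iter {} ws f \<omega>"
proof (induction "length vs" arbitrary: vs ws f rule: less_induct)
  case less
  show ?case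
  proof (rule adjacent_swaps_imp_permutation_invariant[where X="set vs" and F="\<lambda>vs. iter {} vs f \<omega>"])
    fix as u v bs assume dist: "distinct (as @ [u, v] @ bs)" and set: "set (as @ [u, v] @ bs) = set vs"
    let ?X = "set as" and ?T = "insert v (insert u (set as))"
    have uv: "u \<noteq> v" "u \<notin> ?X" "v \<notin> ?X" using dist by auto
    define g where "g = iter ?T bs f"
    have T: "?T \<union> set bs = set vs" "?X \<union> set [u, v] = ?T" "?X \<union> set [v, u] = ?T"
      unfolding set[symmetric] by auto
    have g: "g \<in> borel_measurable (pow ?T)"
      unfolding g_def by (rule measurable_iter) (simp only: T(1) less.prems(4))
    have \<omega>: "\<omega> \<in> space (pow {})" by simp
    have app: "iter {} (as @ us @ bs) f \<omega> = iter {} as (iter ?X us g) \<omega>" if "us \<in> {[u, v], [v, u]}" for us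
    proof -
      have "?X \<union> set us = ?T" using that by auto
      then have "iter ?X (us @ bs) f = iter ?X us g" by (intro ext) (simp only: iter_append g_def)
      then show ?thesis by (simp only: iter_append Un_empty_left)
    qed
    have "iter {} as (iter ?X [u, v] g) \<omega> = iter {} as (iter ?X [v, u] g) \<omega>"
    proof (cases "u \<in> nbr v")
      case False
      have "iter ?X [u, v] g z = iter ?X [v, u] g z" if "z \<in> space (pow ?X)" for z
        using that uv False g by (intro iter_swap_nonadjacent) (simp_all add: insert_commute)
      then show ?thesis by (intro iter_cong[OF \<omega>]) simp
    next
      case True
      let ?A = "nbr u \<inter> ?X" and ?B = "nbr v \<inter> ?X"
      let ?I = "?A \<union> ?B" and ?R = "?X - (nbr u \<inter> ?X \<union> nbr v \<inter> ?X)"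
      have vu: "v \<in> nbr u" using True by (rule nbr_sym)
      have disj: "?A \<inter> ?B = {}" using no_triangle[OF _ True] by blast
      have indep: "a \<notin> nbr b" if "a \<in> ?I" "b \<in> ?I" for a b
      proof -
        have cross: "a \<notin> nbr b" if "a \<in> ?A" "b \<in> ?B" for a b
          using that uv by (intro no_square[OF True]) auto
        show ?thesis
          using that no_triangle[of a u b] no_triangle[of a v b] cross[of a b] cross[of b a] nbr_sym[of a b]
          by blast
      qed
      \<comment> \<open>The last two steps see only the coordinates in \<open>?I\<close>; the others enter as parameters of \<open>g\<close>.\<close>
      have loc: "iter ?X us g x = iter ?I us (\<lambda>z. g (x(u := z u, v := z v))) (restrict x ?I)"
        if us: "us \<in> {[u, v], [v, u]}" and x: "x \<in> space (pow ?X)" for us x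
      proof -
        have X: "?I \<union> ?R = ?X" by auto
        have us': "distinct us" "set us = {u, v}" using us uv by auto
        have x': "x \<in> space (pow (?I \<union> ?R))" using x by (simp only: X)
        have "iter (?I \<union> ?R) us g x = iter ?I us (\<lambda>z. g (\<lambda>i. if i \<in> ?R then x i else z i)) (restrict x ?I)"
          using us' uv by (intro iter_local[OF x']) auto
        also have "\<dots> = iter ?I us (\<lambda>z. g (x(u := z u, v := z v))) (restrict x ?I)"
        proof (rule iter_cong_fibre)
          show "restrict x ?I \<in> space (pow ?I)"
            using x by (intro measurable_space[OF measurable_restrict_subset[of ?I ?X]]) auto
          fix z assume z: "z \<in> space (pow (?I \<union> set us))" "restrict z ?I = restrict x ?I"
          have "(\<lambda>i. if i \<in> ?R then x i else z i) = x(u := z u, v := z v)"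
          proof
            fix i
            consider "i \<in> ?R" | "i \<in> ?I" | "i \<in> {u, v}" | "i \<notin> ?X" "i \<notin> {u, v}" by blast
            then show "(if i \<in> ?R then x i else z i) = (x(u := z u, v := z v)) i"
            proof cases
              case 2
              then have "z i = x i" using z(2)[THEN fun_cong, of i] by (simp only: restrict_apply if_True)
              with 2 uv show ?thesis by auto
            next
              case 4
              then have "z i = undefined" "x i = undefined"
                using z(1) x us' by (auto simp: space_PiM PiE_def extensional_def)
              with 4 show ?thesis by auto
            qed (use uv in auto)
          qed
          then show "g (\<lambda>i. if i \<in> ?R then x i else z i) = g (x(u := z u, v := z v))" by simp
        qed (use us' uv in auto)
        finally show ?thesis by (simp only: X)
      qed
      \<comment> \<open>The exceptional set \<open>N\<close> is null for \<open>\<pi>\<close> to the power \<open>?I\<close>. Its preimage is null for the earlier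
        vertices: by the induction hypothesis \<open>?I\<close> may come first among them.\<close>
      have "AE y in \<Pi>\<^sub>M i\<in>?I. \<pi>. \<forall>\<phi>\<in>borel_measurable (J \<Otimes>\<^sub>M J).
        iter ?I [u, v] (\<lambda>z. \<phi> (z u, z v)) y = iter ?I [v, u] (\<lambda>z. \<phi> (z u, z v)) y"
        using uv disj by (intro AE_iter_swap_adjacent[OF J True]) auto
      then obtain N where N: "{y \<in> space (\<Pi>\<^sub>M i\<in>?I. \<pi>). \<not> (\<forall>\<phi>\<in>borel_measurable (J \<Otimes>\<^sub>M J).
          iter ?I [u, v] (\<lambda>z. \<phi> (z u, z v)) y = iter ?I [v, u] (\<lambda>z. \<phi> (z u, z v)) y)} \<subseteq> N"
        and N0: "emeasure (\<Pi>\<^sub>M i\<in>?I. \<pi>) N = 0" and "N \<in> sets (\<Pi>\<^sub>M i\<in>?I. \<pi>)"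
        by (rule AE_E)
      then have N_sets: "N \<in> sets (pow ?I)" by (simp only: sets_power_pi)
      let ?n = "\<lambda>z. indicator N (restrict z ?I) :: ennreal"
      have n: "?n \<in> borel_measurable (pow ?X)"
        by (rule measurable_compose[OF measurable_restrict_subset borel_measurable_indicator[OF N_sets]]) auto
      obtain il where il: "set il = ?I" "distinct il" using finite_distinct_list[of ?I] by auto
      obtain rl where rl: "set rl = ?R" "distinct rl" using finite_distinct_list[of ?R] by auto
      have "length (as @ [u, v] @ bs) = length vs"
        using distinct_card[OF dist] distinct_card[OF less.prems(1)] set by (simp only:)
      then have "iter {} as ?n \<omega> = iter {} (il @ rl) ?n \<omega>"
        using dist il rl n by (intro less.hyps) auto
      also have "\<dots> = iter {} il (iter ?I rl ?n) \<omega>" by (simp only: iter_append Un_empty_left il(1))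
      also have "\<dots> = (\<integral>\<^sup>+y. iter ?I rl ?n y \<partial>\<Pi>\<^sub>M i\<in>set il. \<pi>)"
      proof (rule iter_independent[OF il(2)])
        have "?I \<union> set rl = ?X" using rl by auto
        then show "iter ?I rl ?n \<in> borel_measurable (pow (set il))"
          unfolding il(1) using n by (intro measurable_iter) (simp only:)
      qed (use indep il in blast)
      also have "\<dots> = (\<integral>\<^sup>+y. 0 \<partial>\<Pi>\<^sub>M i\<in>?I. \<pi>)"
        unfolding il(1)
      proof (rule nn_integral_cong_AE)
        have "AE y in \<Pi>\<^sub>M i\<in>?I. \<pi>. y \<notin> N"
          using N0 \<open>N \<in> sets (\<Pi>\<^sub>M i\<in>?I. \<pi>)\<close> by (intro AE_not_in null_setsI)
        with AE_space show "AE y in \<Pi>\<^sub>M i\<in>?I. \<pi>. iter ?I rl ?n y = 0"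
        proof eventually_elim
          case (elim y)
          then have y: "y \<in> space (pow ?I)" by (simp only: space_power_pi)
          have "iter ?I rl ?n y = iter ?I rl (\<lambda>z. 0) y"
            using elim(2) rl by (intro iter_cong_fibre[OF y]) auto
          then show ?case by (simp only: iter_zero[OF y])
        qed
      qed
      finally have n0: "iter {} as ?n \<omega> = 0" by simp
      let ?M = "iter_measure {} as \<omega>"
      have sets_M: "sets ?M = sets (pow ?X)" by (simp only: sets_iter_measure[OF \<omega>] Un_empty_left)
      have "(\<integral>\<^sup>+z. ?n z \<partial>?M) = 0"
        using nn_integral_iter_measure[OF \<omega>, of ?n as] n n0 by simp
      then have "AE z in ?M. ?n z = 0"
        using n by (subst (asm) nn_integral_0_iff_AE) (simp_all only: measurable_cong_sets[OF sets_M refl])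
      with AE_space have "AE z in ?M. iter ?X [u, v] g z = iter ?X [v, u] g z"
      proof eventually_elim
        case (elim x)
        then have x: "x \<in> space (pow ?X)" by (simp only: sets_eq_imp_space_eq[OF sets_M])
        let ?\<phi> = "\<lambda>p. g (x(u := fst p, v := snd p))"
        have \<phi>: "?\<phi> \<in> borel_measurable (J \<Otimes>\<^sub>M J)"
          using measurable_compose[OF measurable_upd_pair[OF x] g] by (simp add: case_prod_beta')
        have "restrict x ?I \<in> space (\<Pi>\<^sub>M i\<in>?I. \<pi>)"
          unfolding space_power_pi
          using x by (intro measurable_space[OF measurable_restrict_subset[of ?I ?X]]) auto
        moreover have "restrict x ?I \<notin> N" using elim(2) by (simp split: split_indicator_asm)
        ultimately have "\<forall>\<phi>\<in>borel_measurable (J \<Otimes>\<^sub>M J). iter ?I [u, v] (\<lambda>z. \<phi> (z u, z v)) (restrict x ?I)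
          = iter ?I [v, u] (\<lambda>z. \<phi> (z u, z v)) (restrict x ?I)"
          using N by blast
        from bspec[OF this \<phi>] show ?case
          using loc[OF _ x, of "[u, v]"] loc[OF _ x, of "[v, u]"] by (simp only: insert_iff simp_thms fst_conv snd_conv)
      qed
      then have "(\<integral>\<^sup>+z. iter ?X [u, v] g z \<partial>?M) = (\<integral>\<^sup>+z. iter ?X [v, u] g z \<partial>?M)"
        by (rule nn_integral_cong_AE)
      moreover have "(\<integral>\<^sup>+z. iter ?X us g z \<partial>?M) = iter {} as (iter ?X us g) \<omega>" if "us \<in> {[u, v], [v, u]}" for us
      proof (rule nn_integral_iter_measure[OF \<omega>])
        have "?X \<union> set us = ?T" using that by auto
        then have "iter ?X us g \<in> borel_measurable (pow ?X)" using g by (intro measurable_iter) (simp only:)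
        then show "iter ?X us g \<in> borel_measurable (pow ({} \<union> set as))" by (simp only: Un_empty_left)
      qed
      ultimately show ?thesis by (simp only: insert_iff simp_thms)
    qed
    then show "iter {} (as @ [u, v] @ bs) f \<omega> = iter {} (as @ [v, u] @ bs) f \<omega>"
      by (simp only: app insert_iff simp_thms)
  qed (use less.prems in auto)
qed

section \<open>The Markovian family\<close>

lemma iter_move_right:
  assumes "x \<in> space (pow S)" "distinct (v # qs @ rs)" "set (v # qs @ rs) \<inter> S = {}"
    and "\<And>q. q \<in> set qs \<Longrightarrow> v \<notin> nbr q" and "f \<in> borel_measurable (pow (S \<union> set (v # qs @ rs)))"
  shows "iter S (v # qs @ rs) f x = iter S (qs @ v # rs) f x"
  using assms
proof (induction qs arbitrary: S x)
  case (Cons q qs)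
  let ?g = "iter (insert q (insert v S)) (qs @ rs) f"
  have g: "?g \<in> borel_measurable (pow (insert v (insert q S)))"
    unfolding insert_commute[of v q S] using Cons.prems(5)
    by (intro measurable_iter) (simp add: insert_commute)
  have "iter S (v # (q # qs) @ rs) f x = iter S [v, q] ?g x" by simp
  also have "\<dots> = iter S [q, v] ?g x"
    using Cons.prems g by (intro iter_swap_nonadjacent) auto
  also have "\<dots> = iter S (q # v # qs @ rs) f x" by (simp add: insert_commute)
  also have "\<dots> = iter S (q # qs @ v # rs) f x"
    unfolding iter.simps(2)[of S q]
  proof (intro nn_integral_cong Cons.IH)
    fix t assume "t \<in> space (ext_kernel S q x)"
    then show "x(q := t) \<in> space (pow (insert q S))"
      using Cons.prems(1) by (intro space_upd) (simp_all only: ext_kernel(3))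
    show "f \<in> borel_measurable (pow (insert q S \<union> set (v # qs @ rs)))"
      using Cons.prems(5) by (simp add: insert_commute)
  qed (use Cons.prems in auto)
  finally show ?case by simp
qed simp

text \<open>A stable partition of the list uses only swaps of nonadjacent vertices.\<close>

lemma iter_partition:
  assumes "x \<in> space (pow S)" "distinct vs" "set vs \<inter> S = {}"
    and "\<And>a b. a \<in> set vs \<Longrightarrow> b \<in> set vs \<Longrightarrow> Q a \<Longrightarrow> \<not> Q b \<Longrightarrow> b \<notin> nbr a"
    and "f \<in> borel_measurable (pow (S \<union> set vs))"
  shows "iter S vs f x = iter S (filter Q vs @ filter (\<lambda>v. \<not> Q v) vs) f x"
  using assms
proof (induction vs arbitrary: S x)
  case (Cons v vs)
  have "iter S (v # vs) f x = iter S (v # filter Q vs @ filter (\<lambda>v. \<not> Q v) vs) f x"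
    unfolding iter.simps(2)
  proof (intro nn_integral_cong Cons.IH)
    fix t assume "t \<in> space (ext_kernel S v x)"
    then show "x(v := t) \<in> space (pow (insert v S))"
      using Cons.prems(1) by (intro space_upd) (simp_all only: ext_kernel(3))
  qed (use Cons.prems in auto)
  also have "\<dots> = iter S (filter Q (v # vs) @ filter (\<lambda>v. \<not> Q v) (v # vs)) f x"
  proof (cases "Q v")
    case False
    have s: "set (v # filter Q vs @ filter (\<lambda>v. \<not> Q v) vs) = set (v # vs)" by auto
    have "iter S (v # filter Q vs @ filter (\<lambda>v. \<not> Q v) vs) f x
      = iter S (filter Q vs @ v # filter (\<lambda>v. \<not> Q v) vs) f x"
    proof (rule iter_move_right[OF Cons.prems(1)])
      show "f \<in> borel_measurable (pow (S \<union> set (v # filter Q vs @ filter (\<lambda>v. \<not> Q v) vs)))"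
        using Cons.prems(5) by (simp only: s)
    qed (use Cons.prems False in auto)
    then show ?thesis by (simp add: False)
  qed simp
  finally show ?case .
qed simp

end

text \<open>A single enumeration \<open>vl\<close> of the vertices orders all subsets, so that the disintegrations of different
  members of the family are built from compatible orders.\<close>

locale ordered_star_system = star_system J \<pi> P nbr \<rho>
  for J :: "'a measure" and \<pi> P and nbr :: "'v \<Rightarrow> 'v set" and \<rho> +
  fixes V :: "'v set" and vl :: "'v list"
  assumes J: "standard_borel J" and vl: "set vl = V" "distinct vl"
begin

definition ord :: "'v set \<Rightarrow> 'v list" where
  "ord T = filter (\<lambda>v. v \<in> T) vl"

lemma set_ord: "T \<subseteq> V \<Longrightarrow> set (ord T) = T" and distinct_ord: "distinct (ord T)"
  using vl by (auto simp: ord_def)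

lemma Un_set_ord: "S \<subseteq> T \<Longrightarrow> T \<subseteq> V \<Longrightarrow> S \<union> set (ord (T - S)) = T"
  by (subst set_ord) auto

definition family :: "'v set \<Rightarrow> ('v \<Rightarrow> 'a) measure" where
  "family T = iter_measure {} (ord T) \<omega>"

definition family_kernel :: "'v set \<Rightarrow> 'v set \<Rightarrow> ('v \<Rightarrow> 'a) \<Rightarrow> ('v \<Rightarrow> 'a) measure" where
  "family_kernel S T x = distr (iter_measure S (ord (T - S)) x) (pow (T - S)) (\<lambda>z. restrict z (T - S))"

lemma undefined_in_pow_empty: "\<omega> \<in> space (pow {})" by simp

lemma sets_family: "T \<subseteq> V \<Longrightarrow> sets (family T) = sets (pow T)"
  unfolding family_def by (simp only: sets_iter_measure[OF undefined_in_pow_empty] set_ord Un_empty_left)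

lemma sigma_finite_family: "sigma_finite_measure (family T)"
  unfolding family_def by (rule sigma_finite_iter_measure[OF undefined_in_pow_empty distinct_ord]) simp

lemma nn_integral_family:
  assumes "T \<subseteq> V" "f \<in> borel_measurable (pow T)" "distinct vs" "set vs = T"
  shows "(\<integral>\<^sup>+z. f z \<partial>family T) = iter {} vs f \<omega>"
proof -
  have "(\<integral>\<^sup>+z. f z \<partial>family T) = iter {} (ord T) f \<omega>"
    unfolding family_def using assms(2)
    by (intro nn_integral_iter_measure[OF undefined_in_pow_empty]) (simp only: set_ord[OF assms(1)] Un_empty_left)
  also have "\<dots> = iter {} vs f \<omega>"
    using assms by (intro iter_permute[OF J] distinct_ord) (simp_all only: set_ord)
  finally show ?thesis .
qed

text \<open>By \<open>iter_permute\<close> the vertices of \<open>S\<close> may be added first.\<close>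

lemma nn_integral_family_split:
  assumes ST: "S \<subseteq> T" "T \<subseteq> V" and f: "f \<in> borel_measurable (pow T)"
  shows "(\<integral>\<^sup>+z. f z \<partial>family T) = (\<integral>\<^sup>+x. iter S (ord (T - S)) f x \<partial>family S)"
proof -
  have S: "S \<subseteq> V" and TS: "T - S \<subseteq> V" using ST by auto
  have "(\<integral>\<^sup>+z. f z \<partial>family T) = iter {} (ord S @ ord (T - S)) f \<omega>"
    using ST S f by (intro nn_integral_family) (auto simp: set_ord[OF S] set_ord[OF TS] distinct_ord)
  also have "\<dots> = iter {} (ord S) (iter S (ord (T - S)) f) \<omega>"
    by (simp only: iter_append Un_empty_left set_ord[OF S])
  also have "\<dots> = (\<integral>\<^sup>+x. iter S (ord (T - S)) f x \<partial>family S)"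
    using f by (intro nn_integral_family[symmetric] S measurable_iter distinct_ord set_ord)
      (simp only: Un_set_ord[OF ST])
  finally show ?thesis .
qed

lemma sets_family_kernel: "sets (family_kernel S T x) = sets (pow (T - S))"
  by (simp add: family_kernel_def)

lemma nn_integral_family_kernel:
  assumes ST: "S \<subseteq> T" "T \<subseteq> V" and x: "x \<in> space (pow S)" and h: "h \<in> borel_measurable (pow (T - S))"
  shows "(\<integral>\<^sup>+y. h y \<partial>family_kernel S T x) = iter S (ord (T - S)) (\<lambda>z. h (restrict z (T - S))) x"
proof -
  have r: "(\<lambda>z. restrict z (T - S)) \<in> pow T \<rightarrow>\<^sub>M pow (T - S)" by (rule measurable_restrict_subset) auto
  have s: "sets (iter_measure S (ord (T - S)) x) = sets (pow T)"
    by (simp only: sets_iter_measure[OF x] Un_set_ord[OF ST])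
  have "(\<integral>\<^sup>+y. h y \<partial>family_kernel S T x) = (\<integral>\<^sup>+z. h (restrict z (T - S)) \<partial>iter_measure S (ord (T - S)) x)"
    unfolding family_kernel_def
    using r h by (intro nn_integral_distr) (simp_all only: measurable_cong_sets[OF s refl] measurable_distr_eq1)
  also have "\<dots> = iter S (ord (T - S)) (\<lambda>z. h (restrict z (T - S))) x"
    using measurable_compose[OF r h] by (intro nn_integral_iter_measure[OF x]) (simp only: Un_set_ord[OF ST])
  finally show ?thesis .
qed

lemma iter_merge_fibre:
  assumes ST: "S \<subseteq> T" "T \<subseteq> V" and x: "x \<in> space (pow S)"
  shows "iter S (ord (T - S)) (\<lambda>z. f (merge S (T - S) (x, restrict z (T - S)))) x = iter S (ord (T - S)) f x"
proof (rule iter_cong_fibre[OF x distinct_ord])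
  have TS: "T - S \<subseteq> V" using ST by auto
  show "set (ord (T - S)) \<inter> S = {}" by (auto simp: ord_def)
  fix z assume "z \<in> space (pow (S \<union> set (ord (T - S))))" and zx: "restrict z S = x"
  then have z: "z \<in> space (pow T)" by (simp only: Un_set_ord[OF ST])
  have "merge S (T - S) (x, restrict z (T - S)) = z"
  proof
    fix i show "merge S (T - S) (x, restrict z (T - S)) i = z i"
      using z zx[THEN fun_cong, of i] ST(1)
      by (auto simp: merge_def restrict_def space_PiM PiE_def extensional_def split: if_splits)
  qed
  then show "f (merge S (T - S) (x, restrict z (T - S))) = f z" by simp
qed

lemma measurable_merge_section:
  assumes "S \<subseteq> T" "x \<in> space (pow S)"
  shows "(\<lambda>y. merge S (T - S) (x, y)) \<in> pow (T - S) \<rightarrow>\<^sub>M pow T"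
proof -
  have "(\<lambda>y. (x, y)) \<in> pow (T - S) \<rightarrow>\<^sub>M pow S \<Otimes>\<^sub>M pow (T - S)" using assms(2) by simp
  from measurable_compose[OF this measurable_merge] assms(1) show ?thesis by (simp add: Un_absorb1)
qed

lemma sigma_finite_family_kernel:
  assumes ST: "S \<subseteq> T" "T \<subseteq> V" and x: "x \<in> space (pow S)"
  shows "sigma_finite_measure (family_kernel S T x)"
proof -
  have disj: "set (ord (T - S)) \<inter> S = {}" by (auto simp: ord_def)
  obtain w where w: "w \<in> borel_measurable (pow T)"
      "\<And>z. z \<in> space (pow T) \<Longrightarrow> w z \<noteq> 0 \<and> w z \<noteq> \<infinity>" "iter S (ord (T - S)) w x \<le> 1"
    using iter_weight_exists[OF distinct_ord disj, unfolded Un_set_ord[OF ST]] x by blast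
  let ?w = "\<lambda>y. w (merge S (T - S) (x, y))"
  have m: "?w \<in> borel_measurable (pow (T - S))"
    by (rule measurable_compose[OF measurable_merge_section[OF ST(1) x] w(1)])
  show ?thesis
  proof (rule sigma_finite_measure_if_weight)
    show "?w \<in> borel_measurable (family_kernel S T x)"
      unfolding measurable_cong_sets[OF sets_family_kernel refl] by (rule m)
    show "?w y \<noteq> 0 \<and> ?w y \<noteq> \<infinity>" if "y \<in> space (family_kernel S T x)" for y
      using that measurable_space[OF measurable_merge_section[OF ST(1) x]]
      by (intro w(2)) (simp only: sets_eq_imp_space_eq[OF sets_family_kernel])
    show "(\<integral>\<^sup>+y. ?w y \<partial>family_kernel S T x) \<noteq> \<infinity>"
      using w(3) unfolding nn_integral_family_kernel[OF ST x m] iter_merge_fibre[OF ST x]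
      by (auto simp: top_unique)
  qed
qed

lemma disintegration_family:
  assumes ST: "S \<subseteq> T" "T \<subseteq> V"
  shows "disintegration J S T (family S) (family T) (family_kernel S T)"
  unfolding disintegration_def Let_def
proof (intro conjI ballI)
  show "sets (family_kernel S T x) = sets (pow (T - S))" for x by (rule sets_family_kernel)
  fix C assume C: "C \<in> sets (pow T)"
  let ?N = "\<lambda>x. emeasure (family_kernel S T x) {y \<in> space (pow (T - S)). merge S (T - S) (x, y) \<in> C}"
  have N: "?N x = iter S (ord (T - S)) (indicator C) x" if x: "x \<in> space (pow S)" for x
  proof -
    let ?D = "{y \<in> space (pow (T - S)). merge S (T - S) (x, y) \<in> C}"
    have "?D = (\<lambda>y. merge S (T - S) (x, y)) -` C \<inter> space (pow (T - S))" by auto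
    then have D: "?D \<in> sets (pow (T - S))"
      using measurable_sets[OF measurable_merge_section[OF ST(1) x] C] by (simp only:)
    have "?N x = (\<integral>\<^sup>+y. indicator ?D y \<partial>family_kernel S T x)"
      using D by (intro nn_integral_indicator[symmetric]) (simp only: sets_family_kernel)
    also have "\<dots> = (\<integral>\<^sup>+y. indicator C (merge S (T - S) (x, y)) \<partial>family_kernel S T x)"
      by (intro nn_integral_cong) (simp add: indicator_def sets_eq_imp_space_eq[OF sets_family_kernel])
    also have "\<dots> = iter S (ord (T - S)) (\<lambda>z. indicator C (merge S (T - S) (x, restrict z (T - S)))) x"
      by (rule nn_integral_family_kernel[OF ST x])
         (rule measurable_compose[OF measurable_merge_section[OF ST(1) x] borel_measurable_indicator[OF C]])
    also have "\<dots> = iter S (ord (T - S)) (indicator C) x" by (rule iter_merge_fibre[OF ST x])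
    finally show ?thesis .
  qed
  have ind: "indicator C \<in> borel_measurable (pow T)" using C by (rule borel_measurable_indicator)
  have "iter S (ord (T - S)) (indicator C) \<in> borel_measurable (pow S)"
    by (rule measurable_iter) (simp only: Un_set_ord[OF ST] ind)
  then show "?N \<in> borel_measurable (pow S)"
    by (rule measurable_cong[THEN iffD2, rotated]) (rule N)
  have S: "S \<subseteq> V" using ST by auto
  have "emeasure (family T) C = (\<integral>\<^sup>+z. indicator C z \<partial>family T)"
    using C sets_family[OF ST(2)] by (intro nn_integral_indicator[symmetric]) simp
  also have "\<dots> = (\<integral>\<^sup>+x. iter S (ord (T - S)) (indicator C) x \<partial>family S)"
    by (rule nn_integral_family_split[OF ST ind])
  also have "\<dots> = (\<integral>\<^sup>+x. ?N x \<partial>family S)"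
    by (intro nn_integral_cong N[symmetric]) (simp only: sets_eq_imp_space_eq[OF sets_family[OF S]])
  finally show "emeasure (family T) C = (\<integral>\<^sup>+x. ?N x \<partial>family S)" .
qed

lemma decreasing_family: "decreasing J V family"
  unfolding decreasing_def absolutely_continuous_def
proof (intro allI impI subsetI)
  fix T S B assume T: "T \<subseteq> V" and ST: "S \<subseteq> T" and B: "B \<in> null_sets (family S)"
  have S: "S \<subseteq> V" using T ST by auto
  have B': "B \<in> sets (pow S)" using B sets_family[OF S] by auto
  have r: "(\<lambda>z. restrict z S) \<in> pow T \<rightarrow>\<^sub>M pow S" by (rule measurable_restrict_subset[OF ST])
  have r': "(\<lambda>z. restrict z S) \<in> family T \<rightarrow>\<^sub>M pow S"
    unfolding measurable_cong_sets[OF sets_family[OF T] refl] by (rule r)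
  let ?b = "\<lambda>z. indicator B (restrict z S) :: ennreal"
  have b: "?b \<in> borel_measurable (pow T)" by (rule measurable_compose[OF r borel_measurable_indicator[OF B']])
  have "emeasure (distr (family T) (pow S) (\<lambda>z. restrict z S)) B = (\<integral>\<^sup>+z. ?b z \<partial>family T)"
    by (rule emeasure_distr_eq_nn_integral[OF r' B'])
  also have "\<dots> = (\<integral>\<^sup>+x. iter S (ord (T - S)) ?b x \<partial>family S)"
    by (rule nn_integral_family_split[OF ST T b])
  also have "\<dots> = (\<integral>\<^sup>+x. 0 \<partial>family S)"
  proof (rule nn_integral_cong_AE)
    show "AE x in family S. iter S (ord (T - S)) ?b x = 0"
      using AE_space AE_not_in[OF B]
    proof eventually_elim
      case (elim x)
      then have x: "x \<in> space (pow S)" by (simp only: sets_eq_imp_space_eq[OF sets_family[OF S]])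
      have "iter S (ord (T - S)) ?b x = iter S (ord (T - S)) (\<lambda>z. 0) x"
        using elim(2) by (intro iter_cong_fibre[OF x distinct_ord]) (auto simp: ord_def)
      then show ?case by (simp only: iter_zero[OF x])
    qed
  qed
  finally show "B \<in> null_sets (distr (family T) (pow S) (\<lambda>z. restrict z S))"
    using B' by (auto simp: null_sets_def)
qed

text \<open>Without edges between \<open>U - S\<close> and \<open>W - S\<close>, all of \<open>U - S\<close> may be added before \<open>W - S\<close> by swaps of
  nonadjacent vertices, and the kernels used for \<open>W - S\<close> do not see the coordinates in \<open>U - S\<close>.\<close>

lemma family_kernel_union:
  assumes UW: "U \<subseteq> V" "W \<subseteq> V" and S: "S = U \<inter> W"
    and no_edge: "\<And>u w. u \<in> U - S \<Longrightarrow> w \<in> W - S \<Longrightarrow> w \<notin> nbr u" and x: "x \<in> space (pow S)"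
  shows "family_kernel S (U \<union> W) x =
    distr (family_kernel S U x \<Otimes>\<^sub>M family_kernel S W x) (pow ((U \<union> W) - S)) (merge (U - S) (W - S))"
proof (rule measure_eqI)
  let ?nU = "family_kernel S U x" and ?nW = "family_kernel S W x" and ?D = "(U \<union> W) - S"
  have SU: "S \<subseteq> U" and SW: "S \<subseteq> W" and SUW: "S \<subseteq> U \<union> W" and UWV: "U \<union> W \<subseteq> V" using S UW by auto
  have D: "(U - S) \<union> (W - S) = ?D" by auto
  show "sets (family_kernel S (U \<union> W) x) = sets (distr (?nU \<Otimes>\<^sub>M ?nW) (pow ?D) (merge (U - S) (W - S)))"
    by (simp add: sets_family_kernel)
  fix C assume "C \<in> sets (family_kernel S (U \<union> W) x)"
  then have C: "C \<in> sets (pow ?D)" by (simp only: sets_family_kernel)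
  interpret nW: sigma_finite_measure ?nW by (rule sigma_finite_family_kernel[OF SW UW(2) x])
  have pair: "sets (?nU \<Otimes>\<^sub>M ?nW) = sets (pow (U - S) \<Otimes>\<^sub>M pow (W - S))"
    by (intro sets_pair_measure_cong sets_family_kernel)
  have mrg: "merge (U - S) (W - S) \<in> pow (U - S) \<Otimes>\<^sub>M pow (W - S) \<rightarrow>\<^sub>M pow ?D"
    unfolding D[symmetric] by (rule measurable_merge)
  have mrg': "merge (U - S) (W - S) \<in> ?nU \<Otimes>\<^sub>M ?nW \<rightarrow>\<^sub>M pow ?D"
    unfolding measurable_cong_sets[OF pair refl] by (rule mrg)
  let ?c = "\<lambda>p q. indicator C (merge (U - S) (W - S) (p, q)) :: ennreal"
  have c: "(\<lambda>z. ?c (fst z) (snd z)) \<in> borel_measurable (pow (U - S) \<Otimes>\<^sub>M pow (W - S))"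
    using measurable_compose[OF mrg borel_measurable_indicator[OF C]] by simp
  have c_sec: "?c p \<in> borel_measurable (pow (W - S))" if "p \<in> space (pow (U - S))" for p
    using measurable_compose[OF measurable_Pair1'[OF that] c] by simp
  define \<Psi> where "\<Psi> p = (\<integral>\<^sup>+q. ?c p q \<partial>?nW)" for p
  have "(\<lambda>(p, q). ?c p q) \<in> borel_measurable (?nU \<Otimes>\<^sub>M ?nW)"
    unfolding measurable_cong_sets[OF pair refl] using c by (simp add: case_prod_beta')
  then have "\<Psi> \<in> borel_measurable ?nU"
    unfolding \<Psi>_def by (rule nW.borel_measurable_nn_integral)
  then have \<Psi>: "\<Psi> \<in> borel_measurable (pow (U - S))"
    unfolding measurable_cong_sets[OF sets_family_kernel refl] .
  have "emeasure (distr (?nU \<Otimes>\<^sub>M ?nW) (pow ?D) (merge (U - S) (W - S))) C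
    = (\<integral>\<^sup>+z. indicator C (merge (U - S) (W - S) z) \<partial>(?nU \<Otimes>\<^sub>M ?nW))"
    by (rule emeasure_distr_eq_nn_integral[OF mrg' C])
  also have "\<dots> = (\<integral>\<^sup>+p. \<Psi> p \<partial>?nU)"
    unfolding \<Psi>_def using measurable_compose[OF mrg' borel_measurable_indicator[OF C]]
    by (intro nW.nn_integral_fst[symmetric])
  also have "\<dots> = iter S (ord (U - S)) (\<lambda>y. \<Psi> (restrict y (U - S))) x"
    by (rule nn_integral_family_kernel[OF SU UW(1) x \<Psi>])
  also have "\<dots> = iter S (ord (U - S)) (iter U (ord (W - S)) (\<lambda>z. indicator C (restrict z ?D))) x"
  proof (rule iter_cong_fibre[OF x distinct_ord])
    show "set (ord (U - S)) \<inter> S = {}" by (auto simp: ord_def)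
    fix y assume "y \<in> space (pow (S \<union> set (ord (U - S))))" and yx: "restrict y S = x"
    then have y: "y \<in> space (pow U)" by (simp only: Un_set_ord[OF SU UW(1)])
    have U_eq: "U = S \<union> (U - S)" using SU by auto
    have y_sec: "restrict y (U - S) \<in> space (pow (U - S))"
      using y by (intro measurable_space[OF measurable_restrict_subset[of "U - S" U]]) auto
    have "iter (S \<union> (U - S)) (ord (W - S)) (\<lambda>z. indicator C (restrict z ?D)) y
      = iter S (ord (W - S)) (\<lambda>z. indicator C (restrict (\<lambda>i. if i \<in> U - S then y i else z i) ?D)) (restrict y S)"
    proof (rule iter_local)
      show "y \<in> space (pow (S \<union> (U - S)))" using y by (simp only: U_eq[symmetric])
      show "r \<notin> nbr v" if "v \<in> set (ord (W - S))" "r \<in> U - S" for v r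
        using that no_edge[of r v] nbr_sym[of r v] by (auto simp: ord_def)
    qed (use S in \<open>auto simp: ord_def distinct_ord vl\<close>)
    also have "\<dots> = iter S (ord (W - S)) (\<lambda>z. ?c (restrict y (U - S)) (restrict z (W - S))) x"
    proof -
      have "restrict (\<lambda>i. if i \<in> U - S then y i else z i) ?D
        = merge (U - S) (W - S) (restrict y (U - S), restrict z (W - S))" for z
        by (auto simp: merge_def restrict_def fun_eq_iff)
      then show ?thesis by (simp only: yx)
    qed
    also have "\<dots> = \<Psi> (restrict y (U - S))"
      unfolding \<Psi>_def by (rule nn_integral_family_kernel[OF SW UW(2) x c_sec[OF y_sec], symmetric])
    finally show "\<Psi> (restrict y (U - S)) = iter U (ord (W - S)) (\<lambda>z. indicator C (restrict z ?D)) y"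
      by (simp only: U_eq[symmetric])
  qed
  also have "\<dots> = iter S (ord (U - S) @ ord (W - S)) (\<lambda>z. indicator C (restrict z ?D)) x"
    by (simp only: iter_append Un_set_ord[OF SU UW(1)])
  also have "\<dots> = iter S (ord ?D) (\<lambda>z. indicator C (restrict z ?D)) x"
  proof -
    have f: "filter (\<lambda>v. v \<in> U) (ord ?D) = ord (U - S)" "filter (\<lambda>v. v \<notin> U) (ord ?D) = ord (W - S)"
      unfolding ord_def filter_filter using S by (auto intro!: filter_cong)
    have "(\<lambda>z. indicator C (restrict z ?D) :: ennreal) \<in> borel_measurable (pow (U \<union> W))"
      by (rule measurable_compose[OF measurable_restrict_subset borel_measurable_indicator[OF C]]) auto
    then have "iter S (ord ?D) (\<lambda>z. indicator C (restrict z ?D)) x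
      = iter S (filter (\<lambda>v. v \<in> U) (ord ?D) @ filter (\<lambda>v. v \<notin> U) (ord ?D)) (\<lambda>z. indicator C (restrict z ?D)) x"
    proof (intro iter_partition[OF x distinct_ord])
      show "b \<notin> nbr a" if "a \<in> set (ord ?D)" "b \<in> set (ord ?D)" "a \<in> U" "b \<notin> U" for a b
        using that no_edge[of a b] by (auto simp: ord_def)
    qed (simp_all only: Un_set_ord[OF SUW UWV], auto simp: ord_def)
    then show ?thesis by (simp only: f)
  qed
  also have "\<dots> = (\<integral>\<^sup>+q. indicator C q \<partial>family_kernel S (U \<union> W) x)"
    by (rule nn_integral_family_kernel[OF SUW UWV x borel_measurable_indicator[OF C], symmetric])
  also have "\<dots> = emeasure (family_kernel S (U \<union> W) x) C"
    using C by (intro nn_integral_indicator) (simp only: sets_family_kernel)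
  finally show "emeasure (family_kernel S (U \<union> W) x) C
    = emeasure (distr (?nU \<Otimes>\<^sub>M ?nW) (pow ?D) (merge (U - S) (W - S))) C" by simp
qed

lemma markovian_family:
  assumes E: "\<And>u w. w \<in> nbr u \<Longrightarrow> {u, w} \<in> E"
  shows "markovian J V E family"
  unfolding markovian_def
proof (intro conjI exI[of _ family_kernel] allI impI)
  show "decreasing J V family" by (rule decreasing_family)
  show "disintegration J S T (family S) (family T) (family_kernel S T)" if "T \<subseteq> V" "S \<subseteq> T" for S T
    using that by (intro disintegration_family)
  fix U W S assume UW: "U \<subseteq> V" "W \<subseteq> V" and S: "S = U \<inter> W"
    and no_edge: "\<forall>u\<in>U - S. \<forall>w\<in>W - S. {u, w} \<notin> E"
  have "S \<subseteq> V" using S UW by auto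
  show "AE x in family S. family_kernel S (U \<union> W) x =
    distr (family_kernel S U x \<Otimes>\<^sub>M family_kernel S W x) (pow ((U \<union> W) - S)) (merge (U - S) (W - S))"
  proof (rule AE_I2)
    fix x assume "x \<in> space (family S)"
    then have x: "x \<in> space (pow S)" by (simp only: sets_eq_imp_space_eq[OF sets_family[OF \<open>S \<subseteq> V\<close>]])
    show "family_kernel S (U \<union> W) x =
      distr (family_kernel S U x \<Otimes>\<^sub>M family_kernel S W x) (pow ((U \<union> W) - S)) (merge (U - S) (W - S))"
      using no_edge E by (intro family_kernel_union[OF UW S _ x]) blast
  qed
qed

lemma family_empty: "family {} = return (pow {}) (\<lambda>_. undefined)"
proof (rule measure_eqI)
  fix C assume "C \<in> sets (family {})"
  then have C: "C \<in> sets (pow {})" by (simp only: sets_family[OF empty_subsetI])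
  have "emeasure (family {}) C = (\<integral>\<^sup>+z. indicator C z \<partial>family {})" using \<open>C \<in> sets (family {})\<close> by simp
  also have "\<dots> = iter {} [] (indicator C) \<omega>"
    using C by (intro nn_integral_family) simp_all
  finally show "emeasure (family {}) C = emeasure (return (pow {}) \<omega>) C"
    using C by simp
qed (simp add: sets_family)

lemma family_singleton:
  assumes "i \<in> V"
  shows "family {i} = distr \<pi> (pow {i}) (\<lambda>x. \<lambda>l\<in>{i}. x)"
proof (rule measure_eqI_nn_integral_distr)
  have iV: "{i} \<subseteq> V" using assms by simp
  show "sets (family {i}) = sets (pow {i})" by (rule sets_family[OF iV])
  have "(\<lambda>x. \<lambda>l\<in>{i}. x) \<in> J \<rightarrow>\<^sub>M pow {i}" by (intro measurable_restrict) simp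
  then show "(\<lambda>x. \<lambda>l\<in>{i}. x) \<in> \<pi> \<rightarrow>\<^sub>M pow {i}" unfolding measurable_cong_sets[OF sets_pi refl] .
  fix h :: "('v \<Rightarrow> 'a) \<Rightarrow> ennreal" assume h: "h \<in> borel_measurable (pow {i})"
  have upd: "(\<omega>)(i := t) = (\<lambda>l\<in>{i}. t)" for t by auto
  have "(\<integral>\<^sup>+z. h z \<partial>family {i}) = iter {} [i] h \<omega>"
    using h by (intro nn_integral_family iV) simp_all
  also have "\<dots> = (\<integral>\<^sup>+t. h ((\<omega>)(i := t)) \<partial>\<rho> {} \<omega>)" by (simp add: ext_kernel_def restrict_def)
  also have "\<dots> = (\<integral>\<^sup>+t. h ((\<omega>)(i := t)) \<partial>\<pi>)"
    by (rule nn_integral_rho_empty[OF measurable_upd1[OF h undefined_in_pow_empty]])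
  finally show "(\<integral>\<^sup>+z. h z \<partial>family {i}) = (\<integral>\<^sup>+x. h (\<lambda>l\<in>{i}. x) \<partial>\<pi>)" by (simp only: upd)
qed

text \<open>Adding \<open>j\<close> and then \<open>i\<close> integrates over the star with center \<open>i\<close> and the single leaf \<open>j\<close>.\<close>

lemma nn_integral_family_edge:
  assumes ij: "i \<in> V" "j \<in> V" "j \<in> nbr i" and h: "h \<in> borel_measurable (pow {i, j})"
  shows "(\<integral>\<^sup>+z. h z \<partial>family {i, j}) = (\<integral>\<^sup>+x. (\<integral>\<^sup>+y. h ((\<omega>)(j := y, i := x)) \<partial>P x) \<partial>\<pi>)"
proof -
  have ne: "i \<noteq> j" using ij(3) nbr_irrefl by blast
  have nb: "nbr i \<inter> {j} = {j}" "{j} \<subseteq> nbr i" using ij by auto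
  have h': "h \<in> borel_measurable (pow (insert i {j}))" using h by simp
  have hu: "(\<lambda>z. h ((fst z)(i := snd z))) \<in> borel_measurable (pow {j} \<Otimes>\<^sub>M J)"
    using measurable_upd2[OF h'] by (simp add: case_prod_beta')
  have "(\<integral>\<^sup>+z. h z \<partial>family {i, j}) = iter {} [j, i] h \<omega>"
    using ij h ne by (intro nn_integral_family) auto
  also have "\<dots> = iter {} [j] (iter {j} [i] h) \<omega>" by simp
  also have "\<dots> = (\<integral>\<^sup>+y. iter {j} [i] h y \<partial>\<Pi>\<^sub>M l\<in>set [j]. \<pi>)"
  proof (rule iter_independent)
    have "{j} \<union> set [i] = {i, j}" by auto
    then have "iter {j} [i] h \<in> borel_measurable (pow {j})" by (intro measurable_iter) (simp only: h)
    then show "iter {j} [i] h \<in> borel_measurable (pow (set [j]))" by simp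
  qed (simp_all add: nbr_irrefl)
  also have "\<dots> = (\<integral>\<^sup>+y. (\<integral>\<^sup>+x. h (y(i := x)) \<partial>\<rho> {j} y) \<partial>\<Pi>\<^sub>M l\<in>{j}. \<pi>)"
  proof (simp only: list.set, intro nn_integral_cong)
    fix y assume "y \<in> space (\<Pi>\<^sub>M l\<in>{j}. \<pi>)"
    then have "restrict y {j} = y" by (auto simp: space_PiM PiE_restrict)
    then show "iter {j} [i] h y = (\<integral>\<^sup>+x. h (y(i := x)) \<partial>\<rho> {j} y)"
      by (simp only: iter.simps ext_kernel_def nb(1))
  qed
  also have "\<dots> = (\<integral>\<^sup>+x. (\<integral>\<^sup>+y. h (y(i := x)) \<partial>\<Pi>\<^sub>M l\<in>{j}. P x) \<partial>\<pi>)"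
    using star[OF nb(2) hu] by simp
  also have "\<dots> = (\<integral>\<^sup>+x. (\<integral>\<^sup>+y. h ((\<omega>)(j := y, i := x)) \<partial>P x) \<partial>\<pi>)"
  proof (intro nn_integral_cong)
    fix x assume "x \<in> space \<pi>"
    then have x: "x \<in> space J" by (simp only: space_pi)
    interpret Px: product_sigma_finite "\<lambda>_::'v. P x"
      by (intro product_sigma_finite.intro prob_space_imp_sigma_finite prob_P x)
    have "(\<lambda>y. h (y(i := x))) \<in> borel_measurable (\<Pi>\<^sub>M l\<in>insert j {}. P x)"
      unfolding measurable_cong_sets[OF sets_power_P[OF x] refl]
      using measurable_compose[OF measurable_Pair2'[OF x] hu] by simp
    from Px.product_nn_integral_insert[OF _ _ this]
    show "(\<integral>\<^sup>+y. h (y(i := x)) \<partial>\<Pi>\<^sub>M l\<in>{j}. P x) = (\<integral>\<^sup>+y. h ((\<omega>)(j := y, i := x)) \<partial>P x)"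
      by (simp add: PiM_empty nn_integral_count_space_finite fun_upd_def)
  qed
  finally show ?thesis .
qed

end

section \<open>Degrees, girth and the theorem\<close>

lemma card_neighbors_le_degree:
  assumes "finite E"
  shows "finite {w. {v, w} \<in> E}" "card {w. {v, w} \<in> E} \<le> vertex_degree E v"
proof -
  have inj: "inj_on (\<lambda>w. {v, w}) {w. {v, w} \<in> E}" by (auto simp: inj_on_def doubleton_eq_iff)
  have sub: "(\<lambda>w. {v, w}) ` {w. {v, w} \<in> E} \<subseteq> {e \<in> E. v \<in> e}" by auto
  have fin: "finite {e \<in> E. v \<in> e}" using assms by simp
  show "finite {w. {v, w} \<in> E}" using inj_on_finite[OF inj sub fin] .
  show "card {w. {v, w} \<in> E} \<le> vertex_degree E v"
    unfolding vertex_degree_def by (rule card_inj_on_le[OF inj sub fin])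
qed

lemma girth_le_length: "p \<in> cycles E \<Longrightarrow> girth E \<le> enat (length p)"
  unfolding girth_def by (rule INF_lower)

lemma no_triangle_if_girth:
  assumes "girth E \<ge> 5" "v \<noteq> a" "v \<noteq> b" "a \<noteq> b" "{v, a} \<in> E" "{v, b} \<in> E"
  shows "{a, b} \<notin> E"
proof
  assume "{a, b} \<in> E"
  with assms have "[v, a, b] \<in> cycles E"
    by (auto simp: cycles_def less_Suc_eq nth_Cons' insert_commute)
  from order_trans[OF assms(1) girth_le_length[OF this]] show False by (simp add: numeral_eq_enat)
qed

lemma no_square_if_girth:
  assumes "girth E \<ge> 5" "distinct [v, u, a, b]" "{v, u} \<in> E" "{u, a} \<in> E" "{v, b} \<in> E"
  shows "{a, b} \<notin> E"
proof
  assume "{a, b} \<in> E"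
  with assms have "[v, u, a, b] \<in> cycles E"
    by (auto simp: cycles_def less_Suc_eq nth_Cons' insert_commute)
  from order_trans[OF assms(1) girth_le_length[OF this]] show False by (simp add: numeral_eq_enat)
qed

theorem corollary1p3:
  fixes k :: nat
    and J :: "'a measure" and \<eta> :: "('a \<times> 'a) measure"
    and V :: "'v set" and E :: "'v set set"
  assumes "k \<ge> 1"
    and "markov_space J \<eta>"
    and "k_loose k J \<eta>"
    and "simple_graph V E"
    and "girth E \<ge> 5"
    and "\<forall>v\<in>V. vertex_degree E v \<le> k"
  shows "well_measured J \<eta> V E"
proof -
  interpret markov_space J \<eta> by fact
  obtain P where P: "transition_kernel J \<eta> P"
    and ac: "absolutely_continuous (\<Pi>\<^sub>M i\<in>{..<k}. marginal J \<eta>)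
      (marginal J \<eta> \<bind> (\<lambda>x. \<Pi>\<^sub>M i\<in>{..<k}. P x))"
    using assms(3) unfolding k_loose_def neighbor_distribution_def by blast
  interpret R: reversible_kernel J "marginal J \<eta>" P by (rule reversible_kernel_transition_kernel[OF P])
  define nbr where "nbr v = {w. {v, w} \<in> E}" for v
  have V: "finite V" and E: "\<And>e. e \<in> E \<Longrightarrow> e \<subseteq> V" "\<And>e. e \<in> E \<Longrightarrow> card e = 2"
    using assms(4) by (auto simp: simple_graph_def)
  have edge: "u \<noteq> v \<and> u \<in> V \<and> v \<in> V" if "{u, v} \<in> E" for u v
    using E(1)[OF that] E(2)[OF that] by auto
  have "finite E" using E(1) V by (intro finite_subset[of E "Pow V"]) auto
  note nbr_E = card_neighbors_le_degree[OF this, folded nbr_def]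
  have card_nbr: "card (nbr v) \<le> k" for v
  proof (cases "v \<in> V")
    case True
    then show ?thesis using nbr_E(2)[of v] assms(6) by (meson le_trans)
  next
    case False
    then have "nbr v = {}" using edge by (auto simp: nbr_def)
    then show ?thesis by simp
  qed
  define star_kernel where "star_kernel N \<rho> \<longleftrightarrow> finite_kernel (\<Pi>\<^sub>M i\<in>N. J) J \<rho> \<and>
    (\<forall>f\<in>borel_measurable ((\<Pi>\<^sub>M i\<in>N. J) \<Otimes>\<^sub>M J).
      (\<integral>\<^sup>+x. (\<integral>\<^sup>+y. f (y, x) \<partial>\<Pi>\<^sub>M i\<in>N. P x) \<partial>marginal J \<eta>) =
      (\<integral>\<^sup>+y. (\<integral>\<^sup>+x. f (y, x) \<partial>\<rho> y) \<partial>\<Pi>\<^sub>M i\<in>N. marginal J \<eta>))" for N :: "'v set" and \<rho>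
  define \<rho> where "\<rho> N = (SOME \<rho>. star_kernel N \<rho>)" for N
  have \<rho>: "star_kernel N (\<rho> N)" if "finite N" "card N \<le> k" for N
    unfolding \<rho>_def using R.star_kernel_exists[OF standard_borel ac that]
    by (intro someI_ex[of "star_kernel N"]) (simp only: star_kernel_def)
  have small: "finite N" "card N \<le> k" if "N \<subseteq> nbr v" for N v
    using that nbr_E(1)[of v] card_nbr[of v] card_mono[of "nbr v" N] by (auto intro: finite_subset)
  obtain vl where vl: "set vl = V" "distinct vl" using finite_distinct_list[OF V] by blast
  interpret O: ordered_star_system J "marginal J \<eta>" P nbr \<rho> V vl
  proof unfold_locales
    show "finite (nbr v)" "v \<notin> nbr v" for v using nbr_E(1) edge[of v v] by (auto simp: nbr_def)
    show sym: "v \<in> nbr u" if "u \<in> nbr v" for u v using that by (simp add: nbr_def insert_commute)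
    show "a \<notin> nbr b" if "a \<in> nbr v" "b \<in> nbr v" for a b v
      using that no_triangle_if_girth[OF assms(5), of v b a] edge[of v a] edge[of v b] edge[of b a]
      by (auto simp: nbr_def)
    show "a \<notin> nbr b" if *: "u \<in> nbr v" "a \<in> nbr u" "a \<noteq> v" "b \<in> nbr v" "b \<noteq> u" for a b u v
    proof
      assume "a \<in> nbr b"
      then have "distinct [v, u, a, b]" using * edge by (auto simp: nbr_def)
      from no_square_if_girth[OF assms(5) this] * \<open>a \<in> nbr b\<close> show False
        by (simp add: nbr_def insert_commute)
    qed
    show "finite_kernel (\<Pi>\<^sub>M i\<in>N. J) J (\<rho> N)" if "N \<subseteq> nbr v" for N v
      using \<rho>[OF small[OF that]] by (simp only: star_kernel_def)
    show "(\<integral>\<^sup>+x. (\<integral>\<^sup>+y. f (y, x) \<partial>\<Pi>\<^sub>M i\<in>N. P x) \<partial>marginal J \<eta>) =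
      (\<integral>\<^sup>+y. (\<integral>\<^sup>+x. f (y, x) \<partial>\<rho> N y) \<partial>\<Pi>\<^sub>M i\<in>N. marginal J \<eta>)"
      if "N \<subseteq> nbr v" "f \<in> borel_measurable ((\<Pi>\<^sub>M i\<in>N. J) \<Otimes>\<^sub>M J)" for N v f
      by (rule bspec[OF conjunct2[OF \<rho>[OF small[OF that(1)], unfolded star_kernel_def]] that(2)])
  qed (rule standard_borel vl)+
  have edges: "O.family {i, j} = distr \<eta> (\<Pi>\<^sub>M l\<in>{i, j}. J) (\<lambda>(x, y). \<lambda>l\<in>{i, j}. if l = i then x else y)"
    if ij: "{i, j} \<in> E" for i j
  proof (rule measure_eqI_nn_integral_distr)
    have ijV: "i \<in> V" "j \<in> V" "i \<noteq> j" using edge[OF ij] by auto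
    show "sets (O.family {i, j}) = sets (\<Pi>\<^sub>M l\<in>{i, j}. J)" using ijV by (intro O.sets_family) auto
    let ?T = "\<lambda>(x, y). \<lambda>l\<in>{i, j}. if l = i then x else y"
    have T: "?T \<in> J \<Otimes>\<^sub>M J \<rightarrow>\<^sub>M (\<Pi>\<^sub>M l\<in>{i, j}. J)"
      unfolding case_prod_beta' by (intro measurable_restrict) auto
    then show "?T \<in> \<eta> \<rightarrow>\<^sub>M (\<Pi>\<^sub>M l\<in>{i, j}. J)" unfolding measurable_cong_sets[OF sets_eta refl] .
    fix h :: "('v \<Rightarrow> 'a) \<Rightarrow> ennreal" assume h: "h \<in> borel_measurable (\<Pi>\<^sub>M l\<in>{i, j}. J)"
    have upd: "(\<lambda>_. undefined)(j := y, i := x) = ?T (x, y)" for x y using ijV(3) by auto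
    have "(\<integral>\<^sup>+z. h z \<partial>O.family {i, j})
      = (\<integral>\<^sup>+x. (\<integral>\<^sup>+y. h (?T (x, y)) \<partial>P x) \<partial>marginal J \<eta>)"
      unfolding upd[symmetric] using ij ijV h by (intro O.nn_integral_family_edge) (simp_all add: nbr_def)
    also have "\<dots> = (\<integral>\<^sup>+z. h (?T z) \<partial>\<eta>)"
      by (rule nn_integral_eta[OF P measurable_compose[OF T h], symmetric])
    finally show "(\<integral>\<^sup>+z. h z \<partial>O.family {i, j}) = (\<integral>\<^sup>+z. h (?T z) \<partial>\<eta>)" .
  qed
  have "normalized J \<eta> V E O.family"
    unfolding normalized_def by (intro conjI ballI allI impI O.family_singleton O.family_empty edges)
  moreover have "measure_family J V O.family"
    unfolding measure_family_def by (intro allI impI conjI O.sets_family O.sigma_finite_family)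
  moreover have "markovian J V E O.family"
    by (rule O.markovian_family) (simp add: nbr_def)
  ultimately show ?thesis
    unfolding well_measured_def by (intro exI[of _ O.family] conjI O.decreasing_family)
qed

end
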